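(* Let $(P,A,\mathcal T)$ be an extendable poset with admissible system $\mathcal R$. The category $\mathcal U$ of socle-projective right $\Lambda(\mathcal R)$-modules is equivalent to $\mathrm{Rep}(P,A,\mathcal T)$.
   Context: $K$ is a field, $A$ a finite-dimensional $K$-algebra, $P$ a finite poset. A $P$-multiplicative system over $A$ is a family $\mathcal R=\{\mathcal R_{i,j}\subseteq A\mid i\le j\}$ of $K$-subspaces with (M.1) $\mathcal R_{i,j}\mathcal R_{j,l}\subseteq\mathcal R_{i,l}$ for $i\le j\le l$; (M.2) each $\mathcal R_i=\mathcal R_{i,i}$ is a $K$-algebra with unit $1_i$ such that $1_ir=r=r1_j$ for $r\in\mathcal R_{i,j}$. Then $(P,A,\mathcal R)$ is called an algebraically equipped poset. Its incidence algebra is $\Lambda(\mathcal R)=\bigoplus_{i\le j}e_{i,j}\mathcal R_{i,j}$ ($e_{i,j}$ matrix units, matrix operations). $\mathrm{Rep}(P,A,\mathcal R)$: objects are collections $(L,L_i:i\in P)$ with $L$ a right $A$-module and $L_i\subseteq L$ $K$-subspaces such that $L_i\mathcal R_{i,j}\subseteq L_j$ for $i\le j$ and $a1_i=a$ for $a\in L_i$; morphisms are right $A$-module maps $h:L\to M$ with $h(L_i)\subseteq M_i$ for all $i$. For a poset with greatest element $m$, a multiplicative system is admissible if (A.1) each $\mathcal R_i$ is a division ring; (A.2) if $j<m$ and $0\ne x\in\mathcal R_{i,j}$, there is $y\in\mathcal R_{j,l}$, $l\ne j$, with $xy\ne0$. $P^m$ is $P$ with a greatest element $m$ added, and $\mathcal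 T^m$ is the $P^m$-multiplicative system with $\mathcal T_{i,j}$ for $i\le j$ in $P$ and $\mathcal T_{i,m}=A$ for all $i\in P^m$. $(P,A,\mathcal T)$ is extendable with admissible system $\mathcal R$ if $A$ is semisimple with exactly one simple module up to isomorphism, this simple module being $\varepsilon_mA$, each $\mathcal T_i=\mathcal T_{i,i}$ ($i\in P$) is a subalgebra of $A$ (with the same unit), and there are idempotents $\varepsilon_i\in\mathcal T_i$ ($i\in P^m$) such that $\mathcal R=\{\mathcal R_{i,j}=\varepsilon_i\mathcal T_{i,j}\varepsilon_j\mid i\le j\in P^m\}$ is an admissible system and $\Lambda(\mathcal R)$ is Morita equivalent to $\Lambda(\mathcal T^m)$. A right module is socle-projective if its socle is projective; $\mathcal U$ is the full subcategory of right $\Lambda(\mathcal R)$-modules (of arbitrary dimension) with this property. *)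

theory Defs
  imports "HOL-Algebra.Module" "HOL-Algebra.Subrings" "HOL-Library.Equipollence"
begin

section \<open>Right modules\<close>

text \<open>The library locale \<open>module\<close> covers only modules over commutative rings. As there, the fields
  \<open>mult\<close> and \<open>one\<close> inherited from the record \<open>ring\<close> play no role.\<close>

record ('r, 'v) rmodule = "'v ring" +
  act :: "'v \<Rightarrow> 'r \<Rightarrow> 'v" (infixl \<open>\<cdot>\<index>\<close> 70)

locale right_module = R?: ring R + M?: abelian_group M
  for R :: "('r, 'c) ring_scheme" (structure) and M :: "('r, 'v) rmodule" (structure) +
  assumes act_closed: "\<lbrakk>x \<in> carrier M; a \<in> carrier R\<rbrakk> \<Longrightarrow> x \<cdot>\<^bsub>M\<^esub> a \<in> carrier M"
    and act_add: "\<lbrakk>x \<in> carrier M; a \<in> carrier R; b \<in> carrier R\<rbrakk> \<Longrightarrow>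
      x \<cdot>\<^bsub>M\<^esub> (a \<oplus>\<^bsub>R\<^esub> b) = x \<cdot>\<^bsub>M\<^esub> a \<oplus>\<^bsub>M\<^esub> x \<cdot>\<^bsub>M\<^esub> b"
    and add_act: "\<lbrakk>x \<in> carrier M; y \<in> carrier M; a \<in> carrier R\<rbrakk> \<Longrightarrow>
      (x \<oplus>\<^bsub>M\<^esub> y) \<cdot>\<^bsub>M\<^esub> a = x \<cdot>\<^bsub>M\<^esub> a \<oplus>\<^bsub>M\<^esub> y \<cdot>\<^bsub>M\<^esub> a"
    and act_assoc: "\<lbrakk>x \<in> carrier M; a \<in> carrier R; b \<in> carrier R\<rbrakk> \<Longrightarrow>
      x \<cdot>\<^bsub>M\<^esub> (a \<otimes>\<^bsub>R\<^esub> b) = (x \<cdot>\<^bsub>M\<^esub> a) \<cdot>\<^bsub>M\<^esub> b"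
    and act_one: "x \<in> carrier M \<Longrightarrow> x \<cdot>\<^bsub>M\<^esub> \<one>\<^bsub>R\<^esub> = x"

text \<open>Homomorphisms are \<open>undefined\<close> outside the carrier of the domain, so that equality of functions
  is equality of homomorphisms.\<close>

definition rmod_hom ::
  "('r, 'c) ring_scheme \<Rightarrow> ('r, 'v) rmodule \<Rightarrow> ('r, 'w) rmodule \<Rightarrow> ('v \<Rightarrow> 'w) set" where
  "rmod_hom R M N = {h \<in> carrier M \<rightarrow>\<^sub>E carrier N.
     (\<forall>x\<in>carrier M. \<forall>y\<in>carrier M. h (x \<oplus>\<^bsub>M\<^esub> y) = h x \<oplus>\<^bsub>N\<^esub> h y) \<and>
     (\<forall>x\<in>carrier M. \<forall>a\<in>carrier R. h (x \<cdot>\<^bsub>M\<^esub> a) = h x \<cdot>\<^bsub>N\<^esub> a)}"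

definition rmod_isomorphic ::
  "('r, 'c) ring_scheme \<Rightarrow> ('r, 'v) rmodule \<Rightarrow> ('r, 'w) rmodule \<Rightarrow> bool" where
  "rmod_isomorphic R M N \<longleftrightarrow> (\<exists>h\<in>rmod_hom R M N. bij_betw h (carrier M) (carrier N))"

definition rsubmodule :: "'v set \<Rightarrow> ('r, 'c) ring_scheme \<Rightarrow> ('r, 'v) rmodule \<Rightarrow> bool" where
  "rsubmodule N R M \<longleftrightarrow> subgroup N (add_monoid M) \<and> (\<forall>x\<in>N. \<forall>a\<in>carrier R. x \<cdot>\<^bsub>M\<^esub> a \<in> N)"

definition simple_rmodule :: "('r, 'c) ring_scheme \<Rightarrow> ('r, 'v) rmodule \<Rightarrow> bool" where
  "simple_rmodule R M \<longleftrightarrow> right_module R M \<and> carrier M \<noteq> {\<zero>\<^bsub>M\<^esub>} \<and>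
     (\<forall>N. rsubmodule N R M \<longrightarrow> N = {\<zero>\<^bsub>M\<^esub>} \<or> N = carrier M)"

text \<open>The sum of all simple submodules, as the least submodule containing them.\<close>

definition socle :: "('r, 'c) ring_scheme \<Rightarrow> ('r, 'v) rmodule \<Rightarrow> 'v set" where
  "socle R M = \<Inter> {N. rsubmodule N R M \<and>
     (\<forall>S. rsubmodule S R M \<and> simple_rmodule R (M\<lparr>carrier := S\<rparr>) \<longrightarrow> S \<subseteq> N)}"

definition semisimple_rmodule :: "('r, 'c) ring_scheme \<Rightarrow> ('r, 'v) rmodule \<Rightarrow> bool" where
  "semisimple_rmodule R M \<longleftrightarrow> right_module R M \<and> socle R M = carrier M"

definition regular_rmodule :: "('r, 'c) ring_scheme \<Rightarrow> ('r, 'r) rmodule" where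
  "regular_rmodule R = \<lparr>carrier = carrier R, mult = mult R, one = one R,
     zero = zero R, add = add R, act = mult R\<rparr>"

definition principal_rmodule :: "('r, 'c) ring_scheme \<Rightarrow> 'r \<Rightarrow> ('r, 'r) rmodule" where
  "principal_rmodule R e = (regular_rmodule R)\<lparr>carrier := {e \<otimes>\<^bsub>R\<^esub> a | a. a \<in> carrier R}\<rparr>"

definition semisimple_ring :: "('r, 'c) ring_scheme \<Rightarrow> bool" where
  "semisimple_ring R \<longleftrightarrow> ring R \<and> semisimple_rmodule R (regular_rmodule R)"

text \<open>A simple module is cyclic, hence isomorphic to one whose carrier is a set of representatives in
  the ring. It is therefore enough that \<open>S\<close> ranges over modules with elements in the type of the ring.\<close>

definition unique_simple_rmodule ::
  "('r, 'c) ring_scheme \<Rightarrow> ('r, 'r) rmodule \<Rightarrow> bool" where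
  "unique_simple_rmodule R M \<longleftrightarrow> simple_rmodule R M \<and>
     (\<forall>S :: ('r, 'r) rmodule. simple_rmodule R S \<longrightarrow> rmod_isomorphic R S M)"

text \<open>The lifting problems range over modules with elements in the type \<open>'v\<close> of the elements of \<open>M\<close>.
  This is projectivity in the usual sense when \<open>'v\<close> is infinite and at least as large as the ring.\<close>

definition projective_rmodule :: "('r, 'c) ring_scheme \<Rightarrow> ('r, 'v) rmodule \<Rightarrow> bool" where
  "projective_rmodule R M \<longleftrightarrow> right_module R M \<and>
     (\<forall>(X :: ('r, 'v) rmodule) (Y :: ('r, 'v) rmodule). \<forall>g\<in>rmod_hom R X Y. \<forall>f\<in>rmod_hom R M Y.
        right_module R X \<and> right_module R Y \<and> g ` carrier X = carrier Y \<longrightarrow>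
        (\<exists>h\<in>rmod_hom R M X. compose (carrier M) g h = f))"

definition socle_projective :: "('r, 'c) ring_scheme \<Rightarrow> ('r, 'v) rmodule \<Rightarrow> bool" where
  "socle_projective R M \<longleftrightarrow> right_module R M \<and> projective_rmodule R (M\<lparr>carrier := socle R M\<rparr>)"


section \<open>Categories\<close>

text \<open>Hom-sets of different pairs of objects may overlap (a function does not determine its codomain),
  so composition and the arrow part of a functor take the objects as arguments:
  \<open>Comp C X Y Z g f\<close> is the composite of \<open>f \<in> Hom C X Y\<close> with \<open>g \<in> Hom C Y Z\<close>.\<close>

record ('o, 'm) cat =
  Ob :: "'o set"
  Hom :: "'o \<Rightarrow> 'o \<Rightarrow> 'm set"
  Id :: "'o \<Rightarrow> 'm"
  Comp :: "'o \<Rightarrow> 'o \<Rightarrow> 'o \<Rightarrow> 'm \<Rightarrow> 'm \<Rightarrow> 'm"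

locale category =
  fixes C :: "('o, 'm) cat"
  assumes Id_in: "X \<in> Ob C \<Longrightarrow> Id C X \<in> Hom C X X"
    and Comp_in: "\<lbrakk>X \<in> Ob C; Y \<in> Ob C; Z \<in> Ob C; f \<in> Hom C X Y; g \<in> Hom C Y Z\<rbrakk> \<Longrightarrow>
      Comp C X Y Z g f \<in> Hom C X Z"
    and Comp_Id: "\<lbrakk>X \<in> Ob C; Y \<in> Ob C; f \<in> Hom C X Y\<rbrakk> \<Longrightarrow> Comp C X X Y f (Id C X) = f"
    and Id_Comp: "\<lbrakk>X \<in> Ob C; Y \<in> Ob C; f \<in> Hom C X Y\<rbrakk> \<Longrightarrow> Comp C X Y Y (Id C Y) f = f"
    and Comp_assoc: "\<lbrakk>W \<in> Ob C; X \<in> Ob C; Y \<in> Ob C; Z \<in> Ob C;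
        f \<in> Hom C W X; g \<in> Hom C X Y; h \<in> Hom C Y Z\<rbrakk> \<Longrightarrow>
      Comp C W Y Z h (Comp C W X Y g f) = Comp C W X Z (Comp C X Y Z h g) f"

locale cat_functor = C: category C + D: category D
  for C :: "('o, 'm) cat" and D :: "('p, 'n) cat" +
  fixes Fo :: "'o \<Rightarrow> 'p" and Fm :: "'o \<Rightarrow> 'o \<Rightarrow> 'm \<Rightarrow> 'n"
  assumes Fo_in: "X \<in> Ob C \<Longrightarrow> Fo X \<in> Ob D"
    and Fm_in: "\<lbrakk>X \<in> Ob C; Y \<in> Ob C; f \<in> Hom C X Y\<rbrakk> \<Longrightarrow> Fm X Y f \<in> Hom D (Fo X) (Fo Y)"
    and Fm_Id: "X \<in> Ob C \<Longrightarrow> Fm X X (Id C X) = Id D (Fo X)"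
    and Fm_Comp: "\<lbrakk>X \<in> Ob C; Y \<in> Ob C; Z \<in> Ob C; f \<in> Hom C X Y; g \<in> Hom C Y Z\<rbrakk> \<Longrightarrow>
      Fm X Z (Comp C X Y Z g f) = Comp D (Fo X) (Fo Y) (Fo Z) (Fm Y Z g) (Fm X Y f)"

definition iso_arrow :: "('o, 'm) cat \<Rightarrow> 'o \<Rightarrow> 'o \<Rightarrow> 'm \<Rightarrow> bool" where
  "iso_arrow C X Y f \<longleftrightarrow> f \<in> Hom C X Y \<and>
     (\<exists>g\<in>Hom C Y X. Comp C X Y X g f = Id C X \<and> Comp C Y X Y f g = Id C Y)"

definition natural_iso ::
  "('o, 'm) cat \<Rightarrow> ('p, 'n) cat \<Rightarrow> ('o \<Rightarrow> 'p) \<Rightarrow> ('o \<Rightarrow> 'o \<Rightarrow> 'm \<Rightarrow> 'n) \<Rightarrow>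
    ('o \<Rightarrow> 'p) \<Rightarrow> ('o \<Rightarrow> 'o \<Rightarrow> 'm \<Rightarrow> 'n) \<Rightarrow> ('o \<Rightarrow> 'n) \<Rightarrow> bool" where
  "natural_iso C D Fo Fm Go Gm \<eta> \<longleftrightarrow>
     (\<forall>X\<in>Ob C. iso_arrow D (Fo X) (Go X) (\<eta> X)) \<and>
     (\<forall>X\<in>Ob C. \<forall>Y\<in>Ob C. \<forall>f\<in>Hom C X Y.
        Comp D (Fo X) (Fo Y) (Go Y) (\<eta> Y) (Fm X Y f) =
        Comp D (Fo X) (Go X) (Go Y) (Gm X Y f) (\<eta> X))"

definition equivalent_categories :: "('o, 'm) cat \<Rightarrow> ('p, 'n) cat \<Rightarrow> bool" where
  "equivalent_categories C D \<longleftrightarrow>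
     (\<exists>Fo Fm Go Gm \<eta> \<epsilon>. cat_functor C D Fo Fm \<and> cat_functor D C Go Gm \<and>
        natural_iso C C (\<lambda>X. X) (\<lambda>X Y f. f) (\<lambda>X. Go (Fo X)) (\<lambda>X Y f. Gm (Fo X) (Fo Y) (Fm X Y f)) \<eta> \<and>
        natural_iso D D (\<lambda>X. Fo (Go X)) (\<lambda>X Y f. Fm (Go X) (Go Y) (Gm X Y f)) (\<lambda>X. X) (\<lambda>X Y f. f) \<epsilon>)"

definition full_subcategory :: "('o, 'm) cat \<Rightarrow> ('o \<Rightarrow> bool) \<Rightarrow> ('o, 'm) cat" where
  "full_subcategory C Q = C\<lparr>Ob := {X \<in> Ob C. Q X}\<rparr>"

text \<open>The type \<open>'v\<close> of the elements of the modules plays the role of a universe of sets: the objects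
  are all right \<open>R\<close>-modules, of any dimension, whose carrier is a subset of \<open>'v\<close>.\<close>

definition mod_category :: "('r, 'c) ring_scheme \<Rightarrow> (('r, 'v) rmodule, 'v \<Rightarrow> 'v) cat" where
  "mod_category R = \<lparr>Ob = {M. right_module R M}, Hom = rmod_hom R,
     Id = (\<lambda>M. restrict id (carrier M)), Comp = (\<lambda>L M N g f. compose (carrier L) g f)\<rparr>"

definition morita_equivalent ::
  "'v itself \<Rightarrow> ('r, 'c) ring_scheme \<Rightarrow> ('s, 'd) ring_scheme \<Rightarrow> bool" where
  "morita_equivalent _ R S \<longleftrightarrow> ring R \<and> ring S \<and>
     equivalent_categories
       (mod_category R :: (('r, 'v) rmodule, 'v \<Rightarrow> 'v) cat)
       (mod_category S :: (('s, 'v) rmodule, 'v \<Rightarrow> 'v) cat)"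

definition socle_projective_category ::
  "('r, 'c) ring_scheme \<Rightarrow> (('r, 'v) rmodule, 'v \<Rightarrow> 'v) cat" where
  "socle_projective_category R = full_subcategory (mod_category R) (socle_projective R)"


section \<open>Algebraically equipped posets\<close>

text \<open>The library locale \<open>algebra\<close> is restricted to commutative algebras.\<close>

locale fin_dim_algebra = field K + module K A + A: ring A
  for K :: "('k, 'c) ring_scheme" (structure) and A :: "('k, 'a) module" (structure) +
  assumes smult_mult: "\<lbrakk>k \<in> carrier K; x \<in> carrier A; y \<in> carrier A\<rbrakk> \<Longrightarrow>
      (k \<odot>\<^bsub>A\<^esub> x) \<otimes>\<^bsub>A\<^esub> y = k \<odot>\<^bsub>A\<^esub> (x \<otimes>\<^bsub>A\<^esub> y)"
    and mult_smult: "\<lbrakk>k \<in> carrier K; x \<in> carrier A; y \<in> carrier A\<rbrakk> \<Longrightarrow>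
      x \<otimes>\<^bsub>A\<^esub> (k \<odot>\<^bsub>A\<^esub> y) = k \<odot>\<^bsub>A\<^esub> (x \<otimes>\<^bsub>A\<^esub> y)"
    and fin_dim: "\<exists>B. finite B \<and> B \<subseteq> carrier A \<and>
      (\<forall>x\<in>carrier A. \<exists>c\<in>B \<rightarrow> carrier K. x = (\<Oplus>\<^bsub>A\<^esub>b\<in>B. c b \<odot>\<^bsub>A\<^esub> b))"

definition finite_poset :: "'p set \<Rightarrow> 'p rel \<Rightarrow> bool" where
  "finite_poset P r \<longleftrightarrow> finite P \<and> partial_order_on P r"

definition multiplicative_system :: "'p set \<Rightarrow> 'p rel \<Rightarrow> ('k, 'c) ring_scheme \<Rightarrow>
    ('k, 'a) module \<Rightarrow> ('p \<Rightarrow> 'p \<Rightarrow> 'a set) \<Rightarrow> bool" where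
  "multiplicative_system P r K A \<R> \<longleftrightarrow>
     (\<forall>(i, j)\<in>r. submodule (\<R> i j) K A) \<and>
     (\<forall>i j l. (i, j) \<in> r \<and> (j, l) \<in> r \<longrightarrow>
        (\<forall>x\<in>\<R> i j. \<forall>y\<in>\<R> j l. x \<otimes>\<^bsub>A\<^esub> y \<in> \<R> i l)) \<and>
     (\<exists>u. (\<forall>i\<in>P. u i \<in> \<R> i i) \<and>
        (\<forall>(i, j)\<in>r. \<forall>x\<in>\<R> i j. u i \<otimes>\<^bsub>A\<^esub> x = x \<and> x \<otimes>\<^bsub>A\<^esub> u j = x))"

text \<open>The unit of \<open>\<R> i i\<close>, which may differ from the unit of \<open>A\<close>.\<close>

definition local_one :: "('k, 'a) module \<Rightarrow> ('p \<Rightarrow> 'p \<Rightarrow> 'a set) \<Rightarrow> 'p \<Rightarrow> 'a" where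
  "local_one A \<R> i = (THE u. u \<in> \<R> i i \<and> (\<forall>x\<in>\<R> i i. u \<otimes>\<^bsub>A\<^esub> x = x \<and> x \<otimes>\<^bsub>A\<^esub> u = x))"

definition algebraically_equipped_poset :: "'p set \<Rightarrow> 'p rel \<Rightarrow> ('k, 'c) ring_scheme \<Rightarrow>
    ('k, 'a) module \<Rightarrow> ('p \<Rightarrow> 'p \<Rightarrow> 'a set) \<Rightarrow> bool" where
  "algebraically_equipped_poset P r K A \<R> \<longleftrightarrow>
     finite_poset P r \<and> fin_dim_algebra K A \<and> multiplicative_system P r K A \<R>"

text \<open>Elements of the incidence algebra are matrices that vanish at all positions \<open>(i, j) \<notin> r\<close>.\<close>

definition incidence_algebra :: "'p set \<Rightarrow> 'p rel \<Rightarrow> ('k, 'a) module \<Rightarrow>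
    ('p \<Rightarrow> 'p \<Rightarrow> 'a set) \<Rightarrow> ('k, 'p \<Rightarrow> 'p \<Rightarrow> 'a) module" where
  "incidence_algebra P r A \<R> =
    \<lparr>carrier = {X. \<forall>i j. if (i, j) \<in> r then X i j \<in> \<R> i j else X i j = \<zero>\<^bsub>A\<^esub>},
     mult = (\<lambda>X Y i j. \<Oplus>\<^bsub>A\<^esub>l\<in>P. X i l \<otimes>\<^bsub>A\<^esub> Y l j),
     one = (\<lambda>i j. if i = j \<and> i \<in> P then local_one A \<R> i else \<zero>\<^bsub>A\<^esub>),
     zero = (\<lambda>i j. \<zero>\<^bsub>A\<^esub>),
     add = (\<lambda>X Y i j. X i j \<oplus>\<^bsub>A\<^esub> Y i j),
     smult = (\<lambda>k X i j. k \<odot>\<^bsub>A\<^esub> X i j)\<rparr>"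

text \<open>A right \<open>A\<close>-module \<open>L\<close> is a \<open>K\<close>-vector space via \<open>k x = x (k 1)\<close>.\<close>

definition rmod_subspace ::
  "'v set \<Rightarrow> ('k, 'c) ring_scheme \<Rightarrow> ('k, 'a) module \<Rightarrow> ('a, 'v) rmodule \<Rightarrow> bool" where
  "rmod_subspace V K A L \<longleftrightarrow> subgroup V (add_monoid L) \<and>
     (\<forall>k\<in>carrier K. \<forall>x\<in>V. x \<cdot>\<^bsub>L\<^esub> (k \<odot>\<^bsub>A\<^esub> \<one>\<^bsub>A\<^esub>) \<in> V)"

definition rep_category :: "'p set \<Rightarrow> 'p rel \<Rightarrow> ('k, 'c) ring_scheme \<Rightarrow> ('k, 'a) module \<Rightarrow>
    ('p \<Rightarrow> 'p \<Rightarrow> 'a set) \<Rightarrow> (('a, 'v) rmodule \<times> ('p \<Rightarrow> 'v set), 'v \<Rightarrow> 'v) cat" where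
  "rep_category P r K A \<R> =
    \<lparr>Ob = {(L, V). right_module A L \<and>
        (\<forall>i\<in>P. rmod_subspace (V i) K A L \<and> (\<forall>x\<in>V i. x \<cdot>\<^bsub>L\<^esub> local_one A \<R> i = x)) \<and>
        (\<forall>(i, j)\<in>r. \<forall>x\<in>V i. \<forall>a\<in>\<R> i j. x \<cdot>\<^bsub>L\<^esub> a \<in> V j)},
     Hom = (\<lambda>(L, V) (M, W). {h \<in> rmod_hom A L M. \<forall>i\<in>P. h ` V i \<subseteq> W i}),
     Id = (\<lambda>(L, V). restrict id (carrier L)),
     Comp = (\<lambda>(L, V) Y Z g f. compose (carrier L) g f)\<rparr>"

definition greatest_in :: "'p set \<Rightarrow> 'p rel \<Rightarrow> 'p \<Rightarrow> bool" where
  "greatest_in P r m \<longleftrightarrow> m \<in> P \<and> (\<forall>i\<in>P. (i, m) \<in> r)"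

text \<open>The third conjunct says that each \<open>\<R> i i\<close> is a division ring; in particular its unit is
  nonzero.\<close>

definition admissible_system :: "'p set \<Rightarrow> 'p rel \<Rightarrow> 'p \<Rightarrow> ('k, 'c) ring_scheme \<Rightarrow>
    ('k, 'a) module \<Rightarrow> ('p \<Rightarrow> 'p \<Rightarrow> 'a set) \<Rightarrow> bool" where
  "admissible_system P r m K A \<R> \<longleftrightarrow>
     greatest_in P r m \<and> algebraically_equipped_poset P r K A \<R> \<and>
     (\<forall>i\<in>P. Units (A\<lparr>carrier := \<R> i i, one := local_one A \<R> i\<rparr>) = \<R> i i - {\<zero>\<^bsub>A\<^esub>}) \<and>
     (\<forall>(i, j)\<in>r. j \<noteq> m \<longrightarrow> (\<forall>x\<in>\<R> i j. x \<noteq> \<zero>\<^bsub>A\<^esub> \<longrightarrow>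
        (\<exists>l. (j, l) \<in> r \<and> l \<noteq> j \<and> (\<exists>y\<in>\<R> j l. x \<otimes>\<^bsub>A\<^esub> y \<noteq> \<zero>\<^bsub>A\<^esub>))))"

text \<open>The poset \<open>P\<close> with the greatest element \<open>None\<close> added.\<close>

definition top_carrier :: "'p set \<Rightarrow> 'p option set" where
  "top_carrier P = insert None (Some ` P)"

definition top_order :: "'p set \<Rightarrow> 'p rel \<Rightarrow> 'p option rel" where
  "top_order P r = {(Some i, Some j) | i j. (i, j) \<in> r} \<union> top_carrier P \<times> {None}"

text \<open>The third equation concerns a position outside the order and is immaterial.\<close>

fun top_system :: "('k, 'a) module \<Rightarrow> ('p \<Rightarrow> 'p \<Rightarrow> 'a set) \<Rightarrow> 'p option \<Rightarrow> 'p option \<Rightarrow> 'a set" where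
  "top_system A \<T> i None = carrier A"
| "top_system A \<T> (Some i) (Some j) = \<T> i j"
| "top_system A \<T> None (Some j) = {\<zero>\<^bsub>A\<^esub>}"

definition extendable_with :: "'v itself \<Rightarrow> 'p set \<Rightarrow> 'p rel \<Rightarrow> ('k, 'c) ring_scheme \<Rightarrow>
    ('k, 'a) module \<Rightarrow> ('p \<Rightarrow> 'p \<Rightarrow> 'a set) \<Rightarrow> ('p option \<Rightarrow> 'p option \<Rightarrow> 'a set) \<Rightarrow> bool" where
  "extendable_with TV P r K A \<T> \<R> \<longleftrightarrow>
     algebraically_equipped_poset P r K A \<T> \<and>
     semisimple_ring A \<and>
     (\<forall>i\<in>P. subring (\<T> i i) A) \<and>
     (\<exists>e. (\<forall>i\<in>top_carrier P. e i \<in> top_system A \<T> i i \<and> e i \<otimes>\<^bsub>A\<^esub> e i = e i) \<and>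
        unique_simple_rmodule A (principal_rmodule A (e None)) \<and>
        (\<forall>(i, j)\<in>top_order P r. \<R> i j = {e i \<otimes>\<^bsub>A\<^esub> t \<otimes>\<^bsub>A\<^esub> e j | t. t \<in> top_system A \<T> i j})) \<and>
     admissible_system (top_carrier P) (top_order P r) None K A \<R> \<and>
     morita_equivalent TV
       (incidence_algebra (top_carrier P) (top_order P r) A \<R>)
       (incidence_algebra (top_carrier P) (top_order P r) A (top_system A \<T>))"

end

theory Submission
  imports Defs
begin

text \<open>The socle of \<open>M\<close> is projective iff every simple submodule of \<open>M\<close> is projective: one direction
  uses that a simple submodule is a direct summand of the socle, the other builds a lifting from
  liftings on the simple submodules, and both come from Zorn's lemma. The second condition can be
  stated in terms of objects and arrows only, so it passes along the Morita equivalence from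
  \<open>\<Lambda>(\<R>)\<close> to \<open>\<Lambda>(\<T>\<^sup>m)\<close>.

  Over \<open>\<Lambda>(\<T>\<^sup>m)\<close>, let \<open>e\<^sub>i\<^sub>m\<close> be the matrix unit with entry \<open>1\<close> at \<open>(i, m)\<close>. The \<open>x\<close> with \<open>x e\<^sub>i\<^sub>m = 0\<close>
  for all \<open>i\<close> form a submodule. A simple module annihilated in this way is not projective, because the
  regular module contains no such element; any other simple module is a simple \<open>A\<close>-module at the
  vertex \<open>m\<close>, hence isomorphic to \<open>\<epsilon>\<^sub>mA\<close> and projective. So the condition on \<open>M\<close> says that an element
  is determined by its images under all \<open>e\<^sub>i\<^sub>m\<close>. For such modules \<open>M \<mapsto> (M e\<^sub>m\<^sub>m, M e\<^sub>i\<^sub>m)\<close> is an equivalence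
  to representations; its inverse sends \<open>(L, L\<^sub>i)\<close> to the direct sum of \<open>L\<close> and all \<open>L\<^sub>i\<close>.\<close>

section \<open>Equivalences of categories\<close>

text \<open>Equivalences are handled as fully faithful, essentially surjective functors: these
  compose and restrict to full subcategories without a quasi-inverse having to be carried along, and
  a quasi-inverse is chosen once at the end. Two obstacles shape the module theory. Modules may be
  infinite-dimensional, so a nonzero submodule annihilated by all \<open>e\<^sub>i\<^sub>m\<close>
  need not have finite length, yet it must contain a simple submodule; this comes from the
  descending chain condition on right ideals of the finite-dimensional algebra
  \<open>\<Lambda>(\<T>\<^sup>m)\<close>, applied to a cyclic submodule. And all modules have their
  elements in one fixed type, so the regular module, against which non-projectivity is tested, and
  the direct sum that inverts the functor must first be copied into that type. This is possible
  because the type is infinite and at least as large as \<open>A\<close>, while the poset is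
  finite.\<close>

locale weak_equivalence = cat_functor C D Fo Fm
  for C :: "('o, 'm) cat" and D :: "('p, 'n) cat"
    and Fo :: "'o \<Rightarrow> 'p" and Fm :: "'o \<Rightarrow> 'o \<Rightarrow> 'm \<Rightarrow> 'n" +
  assumes faithful: "\<lbrakk>X \<in> Ob C; Y \<in> Ob C; f \<in> Hom C X Y; g \<in> Hom C X Y; Fm X Y f = Fm X Y g\<rbrakk> \<Longrightarrow> f = g"
    and full: "\<lbrakk>X \<in> Ob C; Y \<in> Ob C; d \<in> Hom D (Fo X) (Fo Y)\<rbrakk> \<Longrightarrow> \<exists>f\<in>Hom C X Y. Fm X Y f = d"
    and ess_surj: "Z \<in> Ob D \<Longrightarrow> \<exists>X\<in>Ob C. \<exists>u. iso_arrow D (Fo X) Z u"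

section \<open>Isomorphisms: inverses, composites and cancellation\<close>

context category
begin

lemma iso_arrow_Id: "X \<in> Ob C \<Longrightarrow> iso_arrow C X X (Id C X)"
  unfolding iso_arrow_def using Id_in Comp_Id by metis

lemma iso_arrow_inverse:
  assumes "iso_arrow C X Y f" "X \<in> Ob C" "Y \<in> Ob C"
  obtains g where "iso_arrow C Y X g" "Comp C X Y X g f = Id C X" "Comp C Y X Y f g = Id C Y"
    "f \<in> Hom C X Y" "g \<in> Hom C Y X"
  using assms unfolding iso_arrow_def by metis

lemma iso_arrow_Comp:
  assumes f: "iso_arrow C X Y f" and g: "iso_arrow C Y Z g" and o: "X \<in> Ob C" "Y \<in> Ob C" "Z \<in> Ob C"
  shows "iso_arrow C X Z (Comp C X Y Z g f)"
proof -
  obtain f' where f': "Comp C X Y X f' f = Id C X" "Comp C Y X Y f f' = Id C Y"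
      "f \<in> Hom C X Y" "f' \<in> Hom C Y X"
    using iso_arrow_inverse[OF f o(1,2)] by metis
  obtain g' where g': "Comp C Y Z Y g' g = Id C Y" "Comp C Z Y Z g g' = Id C Z"
      "g \<in> Hom C Y Z" "g' \<in> Hom C Z Y"
    using iso_arrow_inverse[OF g o(2,3)] by metis
  have 1: "Comp C X Y Z g f \<in> Hom C X Z" "Comp C Z Y X f' g' \<in> Hom C Z X"
    using Comp_in o f' g' by auto
  have "Comp C X Z X (Comp C Z Y X f' g') (Comp C X Y Z g f)
      = Comp C X Y X f' (Comp C X Z Y g' (Comp C X Y Z g f))"
    using Comp_assoc[of X Z Y X "Comp C X Y Z g f" g' f'] o f' g' 1 by simp
  also have "Comp C X Z Y g' (Comp C X Y Z g f) = f"
    using Comp_assoc[of X Y Z Y f g g'] o f' g' Id_Comp by simp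
  finally have 2: "Comp C X Z X (Comp C Z Y X f' g') (Comp C X Y Z g f) = Id C X"
    using f' by simp
  have "Comp C Z X Z (Comp C X Y Z g f) (Comp C Z Y X f' g')
      = Comp C Z Y Z g (Comp C Z X Y f (Comp C Z Y X f' g'))"
    using Comp_assoc[of Z X Y Z "Comp C Z Y X f' g'" f g] o f' g' 1 by simp
  also have "Comp C Z X Y f (Comp C Z Y X f' g') = g'"
    using Comp_assoc[of Z Y X Y g' f' f] o f' g' Id_Comp by simp
  finally have 3: "Comp C Z X Z (Comp C X Y Z g f) (Comp C Z Y X f' g') = Id C Z"
    using g' by simp
  show ?thesis unfolding iso_arrow_def using 1 2 3 by blast
qed

lemma iso_arrow_cancel_left:
  assumes f: "iso_arrow C Y Z f" and o: "X \<in> Ob C" "Y \<in> Ob C" "Z \<in> Ob C"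
    and g: "g \<in> Hom C X Y" and h: "h \<in> Hom C X Y" and eq: "Comp C X Y Z f g = Comp C X Y Z f h"
  shows "g = h"
proof -
  obtain f' where f': "Comp C Y Z Y f' f = Id C Y" "f \<in> Hom C Y Z" "f' \<in> Hom C Z Y"
    using iso_arrow_inverse[OF f o(2,3)] by metis
  have "g = Comp C X Z Y f' (Comp C X Y Z f g)"
    using Comp_assoc[OF o(1,2,3,2) g f'(2,3)] f' Id_Comp o g by simp
  also have "\<dots> = h"
    using Comp_assoc[OF o(1,2,3,2) h f'(2,3)] f' Id_Comp o h eq by simp
  finally show ?thesis .
qed

lemma iso_arrow_cancel_right:
  assumes f: "iso_arrow C X Y f" and o: "X \<in> Ob C" "Y \<in> Ob C" "Z \<in> Ob C"
    and g: "g \<in> Hom C Y Z" and h: "h \<in> Hom C Y Z" and eq: "Comp C X Y Z g f = Comp C X Y Z h f"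
  shows "g = h"
proof -
  obtain f' where f': "Comp C Y X Y f f' = Id C Y" "f \<in> Hom C X Y" "f' \<in> Hom C Y X"
    using iso_arrow_inverse[OF f o(1,2)] by metis
  have "g = Comp C Y X Z (Comp C X Y Z g f) f'"
    using Comp_assoc[OF o(2,1,2,3) f'(3,2) g] f' Comp_Id o g by simp
  also have "\<dots> = h"
    using Comp_assoc[OF o(2,1,2,3) f'(3,2) h] f' Comp_Id o h eq by simp
  finally show ?thesis .
qed

end

lemma (in cat_functor) iso_arrow_Fm:
  assumes "iso_arrow C X Y f" "X \<in> Ob C" "Y \<in> Ob C"
  shows "iso_arrow D (Fo X) (Fo Y) (Fm X Y f)"
  using assms unfolding iso_arrow_def by (metis Fm_Comp Fm_Id Fm_in)

text \<open>Fullness lifts an inverse of the image, and faithfulness lifts the two equations that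
  make it an inverse.\<close>

lemma (in weak_equivalence) iso_arrow_Fm_iff:
  assumes o: "X \<in> Ob C" "Y \<in> Ob C" and f: "f \<in> Hom C X Y"
  shows "iso_arrow D (Fo X) (Fo Y) (Fm X Y f) \<longleftrightarrow> iso_arrow C X Y f"
proof
  assume "iso_arrow D (Fo X) (Fo Y) (Fm X Y f)"
  then obtain g' where g': "g' \<in> Hom D (Fo Y) (Fo X)"
    "Comp D (Fo X) (Fo Y) (Fo X) g' (Fm X Y f) = Id D (Fo X)"
    "Comp D (Fo Y) (Fo X) (Fo Y) (Fm X Y f) g' = Id D (Fo Y)"
    unfolding iso_arrow_def by blast
  obtain g where g: "g \<in> Hom C Y X" "Fm Y X g = g'"
    using full o g' by blast
  have "Comp C X Y X g f = Id C X"
    using g g' o f by (intro faithful[of X X]) (auto simp: Fm_Comp Fm_Id intro: C.Comp_in C.Id_in)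
  moreover have "Comp C Y X Y f g = Id C Y"
    using g g' o f by (intro faithful[of Y Y]) (auto simp: Fm_Comp Fm_Id intro: C.Comp_in C.Id_in)
  ultimately show "iso_arrow C X Y f"
    unfolding iso_arrow_def using g f by blast
qed (use iso_arrow_Fm o in blast)

lemma weak_equivalence_compose:
  assumes "weak_equivalence C D Fo Fm" and "weak_equivalence D E Go Gm"
  shows "weak_equivalence C E (\<lambda>X. Go (Fo X)) (\<lambda>X Y f. Gm (Fo X) (Fo Y) (Fm X Y f))"
proof -
  interpret F: weak_equivalence C D Fo Fm by fact
  interpret G: weak_equivalence D E Go Gm by fact
  show ?thesis
  proof
    fix X assume X: "X \<in> Ob C"
    show "Go (Fo X) \<in> Ob E" "Gm (Fo X) (Fo X) (Fm X X (Id C X)) = Id E (Go (Fo X))"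
      using X by (auto simp: F.Fo_in G.Fo_in F.Fm_Id G.Fm_Id)
  next
    fix X Y f assume "X \<in> Ob C" "Y \<in> Ob C" "f \<in> Hom C X Y"
    then show "Gm (Fo X) (Fo Y) (Fm X Y f) \<in> Hom E (Go (Fo X)) (Go (Fo Y))"
      by (auto simp: F.Fo_in F.Fm_in intro!: G.Fm_in)
  next
    fix X Y Z f g assume "X \<in> Ob C" "Y \<in> Ob C" "Z \<in> Ob C" "f \<in> Hom C X Y" "g \<in> Hom C Y Z"
    then show "Gm (Fo X) (Fo Z) (Fm X Z (Comp C X Y Z g f)) =
      Comp E (Go (Fo X)) (Go (Fo Y)) (Go (Fo Z)) (Gm (Fo Y) (Fo Z) (Fm Y Z g)) (Gm (Fo X) (Fo Y) (Fm X Y f))"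
      by (simp add: F.Fm_Comp F.Fm_in F.Fo_in G.Fm_Comp)
  next
    fix X Y f g assume "X \<in> Ob C" "Y \<in> Ob C" "f \<in> Hom C X Y" "g \<in> Hom C X Y"
      "Gm (Fo X) (Fo Y) (Fm X Y f) = Gm (Fo X) (Fo Y) (Fm X Y g)"
    then show "f = g" by (meson F.Fm_in F.Fo_in F.faithful G.faithful)
  next
    fix X Y g assume "X \<in> Ob C" "Y \<in> Ob C" "g \<in> Hom E (Go (Fo X)) (Go (Fo Y))"
    then show "\<exists>f\<in>Hom C X Y. Gm (Fo X) (Fo Y) (Fm X Y f) = g" by (metis F.Fo_in F.full G.full)
  next
    fix Z assume Z: "Z \<in> Ob E"
    obtain Y v where Y: "Y \<in> Ob D" "iso_arrow E (Go Y) Z v" using G.ess_surj[OF Z] by blast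
    obtain X u where X: "X \<in> Ob C" "iso_arrow D (Fo X) Y u" using F.ess_surj[OF Y(1)] by blast
    have "iso_arrow E (Go (Fo X)) (Go Y) (Gm (Fo X) Y u)"
      using G.iso_arrow_Fm X Y F.Fo_in by blast
    then have "iso_arrow E (Go (Fo X)) Z (Comp E (Go (Fo X)) (Go Y) Z v (Gm (Fo X) Y u))"
      using G.D.iso_arrow_Comp X Y Z F.Fo_in G.Fo_in by blast
    then show "\<exists>X\<in>Ob C. \<exists>u. iso_arrow E (Go (Fo X)) Z u" using X by blast
  qed
qed

text \<open>By naturality, \<open>\<eta> Y\<close> after \<open>f\<close> equals
  \<open>G (F f)\<close> after \<open>\<eta> X\<close>, so it depends only on the image of
  \<open>f\<close>; the isomorphism \<open>\<eta> Y\<close> can then be cancelled.\<close>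

lemma natural_iso_faithful:
  assumes "cat_functor C D Fo Fm" "cat_functor D C Go Gm"
    and \<eta>: "natural_iso C C (\<lambda>X. X) (\<lambda>X Y f. f) (\<lambda>X. Go (Fo X)) (\<lambda>X Y f. Gm (Fo X) (Fo Y) (Fm X Y f)) \<eta>"
    and o: "X \<in> Ob C" "Y \<in> Ob C" and fg: "f \<in> Hom C X Y" "g \<in> Hom C X Y" "Fm X Y f = Fm X Y g"
  shows "f = g"
proof -
  interpret F: cat_functor C D Fo Fm by fact
  interpret G: cat_functor D C Go Gm by fact
  have "Comp C X Y (Go (Fo Y)) (\<eta> Y) f = Comp C X Y (Go (Fo Y)) (\<eta> Y) g"
    using \<eta> o fg unfolding natural_iso_def by metis
  moreover have "iso_arrow C Y (Go (Fo Y)) (\<eta> Y)"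
    using \<eta> o unfolding natural_iso_def by blast
  ultimately show ?thesis
    using F.C.iso_arrow_cancel_left o fg F.Fo_in G.Fo_in by blast
qed

text \<open>The same for the functor in the other direction: the counit precedes the arrow, so it is
  cancelled on the right. This is what the fullness of \<open>F\<close> rests on.\<close>

lemma natural_iso_faithful':
  assumes "cat_functor C D Fo Fm" "cat_functor D C Go Gm"
    and \<epsilon>: "natural_iso D D (\<lambda>X. Fo (Go X)) (\<lambda>X Y f. Fm (Go X) (Go Y) (Gm X Y f)) (\<lambda>X. X) (\<lambda>X Y f. f) \<epsilon>"
    and o: "X \<in> Ob D" "Y \<in> Ob D" and fg: "f \<in> Hom D X Y" "g \<in> Hom D X Y" "Gm X Y f = Gm X Y g"
  shows "f = g"
proof -
  interpret F: cat_functor C D Fo Fm by fact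
  interpret G: cat_functor D C Go Gm by fact
  have "Comp D (Fo (Go X)) X Y f (\<epsilon> X) = Comp D (Fo (Go X)) X Y g (\<epsilon> X)"
    using \<epsilon> o fg unfolding natural_iso_def by metis
  moreover have "iso_arrow D (Fo (Go X)) X (\<epsilon> X)"
    using \<epsilon> o unfolding natural_iso_def by blast
  ultimately show ?thesis
    using F.D.iso_arrow_cancel_right o fg F.Fo_in G.Fo_in by blast
qed

text \<open>Fullness is obtained without triangle identities, which
  \<open>equivalent_categories\<close> does not include: a preimage of \<open>d\<close> is found
  with the unit, and that it maps to \<open>d\<close> is tested after applying the faithful functor
  \<open>G\<close>.\<close>

lemma equivalent_categories_imp_weak_equivalence:
  assumes "equivalent_categories C D"
  obtains Fo Fm where "weak_equivalence C D Fo Fm"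
proof -
  obtain Fo Fm Go Gm \<eta> \<epsilon> where F: "cat_functor C D Fo Fm" and G: "cat_functor D C Go Gm"
    and \<eta>: "natural_iso C C (\<lambda>X. X) (\<lambda>X Y f. f) (\<lambda>X. Go (Fo X)) (\<lambda>X Y f. Gm (Fo X) (Fo Y) (Fm X Y f)) \<eta>"
    and \<epsilon>: "natural_iso D D (\<lambda>X. Fo (Go X)) (\<lambda>X Y f. Fm (Go X) (Go Y) (Gm X Y f)) (\<lambda>X. X) (\<lambda>X Y f. f) \<epsilon>"
    using assms unfolding equivalent_categories_def by blast
  interpret F: cat_functor C D Fo Fm by fact
  interpret G: cat_functor D C Go Gm by fact
  have "weak_equivalence C D Fo Fm"
  proof
    fix X Y f g assume "X \<in> Ob C" "Y \<in> Ob C" "f \<in> Hom C X Y" "g \<in> Hom C X Y" "Fm X Y f = Fm X Y g"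
    then show "f = g" using natural_iso_faithful[OF F G \<eta>] by blast
  next
    fix X Y d assume o: "X \<in> Ob C" "Y \<in> Ob C" and d: "d \<in> Hom D (Fo X) (Fo Y)"
    have o': "Fo X \<in> Ob D" "Fo Y \<in> Ob D" "Go (Fo X) \<in> Ob C" "Go (Fo Y) \<in> Ob C"
      using o F.Fo_in G.Fo_in by auto
    have \<eta>X: "iso_arrow C X (Go (Fo X)) (\<eta> X)" and \<eta>Y: "iso_arrow C Y (Go (Fo Y)) (\<eta> Y)"
      using \<eta> o unfolding natural_iso_def by blast+
    obtain i where i: "i \<in> Hom C (Go (Fo Y)) Y" "\<eta> Y \<in> Hom C Y (Go (Fo Y))"
        "Comp C (Go (Fo Y)) Y (Go (Fo Y)) (\<eta> Y) i = Id C (Go (Fo Y))"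
      using F.C.iso_arrow_inverse[OF \<eta>Y o(2) o'(4)] by metis
    \<comment> \<open>\<open>a\<close> is what \<open>\<eta> Y\<close> after the preimage has to be
      by naturality; composing it with the inverse \<open>i\<close> of \<open>\<eta> Y\<close> gives
      the preimage \<open>c\<close>.\<close>
    define a where "a = Comp C X (Go (Fo X)) (Go (Fo Y)) (Gm (Fo X) (Fo Y) d) (\<eta> X)"
    have \<eta>Xi: "\<eta> X \<in> Hom C X (Go (Fo X))" using \<eta>X unfolding iso_arrow_def by blast
    have Gd: "Gm (Fo X) (Fo Y) d \<in> Hom C (Go (Fo X)) (Go (Fo Y))" using G.Fm_in o' d by blast
    have a: "a \<in> Hom C X (Go (Fo Y))"
      unfolding a_def using F.C.Comp_in o o' Gd \<eta>Xi by blast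
    define c where "c = Comp C X (Go (Fo Y)) Y i a"
    have c: "c \<in> Hom C X Y" unfolding c_def using F.C.Comp_in o o' a i by blast
    have "Comp C X Y (Go (Fo Y)) (\<eta> Y) c = a"
      unfolding c_def using F.C.Comp_assoc[OF o(1) o'(4) o(2) o'(4) a i(1,2)] i F.C.Id_Comp o o' a by simp
    moreover have "Comp C X Y (Go (Fo Y)) (\<eta> Y) c
        = Comp C X (Go (Fo X)) (Go (Fo Y)) (Gm (Fo X) (Fo Y) (Fm X Y c)) (\<eta> X)"
      using \<eta> o c unfolding natural_iso_def by blast
    \<comment> \<open>Cancelling \<open>\<eta> X\<close> in this equation shows that
      \<open>G\<close> takes the same value at \<open>F c\<close> and at \<open>d\<close>.\<close>
    ultimately have eq: "Comp C X (Go (Fo X)) (Go (Fo Y)) (Gm (Fo X) (Fo Y) (Fm X Y c)) (\<eta> X)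
        = Comp C X (Go (Fo X)) (Go (Fo Y)) (Gm (Fo X) (Fo Y) d) (\<eta> X)"
      by (simp add: a_def)
    have "Gm (Fo X) (Fo Y) (Fm X Y c) \<in> Hom C (Go (Fo X)) (Go (Fo Y))"
      by (rule G.Fm_in[OF o'(1,2) F.Fm_in[OF o c]])
    then have "Gm (Fo X) (Fo Y) (Fm X Y c) = Gm (Fo X) (Fo Y) d"
      using F.C.iso_arrow_cancel_right[OF \<eta>X o(1) o'(3,4) _ Gd eq] by blast
    then have "Fm X Y c = d"
      using natural_iso_faithful'[OF F G \<epsilon> o'(1,2)] F.Fm_in o c d by blast
    then show "\<exists>f\<in>Hom C X Y. Fm X Y f = d" using c by blast
  next
    fix Y assume "Y \<in> Ob D"
    then show "\<exists>X\<in>Ob C. \<exists>u. iso_arrow D (Fo X) Y u"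
      using \<epsilon> G.Fo_in unfolding natural_iso_def by blast
  qed
  then show ?thesis by (rule that)
qed

text \<open>For all \<open>X\<close> and \<open>Y\<close>, sending \<open>f\<close> to
  \<open>e Y\<close> after \<open>F f\<close> is a bijection from \<open>Hom C X (Go Y)\<close> to
  \<open>Hom D (Fo X) Y\<close> (\<open>lift\<close> and \<open>uniq\<close>). Both the arrow part
  of the quasi-inverse and the unit are defined as preimages under it, so every law reduces to
  comparing images.\<close>

lemma (in weak_equivalence) equivalent_categories: "equivalent_categories C D"
proof -
  define Go where "Go Y = (SOME X. X \<in> Ob C \<and> (\<exists>u. iso_arrow D (Fo X) Y u))" for Y
  define e where "e Y = (SOME u. iso_arrow D (Fo (Go Y)) Y u)" for Y
  have Go: "Go Y \<in> Ob C \<and> (\<exists>u. iso_arrow D (Fo (Go Y)) Y u)" if "Y \<in> Ob D" for Y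
    unfolding Go_def by (rule someI_ex) (use ess_surj[OF that] in blast)
  have e: "iso_arrow D (Fo (Go Y)) Y (e Y)" if "Y \<in> Ob D" for Y
    unfolding e_def using Go[OF that] by (metis someI_ex)
  have FGo: "Fo (Go Y) \<in> Ob D" if "Y \<in> Ob D" for Y using Go that Fo_in by blast
  have e_in: "e Y \<in> Hom D (Fo (Go Y)) Y" if "Y \<in> Ob D" for Y
    using e[OF that] unfolding iso_arrow_def by blast
  \<comment> \<open>Composing with the inverse of \<open>e Y\<close> turns \<open>k\<close> into an
    arrow between objects in the image of \<open>F\<close>, where fullness applies.\<close>
  have lift: "\<exists>f\<in>Hom C X (Go Y). Comp D (Fo X) (Fo (Go Y)) Y (e Y) (Fm X (Go Y) f) = k"
    if o: "X \<in> Ob C" "Y \<in> Ob D" and k: "k \<in> Hom D (Fo X) Y" for X Y k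
  proof -
    obtain i where i: "i \<in> Hom D Y (Fo (Go Y))" "Comp D Y (Fo (Go Y)) Y (e Y) i = Id D Y"
      using D.iso_arrow_inverse[OF e[OF o(2)] FGo[OF o(2)] o(2)] by metis
    have "Comp D (Fo X) Y (Fo (Go Y)) i k \<in> Hom D (Fo X) (Fo (Go Y))"
      using D.Comp_in o FGo Fo_in k i by blast
    then obtain f where f: "f \<in> Hom C X (Go Y)" "Fm X (Go Y) f = Comp D (Fo X) Y (Fo (Go Y)) i k"
      using full o Go by blast
    have "Comp D (Fo X) (Fo (Go Y)) Y (e Y) (Fm X (Go Y) f) = k"
      using f i k o FGo Fo_in e_in D.Comp_assoc[of "Fo X" Y "Fo (Go Y)" Y k i "e Y"]
      by (simp add: D.Id_Comp)
    then show ?thesis using f by blast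
  qed
  have uniq: "f = g" if "X \<in> Ob C" "Y \<in> Ob D" "f \<in> Hom C X (Go Y)" "g \<in> Hom C X (Go Y)"
    "Comp D (Fo X) (Fo (Go Y)) Y (e Y) (Fm X (Go Y) f) = Comp D (Fo X) (Fo (Go Y)) Y (e Y) (Fm X (Go Y) g)"
    for X Y f g
    using that Go FGo Fo_in Fm_in D.iso_arrow_cancel_left[OF e[OF that(2)], of "Fo X"] faithful by metis
  \<comment> \<open>\<open>Gm Y Z g\<close> is the arrow that makes \<open>e\<close> natural at
    \<open>g\<close>.\<close>
  define Gm where "Gm Y Z g = (SOME f. f \<in> Hom C (Go Y) (Go Z) \<and>
      Comp D (Fo (Go Y)) (Fo (Go Z)) Z (e Z) (Fm (Go Y) (Go Z) f) = Comp D (Fo (Go Y)) Y Z g (e Y))" for Y Z g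
  have Gm: "Gm Y Z g \<in> Hom C (Go Y) (Go Z) \<and>
      Comp D (Fo (Go Y)) (Fo (Go Z)) Z (e Z) (Fm (Go Y) (Go Z) (Gm Y Z g)) = Comp D (Fo (Go Y)) Y Z g (e Y)"
    if o: "Y \<in> Ob D" "Z \<in> Ob D" and g: "g \<in> Hom D Y Z" for Y Z g
  proof -
    have "Comp D (Fo (Go Y)) Y Z g (e Y) \<in> Hom D (Fo (Go Y)) Z"
      using D.Comp_in[OF FGo[OF o(1)] o e_in[OF o(1)] g] .
    then have "\<exists>f. f \<in> Hom C (Go Y) (Go Z) \<and>
        Comp D (Fo (Go Y)) (Fo (Go Z)) Z (e Z) (Fm (Go Y) (Go Z) f) = Comp D (Fo (Go Y)) Y Z g (e Y)"
      using lift[OF _ o(2)] Go[OF o(1)] by blast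
    then show ?thesis unfolding Gm_def by (rule someI_ex)
  qed
  have G: "cat_functor D C Go Gm"
  proof
    fix Y assume Y: "Y \<in> Ob D"
    show "Go Y \<in> Ob C" using Go Y by blast
    show "Gm Y Y (Id D Y) = Id C (Go Y)"
      using Y Go FGo e_in Gm[OF Y Y D.Id_in[OF Y]]
      by (intro uniq[of "Go Y" Y]) (auto simp: Fm_Id D.Id_Comp D.Comp_Id intro: C.Id_in)
  next
    fix Y Z g assume "Y \<in> Ob D" "Z \<in> Ob D" "g \<in> Hom D Y Z"
    then show "Gm Y Z g \<in> Hom C (Go Y) (Go Z)" using Gm by blast
  next
    fix X Y Z f g assume o: "X \<in> Ob D" "Y \<in> Ob D" "Z \<in> Ob D" and f: "f \<in> Hom D X Y" and g: "g \<in> Hom D Y Z"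
    let ?X = "Fo (Go X)" and ?Y = "Fo (Go Y)" and ?Z = "Fo (Go Z)"
    have G: "Go X \<in> Ob C" "Go Y \<in> Ob C" "Go Z \<in> Ob C" using o Go by auto
    have gf: "Comp D X Y Z g f \<in> Hom D X Z" using D.Comp_in o f g by blast
    note mf = Gm[OF o(1,2) f] and mg = Gm[OF o(2,3) g] and mgf = Gm[OF o(1,3) gf]
    have F: "Fm (Go X) (Go Y) (Gm X Y f) \<in> Hom D ?X ?Y" "Fm (Go Y) (Go Z) (Gm Y Z g) \<in> Hom D ?Y ?Z"
      using mf mg Fm_in G by blast+
    have "Comp D ?X ?Z Z (e Z) (Fm (Go X) (Go Z) (Comp C (Go X) (Go Y) (Go Z) (Gm Y Z g) (Gm X Y f)))
      = Comp D ?X ?Z Z (e Z) (Comp D ?X ?Y ?Z (Fm (Go Y) (Go Z) (Gm Y Z g)) (Fm (Go X) (Go Y) (Gm X Y f)))"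
      using mf mg G by (simp add: Fm_Comp)
    also have "\<dots> = Comp D ?X ?Y Z (Comp D ?Y Y Z g (e Y)) (Fm (Go X) (Go Y) (Gm X Y f))"
      using D.Comp_assoc[OF FGo FGo FGo o(3) F e_in] o mg by simp
    also have "\<dots> = Comp D ?X Y Z g (Comp D ?X X Y f (e X))"
      using D.Comp_assoc[OF FGo FGo o(2,3) F(1) e_in g] o mf by simp
    also have "\<dots> = Comp D ?X X Z (Comp D X Y Z g f) (e X)"
      using D.Comp_assoc[OF FGo o(1,2,3) e_in f g] o by simp
    finally show "Gm X Z (Comp D X Y Z g f) = Comp C (Go X) (Go Y) (Go Z) (Gm Y Z g) (Gm X Y f)"
      using mgf mf mg o G C.Comp_in by (intro uniq[of "Go X" Z]) auto
  qed
  then interpret G: cat_functor D C Go Gm .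
  \<comment> \<open>The unit at \<open>X\<close> is the arrow whose image under \<open>F\<close> is
    right inverse to \<open>e (Fo X)\<close>.\<close>
  define \<eta> where "\<eta> X = (SOME f. f \<in> Hom C X (Go (Fo X)) \<and>
      Comp D (Fo X) (Fo (Go (Fo X))) (Fo X) (e (Fo X)) (Fm X (Go (Fo X)) f) = Id D (Fo X))" for X
  have \<eta>: "\<eta> X \<in> Hom C X (Go (Fo X)) \<and>
      Comp D (Fo X) (Fo (Go (Fo X))) (Fo X) (e (Fo X)) (Fm X (Go (Fo X)) (\<eta> X)) = Id D (Fo X)"
    if "X \<in> Ob C" for X
    unfolding \<eta>_def by (rule someI_ex) (use lift[of X "Fo X" "Id D (Fo X)"] that Fo_in D.Id_in in blast)
  have "natural_iso C C (\<lambda>X. X) (\<lambda>X Y f. f) (\<lambda>X. Go (Fo X)) (\<lambda>X Y f. Gm (Fo X) (Fo Y) (Fm X Y f)) \<eta>"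
    unfolding natural_iso_def
  proof safe
    fix X assume X: "X \<in> Ob C"
    let ?X = "Fo X" and ?Y = "Fo (Go (Fo X))"
    have o: "?X \<in> Ob D" "?Y \<in> Ob D" "Go ?X \<in> Ob C" using X Fo_in FGo Go by auto
    obtain i where i: "iso_arrow D ?X ?Y i" "Comp D ?X ?Y ?X (e ?X) i = Id D ?X" "i \<in> Hom D ?X ?Y"
      using D.iso_arrow_inverse[OF e[OF o(1)] o(2,1)] by metis
    \<comment> \<open>So the image of the unit is the inverse of an isomorphism, and
      \<open>F\<close> reflects isomorphisms.\<close>
    have "Fm X (Go ?X) (\<eta> X) = i"
      using D.iso_arrow_cancel_left[OF e[OF o(1)] o(1,2,1)] \<eta>[OF X] i Fm_in X o by metis
    then show "iso_arrow C X (Go ?X) (\<eta> X)"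
      using iso_arrow_Fm_iff[OF X o(3)] \<eta>[OF X] i by metis
  next
    fix X Y f assume o: "X \<in> Ob C" "Y \<in> Ob C" and f: "f \<in> Hom C X Y"
    let ?X = "Fo X" and ?Y = "Fo Y"
    have o': "?X \<in> Ob D" "?Y \<in> Ob D" "Go ?X \<in> Ob C" "Go ?Y \<in> Ob C" "Fo (Go ?X) \<in> Ob D" "Fo (Go ?Y) \<in> Ob D"
      using o Fo_in FGo Go by auto
    have Ff: "Fm X Y f \<in> Hom D ?X ?Y" using Fm_in o f by blast
    note m = Gm[OF o'(1,2) Ff]
    have F: "Fm X (Go ?X) (\<eta> X) \<in> Hom D ?X (Fo (Go ?X))" "Fm Y (Go ?Y) (\<eta> Y) \<in> Hom D ?Y (Fo (Go ?Y))"
      "Fm (Go ?X) (Go ?Y) (Gm ?X ?Y (Fm X Y f)) \<in> Hom D (Fo (Go ?X)) (Fo (Go ?Y))"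
      using Fm_in \<eta> o o' m by auto
    \<comment> \<open>Both sides of the naturality square correspond to \<open>Fm X Y f\<close>
      under the bijection.\<close>
    have "Comp D ?X (Fo (Go ?Y)) ?Y (e ?Y) (Fm X (Go ?Y) (Comp C X Y (Go ?Y) (\<eta> Y) f)) = Fm X Y f"
      using D.Comp_assoc[OF o'(1,2,6,2) Ff F(2) e_in[OF o'(2)]] \<eta>[OF o(2)] o o' f Ff
      by (simp add: Fm_Comp D.Id_Comp)
    moreover have "Comp D ?X (Fo (Go ?Y)) ?Y (e ?Y) (Fm X (Go ?Y)
        (Comp C X (Go ?X) (Go ?Y) (Gm ?X ?Y (Fm X Y f)) (\<eta> X))) = Fm X Y f"
    proof -
      have "Comp D ?X (Fo (Go ?Y)) ?Y (e ?Y) (Fm X (Go ?Y)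
          (Comp C X (Go ?X) (Go ?Y) (Gm ?X ?Y (Fm X Y f)) (\<eta> X)))
        = Comp D ?X (Fo (Go ?X)) ?Y (Comp D (Fo (Go ?X)) ?X ?Y (Fm X Y f) (e ?X)) (Fm X (Go ?X) (\<eta> X))"
        using D.Comp_assoc[OF o'(1,5,6,2) F(1,3) e_in[OF o'(2)]] \<eta>[OF o(1)] o o' f m by (simp add: Fm_Comp)
      also have "\<dots> = Fm X Y f"
        using D.Comp_assoc[OF o'(1,5,1,2) F(1) e_in[OF o'(1)] Ff] \<eta>[OF o(1)] o' Ff by (simp add: D.Comp_Id)
      finally show ?thesis .
  qed
    ultimately show "Comp C X Y (Go ?Y) (\<eta> Y) f = Comp C X (Go ?X) (Go ?Y) (Gm ?X ?Y (Fm X Y f)) (\<eta> X)"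
      using uniq[OF o(1) o'(2)] C.Comp_in o o' \<eta> f m by metis
  qed
  moreover have "natural_iso D D (\<lambda>X. Fo (Go X)) (\<lambda>X Y f. Fm (Go X) (Go Y) (Gm X Y f)) (\<lambda>X. X) (\<lambda>X Y f. f) e"
    unfolding natural_iso_def using e Gm by blast
  ultimately show ?thesis
    unfolding equivalent_categories_def using G cat_functor_axioms by blast
qed

section \<open>Restriction of an equivalence to full subcategories\<close>

lemma full_subcategory_simps [simp]:
  "Ob (full_subcategory C Q) = {X \<in> Ob C. Q X}" "Hom (full_subcategory C Q) = Hom C"
  "Id (full_subcategory C Q) = Id C" "Comp (full_subcategory C Q) = Comp C"
  "iso_arrow (full_subcategory C Q) = iso_arrow C"
  by (auto simp: full_subcategory_def iso_arrow_def fun_eq_iff)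

lemma category_full_subcategory: "category C \<Longrightarrow> category (full_subcategory C Q)"
  unfolding category_def full_subcategory_def by (simp; blast)

text \<open>The properties are compared along every isomorphism from \<open>Fo X\<close> to
  \<open>Y\<close>, not only at \<open>Y = Fo X\<close>. This preserves essential surjectivity: an
  object found over a given \<open>Y\<close> with \<open>Q'\<close> then has the property
  \<open>Q\<close>.\<close>

lemma weak_equivalence_full_subcategory:
  assumes "weak_equivalence C D Fo Fm"
    and Q: "\<And>X Y u. \<lbrakk>X \<in> Ob C; Y \<in> Ob D; iso_arrow D (Fo X) Y u\<rbrakk> \<Longrightarrow> Q X \<longleftrightarrow> Q' Y"
  shows "weak_equivalence (full_subcategory C Q) (full_subcategory D Q') Fo Fm"
proof -
  interpret weak_equivalence C D Fo Fm by fact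
  have Q_Fo: "Q X \<Longrightarrow> Q' (Fo X)" if "X \<in> Ob C" for X
    using Q[OF that Fo_in[OF that] D.iso_arrow_Id[OF Fo_in[OF that]]] by blast
  interpret C': category "full_subcategory C Q" by (rule category_full_subcategory[OF C.category_axioms])
  interpret D': category "full_subcategory D Q'" by (rule category_full_subcategory[OF D.category_axioms])
  show ?thesis
  proof
    fix Z assume "Z \<in> Ob (full_subcategory D Q')"
    then show "\<exists>X\<in>Ob (full_subcategory C Q). \<exists>u. iso_arrow (full_subcategory D Q') (Fo X) Z u"
      using ess_surj Q by simp blast
  qed (use Fo_in Fm_in Fm_Id Fm_Comp faithful full Q_Fo in auto)
qed


section \<open>Simple and projective objects\<close>

text \<open>Only endomorphisms enter. In a module category the zero map is one of them, so the
  condition forces the identity to be zero.\<close>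

definition zero_object :: "('o, 'm) cat \<Rightarrow> 'o \<Rightarrow> bool" where
  "zero_object C X \<longleftrightarrow> Hom C X X \<subseteq> {Id C X}"

definition mono_arrow :: "('o, 'm) cat \<Rightarrow> 'o \<Rightarrow> 'o \<Rightarrow> 'm \<Rightarrow> bool" where
  "mono_arrow C X Y f \<longleftrightarrow> f \<in> Hom C X Y \<and>
     (\<forall>Z\<in>Ob C. \<forall>g\<in>Hom C Z X. \<forall>h\<in>Hom C Z X. Comp C Z X Y f g = Comp C Z X Y f h \<longrightarrow> g = h)"

definition simple_object :: "('o, 'm) cat \<Rightarrow> 'o \<Rightarrow> bool" where
  "simple_object C T \<longleftrightarrow> \<not> zero_object C T \<and>
     (\<forall>X\<in>Ob C. \<forall>f. mono_arrow C X T f \<longrightarrow> zero_object C X \<or> iso_arrow C X T f)"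

text \<open>In a module category the extremal epimorphisms are the surjective homomorphisms; unlike for
  epimorphisms, no quotient modules are needed to see this.\<close>

definition extremal_epi :: "('o, 'm) cat \<Rightarrow> 'o \<Rightarrow> 'o \<Rightarrow> 'm \<Rightarrow> bool" where
  "extremal_epi C X Y g \<longleftrightarrow> g \<in> Hom C X Y \<and>
     (\<forall>Z\<in>Ob C. \<forall>m. \<forall>k\<in>Hom C X Z. mono_arrow C Z Y m \<and> Comp C X Z Y m k = g \<longrightarrow> iso_arrow C Z Y m)"

definition projective_object :: "('o, 'm) cat \<Rightarrow> 'o \<Rightarrow> bool" where
  "projective_object C T \<longleftrightarrow>
     (\<forall>X\<in>Ob C. \<forall>Y\<in>Ob C. \<forall>g. \<forall>f\<in>Hom C T Y. extremal_epi C X Y g \<longrightarrow>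
        (\<exists>h\<in>Hom C T X. Comp C T X Y g h = f))"

text \<open>The form of socle-projectivity that an equivalence preserves: monomorphisms from simple
  objects stand for simple submodules.\<close>

definition simple_subobjects_projective :: "('o, 'm) cat \<Rightarrow> 'o \<Rightarrow> bool" where
  "simple_subobjects_projective C M \<longleftrightarrow>
     (\<forall>T\<in>Ob C. \<forall>f. mono_arrow C T M f \<and> simple_object C T \<longrightarrow> projective_object C T)"

text \<open>A span of fully faithful functors that are surjective on objects, with the middle category
  given by its set of objects \<open>I\<close> and the graph \<open>H\<close> of the induced bijections of hom-sets.\<close>

locale hom_correspondence = C: category C + D: category D
  for C :: "('o, 'm) cat" and D :: "('p, 'n) cat" +
  fixes I :: "'i set" and p :: "'i \<Rightarrow> 'o" and q :: "'i \<Rightarrow> 'p" and H :: "'i \<Rightarrow> 'i \<Rightarrow> 'm \<Rightarrow> 'n \<Rightarrow> bool"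
  assumes p_in: "i \<in> I \<Longrightarrow> p i \<in> Ob C" and q_in: "i \<in> I \<Longrightarrow> q i \<in> Ob D"
    and p_surj: "X \<in> Ob C \<Longrightarrow> \<exists>i\<in>I. p i = X" and q_surj: "Y \<in> Ob D \<Longrightarrow> \<exists>i\<in>I. q i = Y"
    and H_in: "\<lbrakk>i \<in> I; j \<in> I; H i j f g\<rbrakk> \<Longrightarrow> f \<in> Hom C (p i) (p j) \<and> g \<in> Hom D (q i) (q j)"
    and H_total: "\<lbrakk>i \<in> I; j \<in> I; f \<in> Hom C (p i) (p j)\<rbrakk> \<Longrightarrow> \<exists>g. H i j f g"
    and H_surj: "\<lbrakk>i \<in> I; j \<in> I; g \<in> Hom D (q i) (q j)\<rbrakk> \<Longrightarrow> \<exists>f. H i j f g"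
    and H_unique: "\<lbrakk>i \<in> I; j \<in> I; H i j f g; H i j f' g'\<rbrakk> \<Longrightarrow> f = f' \<longleftrightarrow> g = g'"
    and H_Id: "i \<in> I \<Longrightarrow> H i i (Id C (p i)) (Id D (q i))"
    and H_Comp: "\<lbrakk>i \<in> I; j \<in> I; k \<in> I; H i j f g; H j k f' g'\<rbrakk> \<Longrightarrow>
      H i k (Comp C (p i) (p j) (p k) f' f) (Comp D (q i) (q j) (q k) g' g)"

text \<open>The axioms are symmetric in the two categories, so every property shown to pass from
  \<open>C\<close> to \<open>D\<close> also passes back.\<close>

lemma hom_correspondence_sym:
  assumes "hom_correspondence C D I p q H"
  shows "hom_correspondence D C I q p (\<lambda>i j g f. H i j f g)"
proof -
  interpret hom_correspondence C D I p q H by fact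
  show ?thesis
  proof (standard, goal_cases)
    case 1 then show ?case by (rule q_in)
  next
    case 2 then show ?case by (rule p_in)
  next
    case 3 then show ?case by (rule q_surj)
  next
    case 4 then show ?case by (rule p_surj)
  next
    case 5 then show ?case using H_in by blast
  next
    case 6 then show ?case by (rule H_surj)
  next
    case 7 then show ?case by (rule H_total)
  next
    case 8 then show ?case using H_unique by metis
  next
    case 9 then show ?case by (rule H_Id)
  next
    case 10 then show ?case by (rule H_Comp)
  qed
qed

section \<open>Invariance under a correspondence of hom-sets\<close>

context hom_correspondence
begin

lemma zero_object_imp:
  assumes i: "i \<in> I" and z: "zero_object C (p i)"
  shows "zero_object D (q i)"
  unfolding zero_object_def
proof
  fix g assume "g \<in> Hom D (q i) (q i)"
  then obtain f where f: "H i i f g" using H_surj i by blast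
  then have "f = Id C (p i)" using z H_in[OF i i f] unfolding zero_object_def by blast
  then show "g \<in> {Id D (q i)}" using H_unique[OF i i f H_Id[OF i]] by blast
qed

lemma iso_arrow_imp:
  assumes i: "i \<in> I" "j \<in> I" and H: "H i j f g" and f: "iso_arrow C (p i) (p j) f"
  shows "iso_arrow D (q i) (q j) g"
proof -
  obtain f' where f': "f' \<in> Hom C (p j) (p i)" "Comp C (p i) (p j) (p i) f' f = Id C (p i)"
      "Comp C (p j) (p i) (p j) f f' = Id C (p j)"
    using f unfolding iso_arrow_def by blast
  obtain g' where g': "H j i f' g'" using H_total i f' by blast
  have "Comp D (q i) (q j) (q i) g' g = Id D (q i)"
    using H_unique[OF i(1,1) H_Comp[OF i i(1) H g'] H_Id[OF i(1)]] f' by blast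
  moreover have "Comp D (q j) (q i) (q j) g g' = Id D (q j)"
    using H_unique[OF i(2,2) H_Comp[OF i(2) i g' H] H_Id[OF i(2)]] f' by blast
  ultimately show ?thesis
    unfolding iso_arrow_def using H_in[OF i H] H_in[OF i(2,1) g'] by blast
qed

text \<open>The test object and the two test arrows in \<open>D\<close> all correspond to data in
  \<open>C\<close>, where \<open>f\<close> can be cancelled.\<close>

lemma mono_arrow_imp:
  assumes i: "i \<in> I" "j \<in> I" and H: "H i j f g" and f: "mono_arrow C (p i) (p j) f"
  shows "mono_arrow D (q i) (q j) g"
  unfolding mono_arrow_def
proof (intro conjI ballI impI)
  fix Z a b assume Z: "Z \<in> Ob D" and a: "a \<in> Hom D Z (q i)" and b: "b \<in> Hom D Z (q i)"
    and eq: "Comp D Z (q i) (q j) g a = Comp D Z (q i) (q j) g b"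
  obtain k where k: "k \<in> I" "q k = Z" using q_surj Z by blast
  obtain a' b' where ab: "H k i a' a" "H k i b' b" using H_surj i k a b by metis
  have "Comp C (p k) (p i) (p j) f a' = Comp C (p k) (p i) (p j) f b'"
    using H_unique[OF k(1) i(2) H_Comp[OF k(1) i ab(1) H] H_Comp[OF k(1) i ab(2) H]] eq k by blast
  then have "a' = b'"
    using f H_in[OF k(1) i(1)] ab p_in[OF k(1)] unfolding mono_arrow_def by blast
  then show "a = b" using H_unique[OF k(1) i(1) ab] by blast
qed (use H_in i H in blast)

end

context hom_correspondence
begin

interpretation inv: hom_correspondence D C I q p "\<lambda>i j g f. H i j f g"
  by (rule hom_correspondence_sym[OF hom_correspondence_axioms])

lemma zero_object_iff: "i \<in> I \<Longrightarrow> zero_object C (p i) \<longleftrightarrow> zero_object D (q i)"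
  using zero_object_imp inv.zero_object_imp by blast

lemma iso_arrow_iff: "\<lbrakk>i \<in> I; j \<in> I; H i j f g\<rbrakk> \<Longrightarrow> iso_arrow C (p i) (p j) f \<longleftrightarrow> iso_arrow D (q i) (q j) g"
  using iso_arrow_imp inv.iso_arrow_imp by blast

lemma mono_arrow_iff: "\<lbrakk>i \<in> I; j \<in> I; H i j f g\<rbrakk> \<Longrightarrow> mono_arrow C (p i) (p j) f \<longleftrightarrow> mono_arrow D (q i) (q j) g"
  using mono_arrow_imp inv.mono_arrow_imp by blast

lemma simple_object_imp:
  assumes i: "i \<in> I" and s: "simple_object C (p i)"
  shows "simple_object D (q i)"
  unfolding simple_object_def
proof (intro conjI ballI allI impI)
  show "\<not> zero_object D (q i)" using s zero_object_iff i unfolding simple_object_def by blast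
  fix Y g assume Y: "Y \<in> Ob D" and g: "mono_arrow D Y (q i) g"
  obtain j where j: "j \<in> I" "q j = Y" using q_surj Y by blast
  obtain f where f: "H j i f g" using H_surj i j g unfolding mono_arrow_def by blast
  have "mono_arrow C (p j) (p i) f" using mono_arrow_iff[OF j(1) i f] g j by blast
  then have "zero_object C (p j) \<or> iso_arrow C (p j) (p i) f"
    using s p_in[OF j(1)] unfolding simple_object_def by blast
  then show "zero_object D Y \<or> iso_arrow D Y (q i) g"
    using zero_object_iff iso_arrow_iff[OF j(1) i f] j by blast
qed

lemma extremal_epi_imp:
  assumes i: "i \<in> I" "j \<in> I" and H: "H i j f g" and f: "extremal_epi C (p i) (p j) f"
  shows "extremal_epi D (q i) (q j) g"
  unfolding extremal_epi_def
proof (intro conjI ballI allI impI)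
  fix Z m k assume Z: "Z \<in> Ob D" and k: "k \<in> Hom D (q i) Z"
    and m: "mono_arrow D Z (q j) m \<and> Comp D (q i) Z (q j) m k = g"
  obtain l where l: "l \<in> I" "q l = Z" using q_surj Z by blast
  obtain m' where m': "H l j m' m" using H_surj i l m unfolding mono_arrow_def by blast
  obtain k' where k': "H i l k' k" using H_surj i l k by blast
  have "Comp C (p i) (p l) (p j) m' k' = f"
    using H_unique[OF i H_Comp[OF i(1) l(1) i(2) k' m'] H] m l by blast
  moreover have "mono_arrow C (p l) (p j) m'" using mono_arrow_iff[OF l(1) i(2) m'] m l by blast
  ultimately have "iso_arrow C (p l) (p j) m'"
    using f p_in[OF l(1)] H_in[OF i(1) l(1) k'] unfolding extremal_epi_def by blast
  then show "iso_arrow D Z (q j) m" using iso_arrow_iff[OF l(1) i(2) m'] l by blast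
qed (use H_in i H in blast)

end

context hom_correspondence
begin

interpretation inv: hom_correspondence D C I q p "\<lambda>i j g f. H i j f g"
  by (rule hom_correspondence_sym[OF hom_correspondence_axioms])

text \<open>A lifting problem in \<open>D\<close> is carried back to \<open>C\<close>, solved there
  and returned. Carrying it back uses \<open>extremal_epi_imp\<close> in the opposite
  direction.\<close>

lemma projective_object_imp:
  assumes i: "i \<in> I" and T: "projective_object C (p i)"
  shows "projective_object D (q i)"
  unfolding projective_object_def
proof (intro ballI allI impI)
  fix X Y g f assume X: "X \<in> Ob D" and Y: "Y \<in> Ob D" and f: "f \<in> Hom D (q i) Y" and g: "extremal_epi D X Y g"
  obtain j k where j: "j \<in> I" "q j = X" and k: "k \<in> I" "q k = Y" using q_surj X Y by metis
  obtain g' where g': "H j k g' g" using H_surj j k g unfolding extremal_epi_def by blast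
  obtain f' where f': "H i k f' f" using H_surj i k f by blast
  have "extremal_epi C (p j) (p k) g'" using inv.extremal_epi_imp j k g' g by blast
  then obtain h' where h': "h' \<in> Hom C (p i) (p j)" "Comp C (p i) (p j) (p k) g' h' = f'"
    using T p_in j k H_in[OF i k(1) f'] unfolding projective_object_def by metis
  obtain h where h: "H i j h' h" using H_total i j h' by blast
  have "Comp D (q i) (q j) (q k) g h = f"
    using H_unique[OF i k(1) H_Comp[OF i j(1) k(1) h g'] f'] h' by blast
  then show "\<exists>h\<in>Hom D (q i) X. Comp D (q i) X Y g h = f" using H_in[OF i j(1) h] j k by blast
qed

end

context hom_correspondence
begin

interpretation inv: hom_correspondence D C I q p "\<lambda>i j g f. H i j f g"
  by (rule hom_correspondence_sym[OF hom_correspondence_axioms])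

text \<open>Monomorphisms and simplicity are carried back to \<open>C\<close>; projectivity of the
  simple object is then carried forward.\<close>

lemma simple_subobjects_projective_imp:
  assumes i: "i \<in> I" and M: "simple_subobjects_projective C (p i)"
  shows "simple_subobjects_projective D (q i)"
  unfolding simple_subobjects_projective_def
proof (intro ballI allI impI)
  fix T f assume T: "T \<in> Ob D" and f: "mono_arrow D T (q i) f \<and> simple_object D T"
  obtain j where j: "j \<in> I" "q j = T" using q_surj T by blast
  obtain f' where f': "H j i f' f" using H_surj i j f unfolding mono_arrow_def by blast
  have "mono_arrow C (p j) (p i) f'" "simple_object C (p j)"
    using inv.mono_arrow_imp[OF j(1) i f'] inv.simple_object_imp[OF j(1)] f j by auto
  then show "projective_object D T"
    using M p_in j projective_object_imp unfolding simple_subobjects_projective_def by blast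
qed

end

text \<open>\<open>Fo\<close> reaches the objects of \<open>D\<close> only up to isomorphism, so the
  middle objects are triples with a specified isomorphism \<open>u\<close>, and \<open>f\<close>
  corresponds to \<open>g\<close> when the square formed with \<open>u\<close> and \<open>u'\<close>
  commutes.\<close>

lemma (in weak_equivalence) hom_correspondence:
  "hom_correspondence C D {(X, Y, u). X \<in> Ob C \<and> Y \<in> Ob D \<and> iso_arrow D (Fo X) Y u} fst (\<lambda>(X, Y, u). Y)
     (\<lambda>(X, Y, u) (X', Y', u') f g. f \<in> Hom C X X' \<and> g \<in> Hom D Y Y' \<and>
        Comp D (Fo X) (Fo X') Y' u' (Fm X X' f) = Comp D (Fo X) Y Y' g u)"
proof (standard, goal_cases)
  case (1 i) then show ?case by auto
next
  case (2 i) then show ?case by auto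
next
  case (3 X)
  then show ?case using Fo_in D.iso_arrow_Id by force
next
  case (4 Y)
  then show ?case using ess_surj by force
next
  case (5 i j f g) then show ?case by auto
next
  case (6 i j f)
  obtain X Y u X' Y' u' where ij: "i = (X, Y, u)" "j = (X', Y', u')" by (metis prod_cases3)
  have o: "X \<in> Ob C" "Y \<in> Ob D" "X' \<in> Ob C" "Y' \<in> Ob D" "Fo X \<in> Ob D" "Fo X' \<in> Ob D"
    and u: "iso_arrow D (Fo X) Y u" and u': "u' \<in> Hom D (Fo X') Y'" and f: "f \<in> Hom C X X'"
    using 6 ij Fo_in by (auto simp: iso_arrow_def)
  obtain v where v: "u \<in> Hom D (Fo X) Y" "v \<in> Hom D Y (Fo X)" "Comp D (Fo X) Y (Fo X) v u = Id D (Fo X)"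
    using D.iso_arrow_inverse[OF u o(5,2)] by metis
  have Ff: "Fm X X' f \<in> Hom D (Fo X) (Fo X')" using Fm_in o f by blast
  \<comment> \<open>The arrow corresponding to \<open>f\<close> is \<open>u'\<close> after
    \<open>F f\<close> after the inverse \<open>v\<close> of \<open>u\<close>.\<close>
  define a where "a = Comp D (Fo X) (Fo X') Y' u' (Fm X X' f)"
  have a: "a \<in> Hom D (Fo X) Y'" unfolding a_def by (rule D.Comp_in[OF o(5,6,4) Ff u'])
  have "Comp D (Fo X) Y Y' (Comp D Y (Fo X) Y' a v) u = a"
    using D.Comp_assoc[OF o(5,2,5,4) v(1,2) a] v D.Comp_Id[OF o(5,4) a] by simp
  moreover have "Comp D Y (Fo X) Y' a v \<in> Hom D Y Y'" by (rule D.Comp_in[OF o(2,5,4) v(2) a])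
  ultimately show ?case using f ij a_def by (metis (mono_tags, lifting) case_prod_conv)
next
  case (7 i j g)
  obtain X Y u X' Y' u' where ij: "i = (X, Y, u)" "j = (X', Y', u')" by (metis prod_cases3)
  have o: "X \<in> Ob C" "Y \<in> Ob D" "X' \<in> Ob C" "Y' \<in> Ob D" "Fo X \<in> Ob D" "Fo X' \<in> Ob D"
    and u: "u \<in> Hom D (Fo X) Y" and u': "iso_arrow D (Fo X') Y' u'" and g: "g \<in> Hom D Y Y'"
    using 7 ij Fo_in by (auto simp: iso_arrow_def)
  obtain v where v: "u' \<in> Hom D (Fo X') Y'" "v \<in> Hom D Y' (Fo X')" "Comp D Y' (Fo X') Y' u' v = Id D Y'"
    using D.iso_arrow_inverse[OF u' o(6,4)] by metis
  \<comment> \<open>In the other direction \<open>F f\<close> has to be the inverse \<open>v\<close>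
    of \<open>u'\<close> after \<open>g\<close> after \<open>u\<close>; fullness provides
    \<open>f\<close>.\<close>
  define a where "a = Comp D (Fo X) Y Y' g u"
  have a: "a \<in> Hom D (Fo X) Y'" unfolding a_def by (rule D.Comp_in[OF o(5,2,4) u g])
  have "Comp D (Fo X) Y' (Fo X') v a \<in> Hom D (Fo X) (Fo X')" by (rule D.Comp_in[OF o(5,4,6) a v(2)])
  then obtain f where f: "f \<in> Hom C X X'" "Fm X X' f = Comp D (Fo X) Y' (Fo X') v a"
    using full o by blast
  have "Comp D (Fo X) (Fo X') Y' u' (Fm X X' f) = a"
    using D.Comp_assoc[OF o(5,4,6,4) a v(2,1)] v f D.Id_Comp[OF o(5,4) a] by simp
  then show ?case using f g ij a_def by (metis (mono_tags, lifting) case_prod_conv)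
next
  case (8 i j f g f' g')
  obtain X Y u X' Y' u' where ij: "i = (X, Y, u)" "j = (X', Y', u')" by (metis prod_cases3)
  have o: "X \<in> Ob C" "Y \<in> Ob D" "X' \<in> Ob C" "Y' \<in> Ob D" "Fo X \<in> Ob D" "Fo X' \<in> Ob D"
    and u: "iso_arrow D (Fo X) Y u" "iso_arrow D (Fo X') Y' u'" and h: "f \<in> Hom C X X'" "g \<in> Hom D Y Y'"
      "f' \<in> Hom C X X'" "g' \<in> Hom D Y Y'"
      "Comp D (Fo X) (Fo X') Y' u' (Fm X X' f) = Comp D (Fo X) Y Y' g u"
      "Comp D (Fo X) (Fo X') Y' u' (Fm X X' f') = Comp D (Fo X) Y Y' g' u"
    using 8 ij Fo_in by auto
  show ?case
  proof
    assume "f = f'"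
    then show "g = g'" using D.iso_arrow_cancel_right[OF u(1) o(5,2,4) h(2,4)] h by simp
  next
    assume "g = g'"
    then have "Fm X X' f = Fm X X' f'"
      using D.iso_arrow_cancel_left[OF u(2) o(5,6,4) Fm_in Fm_in] o h by simp
    then show "f = f'" using faithful o h by blast
  qed
next
  case (9 i)
  then show ?case
    by (auto simp: Fm_Id iso_arrow_def Fo_in D.Id_Comp D.Comp_Id intro: C.Id_in D.Id_in)
next
  case (10 i j k f g f' g')
  obtain X Y u X' Y' u' X'' Y'' u'' where ij: "i = (X, Y, u)" "j = (X', Y', u')" "k = (X'', Y'', u'')"
    by (metis prod_cases3)
  have o: "X \<in> Ob C" "Y \<in> Ob D" "X' \<in> Ob C" "Y' \<in> Ob D" "X'' \<in> Ob C" "Y'' \<in> Ob D"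
      "Fo X \<in> Ob D" "Fo X' \<in> Ob D" "Fo X'' \<in> Ob D"
    and u: "u \<in> Hom D (Fo X) Y" "u' \<in> Hom D (Fo X') Y'" "u'' \<in> Hom D (Fo X'') Y''"
    and h: "f \<in> Hom C X X'" "g \<in> Hom D Y Y'" "f' \<in> Hom C X' X''" "g' \<in> Hom D Y' Y''"
    and e: "Comp D (Fo X) (Fo X') Y' u' (Fm X X' f) = Comp D (Fo X) Y Y' g u"
      "Comp D (Fo X') (Fo X'') Y'' u'' (Fm X' X'' f') = Comp D (Fo X') Y' Y'' g' u'"
    using 10 ij Fo_in by (auto simp: iso_arrow_def)
  have F: "Fm X X' f \<in> Hom D (Fo X) (Fo X')" "Fm X' X'' f' \<in> Hom D (Fo X') (Fo X'')"
    using Fm_in o h by auto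
  have "Comp D (Fo X) (Fo X'') Y'' u'' (Comp D (Fo X) (Fo X') (Fo X'') (Fm X' X'' f') (Fm X X' f))
      = Comp D (Fo X) (Fo X') Y'' (Comp D (Fo X') Y' Y'' g' u') (Fm X X' f)"
    using D.Comp_assoc[OF o(7,8,9,6) F u(3)] e by simp
  also have "\<dots> = Comp D (Fo X) Y' Y'' g' (Comp D (Fo X) Y Y' g u)"
    using D.Comp_assoc[OF o(7,8,4,6) F(1) u(2) h(4)] e by simp
  also have "\<dots> = Comp D (Fo X) Y Y'' (Comp D Y Y' Y'' g' g) u"
    using D.Comp_assoc[OF o(7,2,4,6) u(1) h(2,4)] .
  finally show ?case
    using ij o h C.Comp_in[OF o(1,3,5) h(1,3)] D.Comp_in[OF o(2,4,6) h(2,4)] by (simp add: Fm_Comp)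
qed

section \<open>Invariance under fully faithful, essentially surjective functors\<close>

context weak_equivalence
begin

interpretation H: hom_correspondence C D
  "{(X, Y, u). X \<in> Ob C \<and> Y \<in> Ob D \<and> iso_arrow D (Fo X) Y u}" fst "\<lambda>(X, Y, u). Y"
  "\<lambda>(X, Y, u) (X', Y', u') f g. f \<in> Hom C X X' \<and> g \<in> Hom D Y Y' \<and>
     Comp D (Fo X) (Fo X') Y' u' (Fm X X' f) = Comp D (Fo X) Y Y' g u"
  by (rule hom_correspondence)

lemmas inverse_correspondence = hom_correspondence_sym[OF hom_correspondence]

lemma simple_object_iff:
  "\<lbrakk>X \<in> Ob C; Y \<in> Ob D; iso_arrow D (Fo X) Y u\<rbrakk> \<Longrightarrow> simple_object C X \<longleftrightarrow> simple_object D Y"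
  using H.simple_object_imp[of "(X, Y, u)"]
    hom_correspondence.simple_object_imp[OF inverse_correspondence, of "(X, Y, u)"] by auto

lemma projective_object_iff:
  "\<lbrakk>X \<in> Ob C; Y \<in> Ob D; iso_arrow D (Fo X) Y u\<rbrakk> \<Longrightarrow> projective_object C X \<longleftrightarrow> projective_object D Y"
  using H.projective_object_imp[of "(X, Y, u)"]
    hom_correspondence.projective_object_imp[OF inverse_correspondence, of "(X, Y, u)"] by auto

lemma simple_subobjects_projective_iff:
  "\<lbrakk>X \<in> Ob C; Y \<in> Ob D; iso_arrow D (Fo X) Y u\<rbrakk> \<Longrightarrow>
    simple_subobjects_projective C X \<longleftrightarrow> simple_subobjects_projective D Y"
  using H.simple_subobjects_projective_imp[of "(X, Y, u)"]
    hom_correspondence.simple_subobjects_projective_imp[OF inverse_correspondence, of "(X, Y, u)"] by auto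

end


section \<open>Homomorphisms and submodules\<close>

context right_module
begin

lemma act_zero [simp]: "x \<in> carrier M \<Longrightarrow> x \<cdot>\<^bsub>M\<^esub> \<zero>\<^bsub>R\<^esub> = \<zero>\<^bsub>M\<^esub>"
proof -
  assume x: "x \<in> carrier M"
  have "x \<cdot>\<^bsub>M\<^esub> \<zero>\<^bsub>R\<^esub> \<oplus>\<^bsub>M\<^esub> x \<cdot>\<^bsub>M\<^esub> \<zero>\<^bsub>R\<^esub> = x \<cdot>\<^bsub>M\<^esub> \<zero>\<^bsub>R\<^esub>"
    using act_add[OF x R.zero_closed R.zero_closed] by simp
  then show ?thesis using act_closed[OF x R.zero_closed] by (simp add: M.add.l_cancel_one)
qed

lemma zero_act [simp]: "a \<in> carrier R \<Longrightarrow> \<zero>\<^bsub>M\<^esub> \<cdot>\<^bsub>M\<^esub> a = \<zero>\<^bsub>M\<^esub>"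
proof -
  assume a: "a \<in> carrier R"
  have "\<zero>\<^bsub>M\<^esub> \<cdot>\<^bsub>M\<^esub> a \<oplus>\<^bsub>M\<^esub> \<zero>\<^bsub>M\<^esub> \<cdot>\<^bsub>M\<^esub> a = \<zero>\<^bsub>M\<^esub> \<cdot>\<^bsub>M\<^esub> a"
    using add_act[OF M.zero_closed M.zero_closed a] by simp
  then show ?thesis using act_closed[OF M.zero_closed a] by (simp add: M.add.l_cancel_one)
qed

lemma act_minus_one: "x \<in> carrier M \<Longrightarrow> x \<cdot>\<^bsub>M\<^esub> (\<ominus>\<^bsub>R\<^esub> \<one>\<^bsub>R\<^esub>) = \<ominus>\<^bsub>M\<^esub> x"
proof -
  assume x: "x \<in> carrier M"
  have "x \<cdot>\<^bsub>M\<^esub> (\<ominus>\<^bsub>R\<^esub> \<one>\<^bsub>R\<^esub>) \<oplus>\<^bsub>M\<^esub> x = \<zero>\<^bsub>M\<^esub>"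
    using act_add[OF x R.a_inv_closed[OF R.one_closed] R.one_closed] act_one[OF x] x by (simp add: R.l_neg)
  then show ?thesis using M.minus_equality x act_closed[OF x] by simp
qed

lemma minus_act: "\<lbrakk>x \<in> carrier M; a \<in> carrier R\<rbrakk> \<Longrightarrow> (\<ominus>\<^bsub>M\<^esub> x) \<cdot>\<^bsub>M\<^esub> a = \<ominus>\<^bsub>M\<^esub> (x \<cdot>\<^bsub>M\<^esub> a)"
proof -
  assume x: "x \<in> carrier M" and a: "a \<in> carrier R"
  have "(\<ominus>\<^bsub>M\<^esub> x) \<cdot>\<^bsub>M\<^esub> a \<oplus>\<^bsub>M\<^esub> x \<cdot>\<^bsub>M\<^esub> a = \<zero>\<^bsub>M\<^esub>"
    using add_act[OF M.a_inv_closed[OF x] x a] x a by (simp add: M.l_neg)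
  then show ?thesis using M.minus_equality[of "(\<ominus>\<^bsub>M\<^esub> x) \<cdot>\<^bsub>M\<^esub> a" "x \<cdot>\<^bsub>M\<^esub> a"] x a act_closed by simp
qed

lemma finsum_act:
  "\<lbrakk>finite I; f \<in> I \<rightarrow> carrier M; a \<in> carrier R\<rbrakk> \<Longrightarrow> finsum M f I \<cdot>\<^bsub>M\<^esub> a = (\<Oplus>\<^bsub>M\<^esub>i\<in>I. f i \<cdot>\<^bsub>M\<^esub> a)"
  by (induction rule: finite_induct) (auto simp: add_act act_closed Pi_iff)

lemma act_finsum:
  "\<lbrakk>finite I; f \<in> I \<rightarrow> carrier R; x \<in> carrier M\<rbrakk> \<Longrightarrow> x \<cdot>\<^bsub>M\<^esub> finsum R f I = (\<Oplus>\<^bsub>M\<^esub>i\<in>I. x \<cdot>\<^bsub>M\<^esub> f i)"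
  by (induction rule: finite_induct) (auto simp: act_add act_closed Pi_iff)

text \<open>Closure under negation comes from the action of minus the unit of
  \<open>R\<close>.\<close>

lemma rsubmoduleI:
  assumes "N \<subseteq> carrier M" "\<zero>\<^bsub>M\<^esub> \<in> N" "\<And>x y. \<lbrakk>x \<in> N; y \<in> N\<rbrakk> \<Longrightarrow> x \<oplus>\<^bsub>M\<^esub> y \<in> N"
    and "\<And>x a. \<lbrakk>x \<in> N; a \<in> carrier R\<rbrakk> \<Longrightarrow> x \<cdot>\<^bsub>M\<^esub> a \<in> N"
  shows "rsubmodule N R M"
proof -
  have "\<ominus>\<^bsub>M\<^esub> x \<in> N" if "x \<in> N" for x
    using assms(4)[OF that, of "\<ominus>\<^bsub>R\<^esub> \<one>\<^bsub>R\<^esub>"] assms(1) that act_minus_one by auto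
  then show ?thesis
    unfolding rsubmodule_def using assms by (auto intro!: subgroup.intro simp: a_inv_def)
qed

lemma rsubmoduleD:
  assumes "rsubmodule N R M"
  shows "N \<subseteq> carrier M" "\<zero>\<^bsub>M\<^esub> \<in> N" "\<And>x y. \<lbrakk>x \<in> N; y \<in> N\<rbrakk> \<Longrightarrow> x \<oplus>\<^bsub>M\<^esub> y \<in> N"
    "\<And>x a. \<lbrakk>x \<in> N; a \<in> carrier R\<rbrakk> \<Longrightarrow> x \<cdot>\<^bsub>M\<^esub> a \<in> N" "\<And>x. x \<in> N \<Longrightarrow> \<ominus>\<^bsub>M\<^esub> x \<in> N"
  using assms subgroup.subset[of N "add_monoid M"] subgroup.one_closed[of N "add_monoid M"]
    subgroup.m_closed[of N "add_monoid M"] subgroup.m_inv_closed[of N "add_monoid M"]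
  unfolding rsubmodule_def by (auto simp: a_inv_def)

lemma right_module_rsubmodule:
  assumes "rsubmodule N R M"
  shows "right_module R (M\<lparr>carrier := N\<rparr>)"
proof -
  note N = rsubmoduleD[OF assms]
  have "abelian_group (M\<lparr>carrier := N\<rparr>)"
  proof (rule abelian_groupI)
    fix x assume "x \<in> carrier (M\<lparr>carrier := N\<rparr>)"
    then show "\<exists>y\<in>carrier (M\<lparr>carrier := N\<rparr>). y \<oplus>\<^bsub>M\<lparr>carrier := N\<rparr>\<^esub> x = \<zero>\<^bsub>M\<lparr>carrier := N\<rparr>\<^esub>"
      using N by (intro bexI[of _ "\<ominus>\<^bsub>M\<^esub> x"]) (auto simp: M.l_neg subset_iff)
  qed (use N in \<open>auto simp: subset_iff M.a_ac\<close>)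
  then show ?thesis
    by (intro right_module.intro right_module_axioms.intro R.ring_axioms)
      (use N in \<open>auto simp: subset_iff act_add add_act act_assoc act_one\<close>)
qed

lemma rsubmodule_rsubmodule_iff:
  assumes "rsubmodule N R M"
  shows "rsubmodule L R (M\<lparr>carrier := N\<rparr>) \<longleftrightarrow> L \<subseteq> N \<and> rsubmodule L R M"
proof -
  interpret N: right_module R "M\<lparr>carrier := N\<rparr>" by (rule right_module_rsubmodule[OF assms])
  show ?thesis
  proof
    assume L: "rsubmodule L R (M\<lparr>carrier := N\<rparr>)"
    have "rsubmodule L R M"
      using N.rsubmoduleD[OF L] rsubmoduleD(1)[OF assms] by (intro rsubmoduleI) auto
    then show "L \<subseteq> N \<and> rsubmodule L R M" using N.rsubmoduleD(1)[OF L] by simp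
  next
    assume L: "L \<subseteq> N \<and> rsubmodule L R M"
    show "rsubmodule L R (M\<lparr>carrier := N\<rparr>)"
      using L rsubmoduleD[of L] by (intro N.rsubmoduleI) auto
  qed
qed

lemma rsubmodule_carrier: "rsubmodule (carrier M) R M"
  by (rule rsubmoduleI) (auto simp: act_closed)

lemma rsubmodule_Int: "\<lbrakk>rsubmodule N R M; rsubmodule L R M\<rbrakk> \<Longrightarrow> rsubmodule (N \<inter> L) R M"
  using rsubmoduleD[of N] rsubmoduleD[of L] by (intro rsubmoduleI) auto

lemma rsubmodule_cyclic:
  assumes x: "x \<in> carrier M"
  shows "rsubmodule {x \<cdot>\<^bsub>M\<^esub> a | a. a \<in> carrier R} R M"
proof (rule rsubmoduleI)
  show "\<zero>\<^bsub>M\<^esub> \<in> {x \<cdot>\<^bsub>M\<^esub> a | a. a \<in> carrier R}"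
    using act_zero[OF x, symmetric] R.zero_closed by blast
next
  fix y z assume "y \<in> {x \<cdot>\<^bsub>M\<^esub> a | a. a \<in> carrier R}" "z \<in> {x \<cdot>\<^bsub>M\<^esub> a | a. a \<in> carrier R}"
  then show "y \<oplus>\<^bsub>M\<^esub> z \<in> {x \<cdot>\<^bsub>M\<^esub> a | a. a \<in> carrier R}"
    using act_add[OF x, symmetric] R.a_closed by blast
next
  fix y b assume "y \<in> {x \<cdot>\<^bsub>M\<^esub> a | a. a \<in> carrier R}" "b \<in> carrier R"
  then show "y \<cdot>\<^bsub>M\<^esub> b \<in> {x \<cdot>\<^bsub>M\<^esub> a | a. a \<in> carrier R}"
    using act_assoc[OF x, symmetric] R.m_closed by blast
qed (use x act_closed in auto)

lemma socle_rsubmodule: "rsubmodule (socle R M) R M"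
proof -
  let ?F = "{N. rsubmodule N R M \<and> (\<forall>S. rsubmodule S R M \<and> simple_rmodule R (M\<lparr>carrier := S\<rparr>) \<longrightarrow> S \<subseteq> N)}"
  \<comment> \<open>The whole module is among the submodules that are intersected, so the
    intersection stays inside the carrier.\<close>
  have "carrier M \<in> ?F" using rsubmodule_carrier rsubmoduleD(1) by blast
  then have ne: "\<Inter>?F \<subseteq> carrier M" by blast
  have "rsubmodule (\<Inter>?F) R M"
  proof (rule rsubmoduleI[OF ne])
    show "\<zero>\<^bsub>M\<^esub> \<in> \<Inter>?F" using rsubmoduleD(2) by simp
    show "x \<oplus>\<^bsub>M\<^esub> y \<in> \<Inter>?F" if "x \<in> \<Inter>?F" "y \<in> \<Inter>?F" for x y
      using that rsubmoduleD(3) by simp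
    show "x \<cdot>\<^bsub>M\<^esub> a \<in> \<Inter>?F" if "x \<in> \<Inter>?F" "a \<in> carrier R" for x a
      using that rsubmoduleD(4) by simp
  qed
  then show ?thesis unfolding socle_def .
qed

lemma simple_subset_socle:
  "\<lbrakk>rsubmodule S R M; simple_rmodule R (M\<lparr>carrier := S\<rparr>)\<rbrakk> \<Longrightarrow> S \<subseteq> socle R M"
  unfolding socle_def by blast

lemma socle_subset:
  assumes "rsubmodule N R M"
    and "\<And>S. \<lbrakk>rsubmodule S R M; simple_rmodule R (M\<lparr>carrier := S\<rparr>)\<rbrakk> \<Longrightarrow> S \<subseteq> N"
  shows "socle R M \<subseteq> N"
  using assms unfolding socle_def by blast

end

section \<open>Homomorphisms, kernels and images\<close>

lemma rmod_homI:
  assumes "\<And>x. x \<in> carrier M \<Longrightarrow> h x \<in> carrier N"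
    and "\<And>x y. \<lbrakk>x \<in> carrier M; y \<in> carrier M\<rbrakk> \<Longrightarrow> h (x \<oplus>\<^bsub>M\<^esub> y) = h x \<oplus>\<^bsub>N\<^esub> h y"
    and "\<And>x a. \<lbrakk>x \<in> carrier M; a \<in> carrier R\<rbrakk> \<Longrightarrow> h (x \<cdot>\<^bsub>M\<^esub> a) = h x \<cdot>\<^bsub>N\<^esub> a"
    and "right_module R M"
  shows "restrict h (carrier M) \<in> rmod_hom R M N"
proof -
  interpret right_module R M by fact
  show ?thesis unfolding rmod_hom_def using assms act_closed by auto
qed

lemma rmod_homD:
  assumes "h \<in> rmod_hom R M N"
  shows "\<And>x. x \<in> carrier M \<Longrightarrow> h x \<in> carrier N"
    and "\<And>x y. \<lbrakk>x \<in> carrier M; y \<in> carrier M\<rbrakk> \<Longrightarrow> h (x \<oplus>\<^bsub>M\<^esub> y) = h x \<oplus>\<^bsub>N\<^esub> h y"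
    and "\<And>x a. \<lbrakk>x \<in> carrier M; a \<in> carrier R\<rbrakk> \<Longrightarrow> h (x \<cdot>\<^bsub>M\<^esub> a) = h x \<cdot>\<^bsub>N\<^esub> a"
    and "h \<in> extensional (carrier M)"
  using assms unfolding rmod_hom_def by (auto simp: PiE_def)

lemma rmod_hom_eqI:
  "\<lbrakk>h \<in> rmod_hom R M N; k \<in> rmod_hom R M N; \<And>x. x \<in> carrier M \<Longrightarrow> h x = k x\<rbrakk> \<Longrightarrow> h = k"
  by (meson extensionalityI rmod_homD(4))

lemma rmod_hom_zero:
  assumes "right_module R M" "right_module R N" "h \<in> rmod_hom R M N"
  shows "h \<zero>\<^bsub>M\<^esub> = \<zero>\<^bsub>N\<^esub>"
proof -
  interpret M: right_module R M by fact
  interpret N: right_module R N by fact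
  have "h \<zero>\<^bsub>M\<^esub> = h (\<zero>\<^bsub>M\<^esub> \<cdot>\<^bsub>M\<^esub> \<zero>\<^bsub>R\<^esub>)" by simp
  also have "\<dots> = \<zero>\<^bsub>N\<^esub>" using rmod_homD(1,3)[OF assms(3)] by (simp del: M.zero_act M.act_zero)
  finally show ?thesis .
qed

lemma rmod_hom_minus:
  assumes "right_module R M" "right_module R N" "h \<in> rmod_hom R M N" "x \<in> carrier M"
  shows "h (\<ominus>\<^bsub>M\<^esub> x) = \<ominus>\<^bsub>N\<^esub> h x"
proof -
  interpret M: right_module R M by fact
  interpret N: right_module R N by fact
  show ?thesis
    using rmod_homD(1,3)[OF assms(3,4)] M.act_minus_one[OF assms(4)] N.act_minus_one by (metis M.R.a_inv_closed M.R.one_closed)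
qed

lemma rmod_hom_compose:
  assumes "right_module R M" and h: "h \<in> rmod_hom R M N" and k: "k \<in> rmod_hom R N L"
  shows "compose (carrier M) k h \<in> rmod_hom R M L"
proof -
  interpret right_module R M by fact
  show ?thesis
    unfolding compose_def by (rule rmod_homI) (use rmod_homD[OF h] rmod_homD[OF k] assms(1) in auto)
qed

lemma rmod_hom_id: "right_module R M \<Longrightarrow> restrict id (carrier M) \<in> rmod_hom R M M"
  by (rule rmod_homI) auto

lemma rmod_hom_restrict:
  assumes "right_module R M" "rsubmodule S R M" and h: "h \<in> rmod_hom R M N"
  shows "restrict h S \<in> rmod_hom R (M\<lparr>carrier := S\<rparr>) N"
proof -
  interpret right_module R M by fact
  show ?thesis
    using rmod_homI[of "M\<lparr>carrier := S\<rparr>" h N R] rmod_homD[OF h] rsubmoduleD[OF assms(2)]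
      right_module_rsubmodule[OF assms(2)] by (auto simp: subset_iff)
qed

lemma rmod_hom_inclusion:
  assumes "right_module R M" "rsubmodule S R M"
  shows "restrict id S \<in> rmod_hom R (M\<lparr>carrier := S\<rparr>) M"
  using rmod_hom_restrict[OF assms rmod_hom_id[OF assms(1)]] 
    right_module.rsubmoduleD(1)[OF assms] by (simp add: restrict_def subset_iff cong: if_cong)

lemma rmod_hom_image:
  assumes "right_module R M" "right_module R N" "h \<in> rmod_hom R M N"
  shows "rsubmodule (h ` carrier M) R N"
proof -
  interpret M: right_module R M by fact
  interpret N: right_module R N by fact
  note h = rmod_homD[OF assms(3)]
  show ?thesis
  proof (rule N.rsubmoduleI)
    show "\<zero>\<^bsub>N\<^esub> \<in> h ` carrier M" using rmod_hom_zero[OF assms] M.M.zero_closed by (metis imageI)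
    show "x \<oplus>\<^bsub>N\<^esub> y \<in> h ` carrier M" if "x \<in> h ` carrier M" "y \<in> h ` carrier M" for x y
      using that h(2) M.M.a_closed by (metis (no_types, opaque_lifting) image_iff)
    show "x \<cdot>\<^bsub>N\<^esub> a \<in> h ` carrier M" if "x \<in> h ` carrier M" "a \<in> carrier R" for x a
      using that h(3) M.act_closed by (metis (no_types, opaque_lifting) image_iff)
  qed (use h in auto)
qed

lemma rmod_hom_kernel:
  assumes "right_module R M" "right_module R N" "h \<in> rmod_hom R M N"
  shows "rsubmodule {x \<in> carrier M. h x = \<zero>\<^bsub>N\<^esub>} R M"
proof -
  interpret M: right_module R M by fact
  interpret N: right_module R N by fact
  show ?thesis
    using rmod_homD[OF assms(3)] rmod_hom_zero[OF assms] M.act_closed by (intro M.rsubmoduleI) auto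
qed

lemma rmod_hom_inj_onI:
  assumes "right_module R M" "right_module R N" "h \<in> rmod_hom R M N"
    and "\<And>x. \<lbrakk>x \<in> carrier M; h x = \<zero>\<^bsub>N\<^esub>\<rbrakk> \<Longrightarrow> x = \<zero>\<^bsub>M\<^esub>"
  shows "inj_on h (carrier M)"
proof (rule inj_onI)
  interpret M: right_module R M by fact
  interpret N: right_module R N by fact
  fix x y assume xy: "x \<in> carrier M" "y \<in> carrier M" "h x = h y"
  have "h (x \<oplus>\<^bsub>M\<^esub> \<ominus>\<^bsub>M\<^esub> y) = \<zero>\<^bsub>N\<^esub>"
    using xy rmod_homD[OF assms(3)] rmod_hom_minus[OF assms(1-3)] by (simp add: N.M.r_neg)
  then have "x \<oplus>\<^bsub>M\<^esub> \<ominus>\<^bsub>M\<^esub> y = \<zero>\<^bsub>M\<^esub>" using assms(4) xy by simp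
  then show "x = y" using xy M.M.minus_equality[of x "\<ominus>\<^bsub>M\<^esub> y"] by simp
qed

lemma rmod_hom_inv_into:
  assumes "right_module R M" "right_module R N" "h \<in> rmod_hom R M N" and b: "bij_betw h (carrier M) (carrier N)"
  shows "restrict (inv_into (carrier M) h) (carrier N) \<in> rmod_hom R N M"
proof -
  interpret M: right_module R M by fact
  interpret N: right_module R N by fact
  note h = rmod_homD[OF assms(3)]
  have inj: "inj_on h (carrier M)" and im: "h ` carrier M = carrier N" using b by (auto simp: bij_betw_def)
  have inv: "inv_into (carrier M) h y \<in> carrier M" "h (inv_into (carrier M) h y) = y" if "y \<in> carrier N" for y
    using that inv_into_into[of y h "carrier M"] f_inv_into_f[of y h "carrier M"] im by auto
  show ?thesis
  proof (rule rmod_homI[OF inv(1)])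
    fix x y assume "x \<in> carrier N" "y \<in> carrier N"
    then show "inv_into (carrier M) h (x \<oplus>\<^bsub>N\<^esub> y) = inv_into (carrier M) h x \<oplus>\<^bsub>M\<^esub> inv_into (carrier M) h y"
      using inv h by (intro inj_onD[OF inj]) auto
  next
    fix x a assume "x \<in> carrier N" "a \<in> carrier R"
    then show "inv_into (carrier M) h (x \<cdot>\<^bsub>N\<^esub> a) = inv_into (carrier M) h x \<cdot>\<^bsub>M\<^esub> a"
      using inv h M.act_closed N.act_closed by (intro inj_onD[OF inj]) auto
  qed (use assms in auto)
qed


section \<open>The category of modules\<close>

lemma mod_category_simps [simp]:
  "Ob (mod_category R) = {M. right_module R M}" "Hom (mod_category R) = rmod_hom R"
  "Id (mod_category R) M = restrict id (carrier M)" "Comp (mod_category R) L M N g f = compose (carrier L) g f"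
  by (auto simp: mod_category_def)

lemma category_mod_category:
  fixes R :: "('r, 'c) ring_scheme"
  shows "category (mod_category R :: (('r, 'v) rmodule, 'v \<Rightarrow> 'v) cat)"
proof
  fix W X Y Z :: "('r, 'v) rmodule" and f g h
  assume "f \<in> Hom (mod_category R) W X" "g \<in> Hom (mod_category R) X Y" "h \<in> Hom (mod_category R) Y Z"
  then show "Comp (mod_category R) W Y Z h (Comp (mod_category R) W X Y g f) =
     Comp (mod_category R) W X Z (Comp (mod_category R) X Y Z h g) f"
    by (auto simp: compose_def fun_eq_iff dest: rmod_homD(1))
next
  fix X Y :: "('r, 'v) rmodule" and f
  assume "f \<in> Hom (mod_category R) X Y"
  then show "Comp (mod_category R) X X Y f (Id (mod_category R) X) = f"
    "Comp (mod_category R) X Y Y (Id (mod_category R) Y) f = f"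
    using rmod_homD[of f R X Y] by (auto simp: compose_def extensional_def fun_eq_iff)
qed (auto intro: rmod_hom_id rmod_hom_compose)

lemma zero_object_mod_category:
  assumes "right_module R M"
  shows "zero_object (mod_category R) M \<longleftrightarrow> carrier M = {\<zero>\<^bsub>M\<^esub>}"
proof -
  interpret right_module R M by fact
  show ?thesis
  proof
    assume z: "zero_object (mod_category R) M"
    have "restrict (\<lambda>_. \<zero>\<^bsub>M\<^esub>) (carrier M) \<in> rmod_hom R M M"
      using assms by (intro rmod_homI) auto
    then have *: "restrict (\<lambda>_. \<zero>\<^bsub>M\<^esub>) (carrier M) = restrict id (carrier M)"
      using z by (auto simp: zero_object_def)
    have "x = \<zero>\<^bsub>M\<^esub>" if "x \<in> carrier M" for x
      using fun_cong[OF *, of x] that by simp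
    then show "carrier M = {\<zero>\<^bsub>M\<^esub>}" by auto
  next
    assume c: "carrier M = {\<zero>\<^bsub>M\<^esub>}"
    have "f = restrict id (carrier M)" if "f \<in> rmod_hom R M M" for f
      using rmod_hom_eqI[OF that rmod_hom_id[OF assms]] rmod_homD(1)[OF that] c by auto
    then show "zero_object (mod_category R) M" by (auto simp: zero_object_def)
  qed
qed

lemma iso_arrow_mod_category:
  assumes "right_module R M" "right_module R N"
  shows "iso_arrow (mod_category R) M N h \<longleftrightarrow> h \<in> rmod_hom R M N \<and> bij_betw h (carrier M) (carrier N)"
proof
  assume "iso_arrow (mod_category R) M N h"
  then obtain g where g: "h \<in> rmod_hom R M N" "g \<in> rmod_hom R N M"
    "compose (carrier M) g h = restrict id (carrier M)" "compose (carrier N) h g = restrict id (carrier N)"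
    by (auto simp: iso_arrow_def)
  have "g (h x) = x" if "x \<in> carrier M" for x using fun_cong[OF g(3), of x] that by (simp add: compose_def)
  moreover have "h (g x) = x" if "x \<in> carrier N" for x using fun_cong[OF g(4), of x] that by (simp add: compose_def)
  ultimately have "bij_betw h (carrier M) (carrier N)"
    using rmod_homD(1)[OF g(1)] rmod_homD(1)[OF g(2)] by (intro bij_betw_byWitness[of _ g]) auto
  then show "h \<in> rmod_hom R M N \<and> bij_betw h (carrier M) (carrier N)" using g by blast
next
  assume h: "h \<in> rmod_hom R M N \<and> bij_betw h (carrier M) (carrier N)"
  let ?g = "restrict (inv_into (carrier M) h) (carrier N)"
  have "?g \<in> rmod_hom R N M" using rmod_hom_inv_into assms h by blast
  moreover have "compose (carrier M) ?g h = restrict id (carrier M)"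
    using h by (auto simp: compose_def fun_eq_iff bij_betw_def)
  moreover have "compose (carrier N) h ?g = restrict id (carrier N)"
    using h by (auto simp: compose_def fun_eq_iff bij_betw_def f_inv_into_f)
  ultimately show "iso_arrow (mod_category R) M N h"
    using h unfolding iso_arrow_def by auto
qed

text \<open>The test object is the kernel of \<open>h\<close>: its inclusion and the zero map agree
  after composition with \<open>h\<close>.\<close>

lemma mono_arrow_mod_category:
  assumes "right_module R M" "right_module R N"
  shows "mono_arrow (mod_category R) M N h \<longleftrightarrow> h \<in> rmod_hom R M N \<and> inj_on h (carrier M)"
proof
  assume m: "mono_arrow (mod_category R) M N h"
  then have h: "h \<in> rmod_hom R M N" by (simp add: mono_arrow_def)
  interpret M: right_module R M by fact
  interpret N: right_module R N by fact
  let ?K = "{x \<in> carrier M. h x = \<zero>\<^bsub>N\<^esub>}"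
  have K: "rsubmodule ?K R M" by (rule rmod_hom_kernel[OF assms h])
  have KM: "right_module R (M\<lparr>carrier := ?K\<rparr>)" by (rule M.right_module_rsubmodule[OF K])
  have z: "restrict (\<lambda>_. \<zero>\<^bsub>M\<^esub>) ?K \<in> rmod_hom R (M\<lparr>carrier := ?K\<rparr>) M"
    using rmod_homI[of "M\<lparr>carrier := ?K\<rparr>" "\<lambda>_. \<zero>\<^bsub>M\<^esub>" M R] KM by simp
  have "compose ?K h (restrict (\<lambda>_. \<zero>\<^bsub>M\<^esub>) ?K) = compose ?K h (restrict id ?K)"
    using rmod_hom_zero[OF assms h] by (auto simp: compose_def fun_eq_iff)
  then have *: "restrict (\<lambda>_. \<zero>\<^bsub>M\<^esub>) ?K = restrict id ?K"
    using m KM z rmod_hom_inclusion[OF assms(1) K]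
    by (auto simp: mono_arrow_def dest: bspec[of _ _ "M\<lparr>carrier := ?K\<rparr>"])
  have "x = \<zero>\<^bsub>M\<^esub>" if "x \<in> carrier M" "h x = \<zero>\<^bsub>N\<^esub>" for x
    using fun_cong[OF *, of x] that by simp
  then show "h \<in> rmod_hom R M N \<and> inj_on h (carrier M)"
    using rmod_hom_inj_onI[OF assms h] h by blast
next
  assume h: "h \<in> rmod_hom R M N \<and> inj_on h (carrier M)"
  have "f = g" if Z: "f \<in> rmod_hom R Z M" "g \<in> rmod_hom R Z M"
    and eq: "compose (carrier Z) h f = compose (carrier Z) h g" for Z :: "('a, 'c) rmodule" and f g
  proof (rule rmod_hom_eqI[OF Z])
    fix x assume x: "x \<in> carrier Z"
    then have "h (f x) = h (g x)" using fun_cong[OF eq, of x] by (simp add: compose_def)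
    then show "f x = g x" using h rmod_homD(1)[OF Z(1) x] rmod_homD(1)[OF Z(2) x] by (auto dest: inj_onD)
  qed
  then show "mono_arrow (mod_category R) M N h" using h by (auto simp: mono_arrow_def)
qed

lemma rmod_hom_codomain:
  assumes "h \<in> rmod_hom R M N" "h ` carrier M \<subseteq> S"
  shows "h \<in> rmod_hom R M (N\<lparr>carrier := S\<rparr>)"
  using assms by (auto simp: rmod_hom_def PiE_def)

text \<open>A homomorphism factors through the inclusion of its image, which is a monomorphism and
  hence, by extremality, an isomorphism. In the other direction, a monomorphism through which a
  surjection factors is itself surjective.\<close>

lemma extremal_epi_mod_category:
  assumes "right_module R M" "right_module R N"
  shows "extremal_epi (mod_category R) M N h \<longleftrightarrow> h \<in> rmod_hom R M N \<and> h ` carrier M = carrier N"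
proof
  assume e: "extremal_epi (mod_category R) M N h"
  then have h: "h \<in> rmod_hom R M N" by (simp add: extremal_epi_def)
  interpret N: right_module R N by fact
  let ?I = "h ` carrier M"
  have I: "rsubmodule ?I R N" by (rule rmod_hom_image[OF assms h])
  have IN: "right_module R (N\<lparr>carrier := ?I\<rparr>)" by (rule N.right_module_rsubmodule[OF I])
  have "mono_arrow (mod_category R) (N\<lparr>carrier := ?I\<rparr>) N (restrict id ?I)"
    using mono_arrow_mod_category[OF IN assms(2)] rmod_hom_inclusion[OF assms(2) I] by simp
  moreover have "compose (carrier M) (restrict id ?I) h = h"
    using rmod_homD(4)[OF h] by (auto simp: compose_def extensional_def fun_eq_iff)
  ultimately have "iso_arrow (mod_category R) (N\<lparr>carrier := ?I\<rparr>) N (restrict id ?I)"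
    using e IN rmod_hom_codomain[OF h, of ?I] unfolding extremal_epi_def mod_category_simps
    by (metis mem_Collect_eq order_refl)
  then have "bij_betw (restrict id ?I) ?I (carrier N)"
    using iso_arrow_mod_category[OF IN assms(2)] by simp
  then show "h \<in> rmod_hom R M N \<and> h ` carrier M = carrier N" using h by (auto simp: bij_betw_def)
next
  assume h: "h \<in> rmod_hom R M N \<and> h ` carrier M = carrier N"
  have "iso_arrow (mod_category R) Z N m" if Z: "right_module R Z" and k: "k \<in> rmod_hom R M Z"
    and m: "mono_arrow (mod_category R) Z N m" and eq: "compose (carrier M) m k = h" for Z m k
  proof -
    have m': "m \<in> rmod_hom R Z N" "inj_on m (carrier Z)" using m mono_arrow_mod_category[OF Z assms(2)] by auto
    have "y \<in> m ` carrier Z" if y: "y \<in> carrier N" for y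
    proof -
      obtain x where x: "x \<in> carrier M" "h x = y" using h y by (metis imageE)
      then have "y = m (k x)" using eq by (auto simp: compose_def)
      then show ?thesis using rmod_homD(1)[OF k x(1)] by blast
    qed
    then have "m ` carrier Z = carrier N" using rmod_homD(1)[OF m'(1)] by blast
    then show ?thesis using iso_arrow_mod_category[OF Z assms(2)] m' by (simp add: bij_betw_def)
  qed
  then show "extremal_epi (mod_category R) M N h" using h by (auto simp: extremal_epi_def)
qed

lemma simple_object_mod_category:
  assumes "right_module R T"
  shows "simple_object (mod_category R) T \<longleftrightarrow> simple_rmodule R T"
proof
  interpret right_module R T by fact
  assume s: "simple_object (mod_category R) T"
  have "N = {\<zero>\<^bsub>T\<^esub>} \<or> N = carrier T" if N: "rsubmodule N R T" for N
  proof -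
    have NT: "right_module R (T\<lparr>carrier := N\<rparr>)" by (rule right_module_rsubmodule[OF N])
    have "mono_arrow (mod_category R) (T\<lparr>carrier := N\<rparr>) T (restrict id N)"
      using mono_arrow_mod_category[OF NT assms] rmod_hom_inclusion[OF assms N] by simp
    then have "zero_object (mod_category R) (T\<lparr>carrier := N\<rparr>) \<or>
        iso_arrow (mod_category R) (T\<lparr>carrier := N\<rparr>) T (restrict id N)"
      using s NT unfolding simple_object_def by simp
    then show ?thesis
      using zero_object_mod_category[OF NT] iso_arrow_mod_category[OF NT assms] by (auto simp: bij_betw_def)
  qed
  then show "simple_rmodule R T"
    using s assms zero_object_mod_category[OF assms] unfolding simple_rmodule_def simple_object_def by blast
next
  assume s: "simple_rmodule R T"
  have "zero_object (mod_category R) X \<or> iso_arrow (mod_category R) X T f"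
    if X: "right_module R X" and f: "mono_arrow (mod_category R) X T f" for X f
  proof -
    have f': "f \<in> rmod_hom R X T" "inj_on f (carrier X)" using f mono_arrow_mod_category[OF X assms] by auto
    interpret X: right_module R X by fact
    consider "f ` carrier X = {\<zero>\<^bsub>T\<^esub>}" | "f ` carrier X = carrier T"
      using s rmod_hom_image[OF X assms f'(1)] unfolding simple_rmodule_def by blast
    then show ?thesis
    proof cases
      case 1
      have "carrier X = {\<zero>\<^bsub>X\<^esub>}"
      proof -
        have "x = \<zero>\<^bsub>X\<^esub>" if x: "x \<in> carrier X" for x
        proof (rule inj_onD[OF f'(2) _ x X.M.zero_closed])
          have "f x \<in> {\<zero>\<^bsub>T\<^esub>}" "f \<zero>\<^bsub>X\<^esub> \<in> {\<zero>\<^bsub>T\<^esub>}"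
            using 1 x X.M.zero_closed by blast+
          then show "f x = f \<zero>\<^bsub>X\<^esub>" by simp
        qed
        then show ?thesis using X.M.zero_closed by blast
      qed
      then show ?thesis using zero_object_mod_category[OF X] by blast
    next
      case 2
      then show ?thesis using iso_arrow_mod_category[OF X assms] f' by (simp add: bij_betw_def)
    qed
  qed
  then show "simple_object (mod_category R) T"
    using s zero_object_mod_category[OF assms] unfolding simple_rmodule_def simple_object_def by auto
qed

lemma projective_object_mod_category:
  assumes "right_module R T"
  shows "projective_object (mod_category R) T \<longleftrightarrow> projective_rmodule R T"
  unfolding projective_object_def projective_rmodule_def
  using assms by (auto simp: extremal_epi_mod_category)

text \<open>A monomorphism from a simple object is an isomorphism onto a simple submodule, so what
  remains is that simplicity and projectivity are invariant under isomorphism.\<close>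

lemma simple_subobjects_projective_mod_category:
  assumes "right_module R M"
  shows "simple_subobjects_projective (mod_category R) M \<longleftrightarrow>
    (\<forall>S. rsubmodule S R M \<and> simple_rmodule R (M\<lparr>carrier := S\<rparr>) \<longrightarrow> projective_rmodule R (M\<lparr>carrier := S\<rparr>))"
proof
  interpret right_module R M by fact
  assume q: "simple_subobjects_projective (mod_category R) M"
  show "\<forall>S. rsubmodule S R M \<and> simple_rmodule R (M\<lparr>carrier := S\<rparr>) \<longrightarrow> projective_rmodule R (M\<lparr>carrier := S\<rparr>)"
  proof (intro allI impI)
    fix S assume S: "rsubmodule S R M \<and> simple_rmodule R (M\<lparr>carrier := S\<rparr>)"
    then have SM: "right_module R (M\<lparr>carrier := S\<rparr>)" using right_module_rsubmodule by blast
    have "mono_arrow (mod_category R) (M\<lparr>carrier := S\<rparr>) M (restrict id S)"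
      using mono_arrow_mod_category[OF SM assms] rmod_hom_inclusion[OF assms] S by simp
    then show "projective_rmodule R (M\<lparr>carrier := S\<rparr>)"
      using q SM S simple_object_mod_category[OF SM] projective_object_mod_category[OF SM]
      unfolding simple_subobjects_projective_def by auto
  qed
next
  assume q: "\<forall>S. rsubmodule S R M \<and> simple_rmodule R (M\<lparr>carrier := S\<rparr>) \<longrightarrow> projective_rmodule R (M\<lparr>carrier := S\<rparr>)"
  interpret right_module R M by fact
  interpret C: category "mod_category R :: (('a, 'c) rmodule, 'c \<Rightarrow> 'c) cat" by (rule category_mod_category)
  \<comment> \<open>Invariance under isomorphism is the case of the identity functor, since the
    comparison lemmas allow any \<open>Y\<close> isomorphic to the image of
    \<open>X\<close>.\<close>
  interpret Id: weak_equivalence "mod_category R :: (('a, 'c) rmodule, 'c \<Rightarrow> 'c) cat" "mod_category R"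
    "\<lambda>X. X" "\<lambda>X Y f. f"
    by standard (use C.iso_arrow_Id in auto)
  have "projective_object (mod_category R) T" if T: "right_module R T"
    and f: "mono_arrow (mod_category R) T M f" and s: "simple_object (mod_category R) T" for T f
  proof -
    have f': "f \<in> rmod_hom R T M" "inj_on f (carrier T)" using f mono_arrow_mod_category[OF T assms] by auto
    let ?S = "f ` carrier T"
    have S: "rsubmodule ?S R M" by (rule rmod_hom_image[OF T assms f'(1)])
    have SM: "right_module R (M\<lparr>carrier := ?S\<rparr>)" by (rule right_module_rsubmodule[OF S])
    have iso: "iso_arrow (mod_category R) T (M\<lparr>carrier := ?S\<rparr>) f"
      using iso_arrow_mod_category[OF T SM] rmod_hom_codomain[OF f'(1)] f'(2) by (simp add: bij_betw_def)
    have "simple_rmodule R (M\<lparr>carrier := ?S\<rparr>)"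
      using Id.simple_object_iff[OF _ _ iso] T SM s simple_object_mod_category[OF SM] by simp
    then have "projective_object (mod_category R) (M\<lparr>carrier := ?S\<rparr>)"
      using q S projective_object_mod_category[OF SM] by blast
    then show ?thesis
      using Id.projective_object_iff[OF _ _ iso] T SM by simp
  qed
  then show "simple_subobjects_projective (mod_category R) M"
    unfolding simple_subobjects_projective_def by auto
qed


section \<open>Projectivity of the socle\<close>

text \<open>A submodule of the direct sum of \<open>M\<close> and \<open>X\<close>, written as a
  relation. Graphs of partially defined homomorphisms have this form, and extension of homomorphisms
  is inclusion of graphs, which suits Zorn's lemma.\<close>

definition linear_relation ::
  "('r, 'c) ring_scheme \<Rightarrow> ('r, 'v) rmodule \<Rightarrow> ('r, 'w) rmodule \<Rightarrow> ('v \<times> 'w) set \<Rightarrow> bool" where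
  "linear_relation R M X G \<longleftrightarrow> G \<subseteq> carrier M \<times> carrier X \<and> (\<zero>\<^bsub>M\<^esub>, \<zero>\<^bsub>X\<^esub>) \<in> G \<and>
     (\<forall>(x, y)\<in>G. \<forall>(x', y')\<in>G. (x \<oplus>\<^bsub>M\<^esub> x', y \<oplus>\<^bsub>X\<^esub> y') \<in> G) \<and>
     (\<forall>(x, y)\<in>G. \<forall>a\<in>carrier R. (x \<cdot>\<^bsub>M\<^esub> a, y \<cdot>\<^bsub>X\<^esub> a) \<in> G)"

lemma linear_relationD:
  assumes "linear_relation R M X G"
  shows "\<And>x y. (x, y) \<in> G \<Longrightarrow> x \<in> carrier M" "\<And>x y. (x, y) \<in> G \<Longrightarrow> y \<in> carrier X"
    "(\<zero>\<^bsub>M\<^esub>, \<zero>\<^bsub>X\<^esub>) \<in> G"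
    "\<And>x y x' y'. \<lbrakk>(x, y) \<in> G; (x', y') \<in> G\<rbrakk> \<Longrightarrow> (x \<oplus>\<^bsub>M\<^esub> x', y \<oplus>\<^bsub>X\<^esub> y') \<in> G"
    "\<And>x y a. \<lbrakk>(x, y) \<in> G; a \<in> carrier R\<rbrakk> \<Longrightarrow> (x \<cdot>\<^bsub>M\<^esub> a, y \<cdot>\<^bsub>X\<^esub> a) \<in> G"
  using assms unfolding linear_relation_def by blast+

lemma linear_relationI:
  assumes "\<And>x y. (x, y) \<in> G \<Longrightarrow> x \<in> carrier M \<and> y \<in> carrier X"
    "(\<zero>\<^bsub>M\<^esub>, \<zero>\<^bsub>X\<^esub>) \<in> G"
    "\<And>x y x' y'. \<lbrakk>(x, y) \<in> G; (x', y') \<in> G\<rbrakk> \<Longrightarrow> (x \<oplus>\<^bsub>M\<^esub> x', y \<oplus>\<^bsub>X\<^esub> y') \<in> G"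
    "\<And>x y a. \<lbrakk>(x, y) \<in> G; a \<in> carrier R\<rbrakk> \<Longrightarrow> (x \<cdot>\<^bsub>M\<^esub> a, y \<cdot>\<^bsub>X\<^esub> a) \<in> G"
  shows "linear_relation R M X G"
  using assms unfolding linear_relation_def by auto

text \<open>\<open>E\<close> prescribes which values are allowed. Take a maximal single-valued
  relation between \<open>G0\<close> and \<open>E\<close>. If its domain does not contain a simple
  submodule \<open>S\<close>, it meets \<open>S\<close> in zero, and the graph of an allowed
  homomorphism on \<open>S\<close> can be added. So the domain contains the socle, which is
  \<open>M\<close>. One choice of \<open>E\<close> and \<open>G0\<close> yields a projection onto a
  simple submodule, another yields a lifting.\<close>

lemma semisimple_hom_extension:
  fixes M :: "('r, 'v) rmodule" and X :: "('r, 'w) rmodule"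
  assumes MX: "right_module R M" "right_module R X" and soc: "socle R M = carrier M"
    and E: "linear_relation R M X E"
    and G0: "linear_relation R M X G0" "G0 \<subseteq> E" "\<And>y. (\<zero>\<^bsub>M\<^esub>, y) \<in> G0 \<Longrightarrow> y = \<zero>\<^bsub>X\<^esub>"
    and sel: "\<And>S. \<lbrakk>rsubmodule S R M; simple_rmodule R (M\<lparr>carrier := S\<rparr>)\<rbrakk> \<Longrightarrow>
      \<exists>h\<in>rmod_hom R (M\<lparr>carrier := S\<rparr>) X. \<forall>s\<in>S. (s, h s) \<in> E"
  obtains h where "h \<in> rmod_hom R M X" "\<And>x. x \<in> carrier M \<Longrightarrow> (x, h x) \<in> E" "\<And>x y. (x, y) \<in> G0 \<Longrightarrow> h x = y"
proof -
  interpret M: right_module R M by fact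
  interpret X: right_module R X by fact
  \<comment> \<open>For a linear relation, being single-valued only has to be required at
    zero.\<close>
  define \<A> where "\<A> = {G. linear_relation R M X G \<and> G0 \<subseteq> G \<and> G \<subseteq> E \<and> (\<forall>y. (\<zero>\<^bsub>M\<^esub>, y) \<in> G \<longrightarrow> y = \<zero>\<^bsub>X\<^esub>)}"
  have "\<exists>G\<in>\<A>. \<forall>G'\<in>\<A>. G \<subseteq> G' \<longrightarrow> G' = G"
  proof (rule subset_Zorn_nonempty)
    show "\<A> \<noteq> {}" using G0 unfolding \<A>_def by blast
    fix \<C> assume ne: "\<C> \<noteq> {}" and ch: "subset.chain \<A> \<C>"
    have C: "linear_relation R M X G" "G0 \<subseteq> G" "G \<subseteq> E" "\<And>y. (\<zero>\<^bsub>M\<^esub>, y) \<in> G \<Longrightarrow> y = \<zero>\<^bsub>X\<^esub>" if "G \<in> \<C>" for G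
      using that ch unfolding subset.chain_def \<A>_def by blast+
    have "linear_relation R M X (\<Union>\<C>)"
    proof (rule linear_relationI)
      fix x y x' y' assume "(x, y) \<in> \<Union>\<C>" "(x', y') \<in> \<Union>\<C>"
      then obtain G G' where G: "G \<in> \<C>" "G' \<in> \<C>" "(x, y) \<in> G" "(x', y') \<in> G'" by blast
      moreover have "G \<subseteq> G' \<or> G' \<subseteq> G" using ch G unfolding subset.chain_def by blast
      ultimately show "(x \<oplus>\<^bsub>M\<^esub> x', y \<oplus>\<^bsub>X\<^esub> y') \<in> \<Union>\<C>"
        using linear_relationD(4)[OF C(1)[OF G(1)], of x y x' y'] linear_relationD(4)[OF C(1)[OF G(2)], of x y x' y']
        by blast
    next
      fix x y a assume "(x, y) \<in> \<Union>\<C>" "a \<in> carrier R"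
      then show "(x \<cdot>\<^bsub>M\<^esub> a, y \<cdot>\<^bsub>X\<^esub> a) \<in> \<Union>\<C>" using linear_relationD(5)[OF C(1)] by (meson Union_iff)
    next
      fix x y assume "(x, y) \<in> \<Union>\<C>"
      then show "x \<in> carrier M \<and> y \<in> carrier X"
        using linear_relationD(1)[OF C(1)] linear_relationD(2)[OF C(1)] by (meson Union_iff)
    next
      obtain G where "G \<in> \<C>" using ne by blast
      then show "(\<zero>\<^bsub>M\<^esub>, \<zero>\<^bsub>X\<^esub>) \<in> \<Union>\<C>" using linear_relationD(3)[OF C(1)] by (meson Union_iff)
    qed
    then show "\<Union>\<C> \<in> \<A>" unfolding \<A>_def using C ne by blast
  qed
  then obtain G where "G \<in> \<A>" and max: "\<And>G'. \<lbrakk>G' \<in> \<A>; G \<subseteq> G'\<rbrakk> \<Longrightarrow> G' = G" by blast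
  then have G: "linear_relation R M X G" "G0 \<subseteq> G" "G \<subseteq> E" "\<And>y. (\<zero>\<^bsub>M\<^esub>, y) \<in> G \<Longrightarrow> y = \<zero>\<^bsub>X\<^esub>"
    unfolding \<A>_def by blast+
  note g = linear_relationD[OF G(1)]
  have D: "rsubmodule (Domain G) R M"
  proof (rule M.rsubmoduleI)
    show "Domain G \<subseteq> carrier M" using g(1) by blast
    show "\<zero>\<^bsub>M\<^esub> \<in> Domain G" using g(3) by blast
    show "x \<oplus>\<^bsub>M\<^esub> y \<in> Domain G" if "x \<in> Domain G" "y \<in> Domain G" for x y
      using that g(4) by (meson Domain.cases DomainI)
    show "x \<cdot>\<^bsub>M\<^esub> a \<in> Domain G" if "x \<in> Domain G" "a \<in> carrier R" for x a
      using that g(5) by (meson Domain.cases DomainI)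
  qed
  have "S \<subseteq> Domain G" if S: "rsubmodule S R M" "simple_rmodule R (M\<lparr>carrier := S\<rparr>)" for S
  proof -
    note s = M.rsubmoduleD[OF S(1)]
    have "rsubmodule (S \<inter> Domain G) R (M\<lparr>carrier := S\<rparr>)"
      using M.rsubmodule_rsubmodule_iff[OF S(1)] M.rsubmodule_Int[OF S(1) D] by blast
    then consider "S \<inter> Domain G = {\<zero>\<^bsub>M\<^esub>}" | "S \<inter> Domain G = S"
      using S(2) unfolding simple_rmodule_def by auto
    then show ?thesis
    proof cases
      case 1
      obtain h where h: "h \<in> rmod_hom R (M\<lparr>carrier := S\<rparr>) X" "\<And>s. s \<in> S \<Longrightarrow> (s, h s) \<in> E" using sel[OF S] by blast
      have hs: "\<And>s. s \<in> S \<Longrightarrow> h s \<in> carrier X" "\<And>s t. \<lbrakk>s \<in> S; t \<in> S\<rbrakk> \<Longrightarrow> h (s \<oplus>\<^bsub>M\<^esub> t) = h s \<oplus>\<^bsub>X\<^esub> h t"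
        "\<And>s a. \<lbrakk>s \<in> S; a \<in> carrier R\<rbrakk> \<Longrightarrow> h (s \<cdot>\<^bsub>M\<^esub> a) = h s \<cdot>\<^bsub>X\<^esub> a"
        using rmod_homD[OF h(1)] by simp_all
      have h0: "h \<zero>\<^bsub>M\<^esub> = \<zero>\<^bsub>X\<^esub>"
        using rmod_hom_zero[OF M.right_module_rsubmodule[OF S(1)] MX(2) h(1)] by simp
      \<comment> \<open>The sum of \<open>G\<close> and the graph of \<open>h\<close>; it is
        single-valued because \<open>S\<close> meets the domain of \<open>G\<close> in zero.\<close>
      define G' where "G' = {(x \<oplus>\<^bsub>M\<^esub> s, y \<oplus>\<^bsub>X\<^esub> h s) | x y s. (x, y) \<in> G \<and> s \<in> S}"
      have G'I: "(x \<oplus>\<^bsub>M\<^esub> s, y \<oplus>\<^bsub>X\<^esub> h s) \<in> G'" if "(x, y) \<in> G" "s \<in> S" for x y s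
        using that unfolding G'_def by blast
      have sM: "s \<in> carrier M" if "s \<in> S" for s using s(1) that by blast
      have "linear_relation R M X G'"
      proof (rule linear_relationI)
        fix u v assume "(u, v) \<in> G'"
        then show "u \<in> carrier M \<and> v \<in> carrier X" unfolding G'_def using g(1,2) sM hs(1) by auto
      next
        show "(\<zero>\<^bsub>M\<^esub>, \<zero>\<^bsub>X\<^esub>) \<in> G'" using G'I[OF g(3) s(2)] h0 by simp
      next
        fix u v u' v' assume "(u, v) \<in> G'" "(u', v') \<in> G'"
        then obtain x y t x' y' t' where *: "u = x \<oplus>\<^bsub>M\<^esub> t" "v = y \<oplus>\<^bsub>X\<^esub> h t" "(x, y) \<in> G" "t \<in> S"
          "u' = x' \<oplus>\<^bsub>M\<^esub> t'" "v' = y' \<oplus>\<^bsub>X\<^esub> h t'" "(x', y') \<in> G" "t' \<in> S"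
          unfolding G'_def by blast
        have "u \<oplus>\<^bsub>M\<^esub> u' = (x \<oplus>\<^bsub>M\<^esub> x') \<oplus>\<^bsub>M\<^esub> (t \<oplus>\<^bsub>M\<^esub> t')"
          using * g(1) sM by (simp add: M.M.a_ac)
        moreover have "v \<oplus>\<^bsub>X\<^esub> v' = (y \<oplus>\<^bsub>X\<^esub> y') \<oplus>\<^bsub>X\<^esub> h (t \<oplus>\<^bsub>M\<^esub> t')"
          using * g(2) hs by (simp add: X.M.a_ac)
        ultimately show "(u \<oplus>\<^bsub>M\<^esub> u', v \<oplus>\<^bsub>X\<^esub> v') \<in> G'" using G'I[OF g(4) s(3)] * by simp
      next
        fix u v a assume "(u, v) \<in> G'" and a: "a \<in> carrier R"
        then obtain x y t where *: "u = x \<oplus>\<^bsub>M\<^esub> t" "v = y \<oplus>\<^bsub>X\<^esub> h t" "(x, y) \<in> G" "t \<in> S"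
          unfolding G'_def by blast
        then have "u \<cdot>\<^bsub>M\<^esub> a = x \<cdot>\<^bsub>M\<^esub> a \<oplus>\<^bsub>M\<^esub> t \<cdot>\<^bsub>M\<^esub> a" "v \<cdot>\<^bsub>X\<^esub> a = y \<cdot>\<^bsub>X\<^esub> a \<oplus>\<^bsub>X\<^esub> h (t \<cdot>\<^bsub>M\<^esub> a)"
          using g(1,2) sM hs a by (simp_all add: M.add_act X.add_act)
        then show "(u \<cdot>\<^bsub>M\<^esub> a, v \<cdot>\<^bsub>X\<^esub> a) \<in> G'" using G'I[OF g(5)[OF _ a] s(4)[OF _ a]] * by simp
      qed
      moreover have GG': "G \<subseteq> G'"
      proof (rule subrelI)
        fix x y assume xy: "(x, y) \<in> G"
        then show "(x, y) \<in> G'" using G'I[OF xy s(2)] h0 g(1,2) by simp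
      qed
      moreover have "G' \<subseteq> E"
        unfolding G'_def using linear_relationD(4)[OF E] G(3) h(2) by blast
      moreover have "y = \<zero>\<^bsub>X\<^esub>" if yG': "(\<zero>\<^bsub>M\<^esub>, y) \<in> G'" for y
      proof -
        obtain x z t where *: "\<zero>\<^bsub>M\<^esub> = x \<oplus>\<^bsub>M\<^esub> t" "y = z \<oplus>\<^bsub>X\<^esub> h t" "(x, z) \<in> G" "t \<in> S"
          using yG' unfolding G'_def by blast
        \<comment> \<open>\<open>t\<close> lies in \<open>S\<close> and, being minus
          \<open>x\<close>, also in the domain of \<open>G\<close>.\<close>
        have "t = \<ominus>\<^bsub>M\<^esub> x"
          using *(1) M.M.minus_equality[of t x] M.M.a_comm[of x t] *(3,4) g(1) sM by simp
        then have "t \<in> S \<inter> Domain G" using * M.rsubmoduleD(5)[OF D] by blast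
        then have t: "t = \<zero>\<^bsub>M\<^esub>" using 1 by blast
        have "x = \<zero>\<^bsub>M\<^esub>" using *(1) t g(1)[OF *(3)] by simp
        then have "z = \<zero>\<^bsub>X\<^esub>" using G(4) *(3) by blast
        then show ?thesis using *(2) t h0 by simp
      qed
      ultimately have "G' \<in> \<A>" unfolding \<A>_def using G(2) by blast
      then have "G' = G" using max GG' by blast
      then have "(\<zero>\<^bsub>M\<^esub> \<oplus>\<^bsub>M\<^esub> t, \<zero>\<^bsub>X\<^esub> \<oplus>\<^bsub>X\<^esub> h t) \<in> G" if "t \<in> S" for t using G'I[OF g(3) that] by simp
      then show ?thesis using sM by fastforce
    qed blast
  qed
  then have Dom: "Domain G = carrier M" using M.socle_subset[OF D] soc M.rsubmoduleD(1)[OF D] by blast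
  have uniq: "y = z" if "(x, y) \<in> G" "(x, z) \<in> G" for x y z
  proof -
    have "(x \<cdot>\<^bsub>M\<^esub> (\<ominus>\<^bsub>R\<^esub> \<one>\<^bsub>R\<^esub>), z \<cdot>\<^bsub>X\<^esub> (\<ominus>\<^bsub>R\<^esub> \<one>\<^bsub>R\<^esub>)) \<in> G" using g(5) that(2) by simp
    then have "(x \<oplus>\<^bsub>M\<^esub> \<ominus>\<^bsub>M\<^esub> x, y \<oplus>\<^bsub>X\<^esub> \<ominus>\<^bsub>X\<^esub> z) \<in> G"
      using g(4)[OF that(1)] M.act_minus_one X.act_minus_one g(1,2) that by metis
    then have "y \<oplus>\<^bsub>X\<^esub> \<ominus>\<^bsub>X\<^esub> z = \<zero>\<^bsub>X\<^esub>" using G(4) g(1)[OF that(1)] by (simp add: M.M.r_neg)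
    then show ?thesis using X.M.minus_equality[of y "\<ominus>\<^bsub>X\<^esub> z"] g(2) that by simp
  qed
  define h where "h x = (THE y. (x, y) \<in> G)" for x
  have hI: "h x = y" if "(x, y) \<in> G" for x y unfolding h_def using that uniq by blast
  have hG: "(x, h x) \<in> G" if "x \<in> carrier M" for x using that Dom hI by blast
  have "restrict h (carrier M) \<in> rmod_hom R M X"
    using hG g(2) hI[OF g(4)] hI[OF g(5)] MX(1) by (intro rmod_homI) auto
  moreover have "(x, restrict h (carrier M) x) \<in> E" if "x \<in> carrier M" for x using hG G(3) that by auto
  moreover have "restrict h (carrier M) x = y" if "(x, y) \<in> G0" for x y using hI G(2) that g(1) by auto
  ultimately show ?thesis by (rule that)
qed

lemma socle_projective_iff:
  fixes M :: "('r, 'v) rmodule"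
  assumes M: "right_module R M"
  shows "socle_projective R M \<longleftrightarrow>
    (\<forall>S. rsubmodule S R M \<and> simple_rmodule R (M\<lparr>carrier := S\<rparr>) \<longrightarrow> projective_rmodule R (M\<lparr>carrier := S\<rparr>))"
proof -
  interpret M: right_module R M by fact
  let ?S = "M\<lparr>carrier := socle R M\<rparr>"
  have sub: "rsubmodule (socle R M) R M" by (rule M.socle_rsubmodule)
  have SM: "right_module R ?S" by (rule M.right_module_rsubmodule[OF sub])
  interpret S: right_module R ?S by (rule SM)
  have sub_iff: "rsubmodule T R ?S \<longleftrightarrow> T \<subseteq> socle R M \<and> rsubmodule T R M" for T
    by (rule M.rsubmodule_rsubmodule_iff[OF sub])
  \<comment> \<open>The simple submodules of \<open>M\<close> are simple submodules of its socle, so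
    the socle is its own socle.\<close>
  have soc: "socle R ?S = carrier ?S"
  proof
    show "socle R ?S \<subseteq> carrier ?S" using S.rsubmoduleD(1)[OF S.socle_rsubmodule] .
    have "socle R M \<subseteq> socle R ?S"
      using S.socle_rsubmodule sub_iff M.simple_subset_socle S.simple_subset_socle
      by (intro M.socle_subset) auto
    then show "carrier ?S \<subseteq> socle R ?S" by simp
  qed
  show ?thesis
  proof
    assume p: "socle_projective R M"
    show "\<forall>S. rsubmodule S R M \<and> simple_rmodule R (M\<lparr>carrier := S\<rparr>) \<longrightarrow> projective_rmodule R (M\<lparr>carrier := S\<rparr>)"
    proof (intro allI impI)
      fix T assume T: "rsubmodule T R M \<and> simple_rmodule R (M\<lparr>carrier := T\<rparr>)"
      let ?T = "M\<lparr>carrier := T\<rparr>"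
      have TM: "right_module R ?T" using T M.right_module_rsubmodule by blast
      interpret T: right_module R ?T by (rule TM)
      note t = M.rsubmoduleD[OF conjunct1[OF T]]
      have Ts: "T \<subseteq> socle R M" using M.simple_subset_socle T by blast
      \<comment> \<open>A projection of the socle onto \<open>T\<close> extends the identity of
        \<open>T\<close>. Every value in \<open>T\<close> is allowed, so the zero map serves on each
        simple submodule.\<close>
      obtain \<pi> where \<pi>: "\<pi> \<in> rmod_hom R ?S ?T" "\<And>x y. (x, y) \<in> Id_on T \<Longrightarrow> \<pi> x = y"
      proof (rule semisimple_hom_extension[OF SM TM soc, of "socle R M \<times> T" "Id_on T"])
        show "linear_relation R ?S ?T (socle R M \<times> T)"
          using M.rsubmoduleD[OF sub] t by (auto simp: linear_relation_def)
        show "linear_relation R ?S ?T (Id_on T)"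
          using t Ts by (auto simp: linear_relation_def)
        show "\<exists>h\<in>rmod_hom R (?S\<lparr>carrier := S\<rparr>) ?T. \<forall>s\<in>S. (s, h s) \<in> socle R M \<times> T"
          if "rsubmodule S R ?S" for S
        proof -
          have "restrict (\<lambda>_. \<zero>\<^bsub>M\<^esub>) (carrier (?S\<lparr>carrier := S\<rparr>)) \<in> rmod_hom R (?S\<lparr>carrier := S\<rparr>) ?T"
            using t T.zero_act S.right_module_rsubmodule[OF that] by (intro rmod_homI) auto
          then show ?thesis using that sub_iff t(2) by (intro bexI) auto
        qed
        show "Id_on T \<subseteq> socle R M \<times> T" using Ts by auto
      qed auto
      have "\<exists>h\<in>rmod_hom R ?T X. compose (carrier ?T) g h = f"
        if XY: "g \<in> rmod_hom R X Y" "f \<in> rmod_hom R ?T Y" "right_module R X" "right_module R Y"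
          "g ` carrier X = carrier Y" for X Y :: "('r, 'v) rmodule" and g f
      proof -
        \<comment> \<open>\<open>T\<close> is a retract of the projective socle: lift
          \<open>f\<close> after \<open>\<pi>\<close> and restrict the result to
          \<open>T\<close>.\<close>
        have f\<pi>: "compose (carrier ?S) f \<pi> \<in> rmod_hom R ?S Y"
          by (rule rmod_hom_compose[OF SM \<pi>(1) XY(2)])
        then obtain h where h: "h \<in> rmod_hom R ?S X" "compose (carrier ?S) g h = compose (carrier ?S) f \<pi>"
          using p XY unfolding socle_projective_def projective_rmodule_def by blast
        have "restrict h T \<in> rmod_hom R ?T X"
          using rmod_hom_restrict[OF SM _ h(1), of T] sub_iff T Ts by simp
        moreover have "compose (carrier ?T) g (restrict h T) = f"
        proof (rule rmod_hom_eqI[OF rmod_hom_compose[OF TM calculation XY(1)] XY(2)])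
          fix x assume "x \<in> carrier ?T"
          then show "compose (carrier ?T) g (restrict h T) x = f x"
            using fun_cong[OF h(2), of x] Ts \<pi>(2)[of x x] by (auto simp: compose_def subset_iff Id_on_iff)
        qed
        ultimately show ?thesis by blast
      qed
      then show "projective_rmodule R ?T" unfolding projective_rmodule_def using TM by blast
    qed
  next
    assume q: "\<forall>S. rsubmodule S R M \<and> simple_rmodule R (M\<lparr>carrier := S\<rparr>) \<longrightarrow> projective_rmodule R (M\<lparr>carrier := S\<rparr>)"
    have "\<exists>h\<in>rmod_hom R ?S X. compose (carrier ?S) g h = f"
      if XY: "g \<in> rmod_hom R X Y" "f \<in> rmod_hom R ?S Y" "right_module R X" "right_module R Y"
        "g ` carrier X = carrier Y" for X Y :: "('r, 'v) rmodule" and g f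
    proof -
      interpret X: right_module R X by fact
      let ?E = "{(m, x). m \<in> socle R M \<and> x \<in> carrier X \<and> f m = g x}"
      have f0: "f \<zero>\<^bsub>M\<^esub> = \<zero>\<^bsub>Y\<^esub>" using rmod_hom_zero[OF SM XY(4,2)] by simp
      have g0: "g \<zero>\<^bsub>X\<^esub> = \<zero>\<^bsub>Y\<^esub>" by (rule rmod_hom_zero[OF XY(3,4,1)])
      have fs: "\<And>x y. \<lbrakk>x \<in> socle R M; y \<in> socle R M\<rbrakk> \<Longrightarrow> f (x \<oplus>\<^bsub>M\<^esub> y) = f x \<oplus>\<^bsub>Y\<^esub> f y"
        "\<And>x a. \<lbrakk>x \<in> socle R M; a \<in> carrier R\<rbrakk> \<Longrightarrow> f (x \<cdot>\<^bsub>M\<^esub> a) = f x \<cdot>\<^bsub>Y\<^esub> a"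
        using rmod_homD[OF XY(2)] by simp_all
      \<comment> \<open>\<open>?E\<close> is the pullback of \<open>f\<close> and \<open>g\<close>.
        A homomorphism with graph inside it is a lifting of \<open>f\<close>, and on a simple
        submodule one exists by projectivity.\<close>
      obtain h where h: "h \<in> rmod_hom R ?S X" "\<And>x. x \<in> carrier ?S \<Longrightarrow> (x, h x) \<in> ?E"
      proof (rule semisimple_hom_extension[OF SM XY(3) soc, of ?E "{(\<zero>\<^bsub>M\<^esub>, \<zero>\<^bsub>X\<^esub>)}"])
        show "linear_relation R ?S X ?E"
          using M.rsubmoduleD[OF sub] f0 g0 fs rmod_homD[OF XY(1)]
          by (intro linear_relationI) (auto simp: X.act_closed)
        show "linear_relation R ?S X {(\<zero>\<^bsub>M\<^esub>, \<zero>\<^bsub>X\<^esub>)}"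
          using M.rsubmoduleD[OF sub] by (intro linear_relationI) auto
        show "{(\<zero>\<^bsub>M\<^esub>, \<zero>\<^bsub>X\<^esub>)} \<subseteq> ?E" using M.rsubmoduleD[OF sub] f0 g0 by auto
        show "\<exists>h\<in>rmod_hom R (?S\<lparr>carrier := T\<rparr>) X. \<forall>s\<in>T. (s, h s) \<in> ?E"
          if T: "rsubmodule T R ?S" "simple_rmodule R (?S\<lparr>carrier := T\<rparr>)" for T
        proof -
          have Ts: "T \<subseteq> socle R M" "rsubmodule T R M" using T sub_iff by auto
          have "projective_rmodule R (M\<lparr>carrier := T\<rparr>)" using q Ts T by simp
          moreover have "restrict f T \<in> rmod_hom R (M\<lparr>carrier := T\<rparr>) Y"
            using rmod_hom_restrict[OF SM T(1) XY(2)] by simp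
          ultimately obtain h where h: "h \<in> rmod_hom R (M\<lparr>carrier := T\<rparr>) X"
            "compose (carrier (M\<lparr>carrier := T\<rparr>)) g h = restrict f T"
            using XY unfolding projective_rmodule_def by blast
          have "(s, h s) \<in> ?E" if "s \<in> T" for s
            using fun_cong[OF h(2), of s] that rmod_homD(1)[OF h(1), of s] Ts by (auto simp: compose_def)
          then show ?thesis using h by auto
        qed
      qed auto
      have "compose (carrier ?S) g h = f"
        using rmod_hom_eqI[OF rmod_hom_compose[OF SM h(1) XY(1)] XY(2)] h(2) by (auto simp: compose_def)
      then show ?thesis using h(1) by blast
    qed
    then show "socle_projective R M"
      unfolding socle_projective_def projective_rmodule_def using M SM by blast
  qed
qed


section \<open>Chains of subspaces\<close>

text \<open>A strictly increasing function on subspaces stands in for the dimension.\<close>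

context fin_dim_algebra
begin

definition has_rank :: "'a set \<Rightarrow> bool" where
  "has_rank U \<longleftrightarrow> (\<exists>\<rho> :: 'a set \<Rightarrow> nat. \<forall>V W. submodule V K A \<and> submodule W K A \<and> V \<subset> W \<and> W \<subseteq> U \<longrightarrow> \<rho> V < \<rho> W)"

lemma submodule_add_line:
  assumes U: "submodule U K A" and b: "b \<in> carrier A"
  shows "submodule {u \<oplus>\<^bsub>A\<^esub> k \<odot>\<^bsub>A\<^esub> b | u k. u \<in> U \<and> k \<in> carrier K} K A"
proof (rule submoduleI)
  note u = submoduleE[OF U]
  have uA: "\<And>x. x \<in> U \<Longrightarrow> x \<in> carrier A" using u(1) by blast
  let ?L = "{u \<oplus>\<^bsub>A\<^esub> k \<odot>\<^bsub>A\<^esub> b | u k. u \<in> U \<and> k \<in> carrier K}"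
  have I: "u \<oplus>\<^bsub>A\<^esub> k \<odot>\<^bsub>A\<^esub> b \<in> ?L" if "u \<in> U" "k \<in> carrier K" for u k using that by blast
  show "?L \<subseteq> carrier A" using uA b by auto
  have "\<zero>\<^bsub>A\<^esub> \<in> U" using u(2,3,5) uA M.r_neg by (metis ex_in_conv)
  then show "\<zero>\<^bsub>A\<^esub> \<in> ?L" using I[of "\<zero>\<^bsub>A\<^esub>" "\<zero>\<^bsub>K\<^esub>"] b by simp
next
  note u = submoduleE[OF U]
  have uA: "\<And>x. x \<in> U \<Longrightarrow> x \<in> carrier A" using u(1) by blast
  let ?L = "{u \<oplus>\<^bsub>A\<^esub> k \<odot>\<^bsub>A\<^esub> b | u k. u \<in> U \<and> k \<in> carrier K}"
  have I: "u \<oplus>\<^bsub>A\<^esub> k \<odot>\<^bsub>A\<^esub> b \<in> ?L" if "u \<in> U" "k \<in> carrier K" for u k using that by blast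
  {
    fix x assume "x \<in> ?L"
    then obtain v k where x: "x = v \<oplus>\<^bsub>A\<^esub> k \<odot>\<^bsub>A\<^esub> b" "v \<in> U" "k \<in> carrier K" by blast
    then have "\<ominus>\<^bsub>A\<^esub> x = \<ominus>\<^bsub>A\<^esub> v \<oplus>\<^bsub>A\<^esub> (\<ominus>\<^bsub>K\<^esub> k) \<odot>\<^bsub>A\<^esub> b"
      using uA b by (simp add: M.minus_add smult_l_minus)
    then show "\<ominus>\<^bsub>A\<^esub> x \<in> ?L" using I[OF u(3)[OF x(2)], of "\<ominus>\<^bsub>K\<^esub> k"] x by simp
  next
    fix x y assume "x \<in> ?L" "y \<in> ?L"
    then obtain v k w l where x: "x = v \<oplus>\<^bsub>A\<^esub> k \<odot>\<^bsub>A\<^esub> b" "v \<in> U" "k \<in> carrier K"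
      "y = w \<oplus>\<^bsub>A\<^esub> l \<odot>\<^bsub>A\<^esub> b" "w \<in> U" "l \<in> carrier K" by blast
    then have "x \<oplus>\<^bsub>A\<^esub> y = (v \<oplus>\<^bsub>A\<^esub> w) \<oplus>\<^bsub>A\<^esub> (k \<oplus>\<^bsub>K\<^esub> l) \<odot>\<^bsub>A\<^esub> b"
      using uA b by (simp add: smult_l_distr M.add.m_ac)
    then show "x \<oplus>\<^bsub>A\<^esub> y \<in> ?L" using I[OF u(5)[OF x(2,5)], of "k \<oplus>\<^bsub>K\<^esub> l"] x by simp
  next
    fix a x assume a: "a \<in> carrier K" and "x \<in> ?L"
    then obtain v k where x: "x = v \<oplus>\<^bsub>A\<^esub> k \<odot>\<^bsub>A\<^esub> b" "v \<in> U" "k \<in> carrier K" by blast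
    then have "a \<odot>\<^bsub>A\<^esub> x = a \<odot>\<^bsub>A\<^esub> v \<oplus>\<^bsub>A\<^esub> (a \<otimes>\<^bsub>K\<^esub> k) \<odot>\<^bsub>A\<^esub> b"
      using uA b a by (simp add: smult_r_distr smult_assoc1)
    then show "a \<odot>\<^bsub>A\<^esub> x \<in> ?L" using I[OF u(4)[OF a x(2)], of "a \<otimes>\<^bsub>K\<^esub> k"] x a by simp
  }
qed

lemma submodule_Int: "\<lbrakk>submodule V K A; submodule W K A\<rbrakk> \<Longrightarrow> submodule (V \<inter> W) K A"
proof (rule submoduleI)
  assume VW: "submodule V K A" "submodule W K A"
  note v = submoduleE[OF VW(1)] and w = submoduleE[OF VW(2)]
  show "V \<inter> W \<subseteq> carrier A" using v(1) by blast
  have "\<zero>\<^bsub>A\<^esub> \<in> V" using v(1,2,3,5) M.r_neg by (metis ex_in_conv subset_iff)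
  moreover have "\<zero>\<^bsub>A\<^esub> \<in> W" using w(1,2,3,5) M.r_neg by (metis ex_in_conv subset_iff)
  ultimately show "\<zero>\<^bsub>A\<^esub> \<in> V \<inter> W" by simp
  show "\<ominus>\<^bsub>A\<^esub> x \<in> V \<inter> W" if "x \<in> V \<inter> W" for x using that v(3) w(3) by blast
  show "x \<oplus>\<^bsub>A\<^esub> y \<in> V \<inter> W" if "x \<in> V \<inter> W" "y \<in> V \<inter> W" for x y using that v(5) w(5) by blast
  show "k \<odot>\<^bsub>A\<^esub> x \<in> V \<inter> W" if "k \<in> carrier K" "x \<in> V \<inter> W" for k x using that v(4) w(4) by blast
qed

text \<open>The new rank of \<open>V\<close> is the old rank of \<open>V \<inter> U\<close>, plus
  one once \<open>V\<close> leaves \<open>U\<close>. If \<open>V\<close> and \<open>W\<close> meet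
  \<open>U\<close> in the same subspace and \<open>V\<close> already leaves \<open>U\<close>, then
  subtracting a multiple of one vector of \<open>V\<close> moves any vector of \<open>W\<close> into
  that common part, so \<open>W \<subseteq> V\<close>.\<close>

lemma has_rank_add_line:
  assumes U: "submodule U K A" and b: "b \<in> carrier A" and r: "has_rank U"
  shows "has_rank {u \<oplus>\<^bsub>A\<^esub> k \<odot>\<^bsub>A\<^esub> b | u k. u \<in> U \<and> k \<in> carrier K}" (is "has_rank ?L")
proof -
  obtain \<rho> :: "'a set \<Rightarrow> nat" where \<rho>: "\<And>V W. \<lbrakk>submodule V K A; submodule W K A; V \<subset> W; W \<subseteq> U\<rbrakk> \<Longrightarrow> \<rho> V < \<rho> W"
    using r unfolding has_rank_def by blast
  define \<sigma> where "\<sigma> V = \<rho> (V \<inter> U) + (if V \<subseteq> U then 0 else 1)" for V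
  have "\<sigma> V < \<sigma> W" if V: "submodule V K A" and W: "submodule W K A" and VW: "V \<subset> W" and WL: "W \<subseteq> ?L" for V W
  proof (cases "V \<inter> U = W \<inter> U")
    case False
    then have "\<rho> (V \<inter> U) < \<rho> (W \<inter> U)"
      using VW by (intro \<rho> submodule_Int U V W) auto
    then show ?thesis using VW unfolding \<sigma>_def by auto
  next
    case True
    then have WU: "\<not> W \<subseteq> U" using VW by blast
    have "V \<subseteq> U"
    proof (rule ccontr)
      note v = submoduleE[OF V] and w = submoduleE[OF W] and u = submoduleE[OF U]
      have uA: "\<And>x. x \<in> U \<Longrightarrow> x \<in> carrier A" using u(1) by blast
      assume "\<not> V \<subseteq> U"
      then obtain x where x: "x \<in> V" "x \<notin> U" by blast
      then obtain y k where y: "x = y \<oplus>\<^bsub>A\<^esub> k \<odot>\<^bsub>A\<^esub> b" "y \<in> U" "k \<in> carrier K" using VW WL by blast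
      \<comment> \<open>With zero as coefficient of \<open>b\<close> the vector \<open>x\<close>
        would lie in \<open>U\<close>.\<close>
      have "k \<noteq> \<zero>\<^bsub>K\<^esub>" using x y b uA by (metis M.r_zero smult_l_null)
      then have k: "inv\<^bsub>K\<^esub> k \<in> carrier K" "inv\<^bsub>K\<^esub> k \<otimes>\<^bsub>K\<^esub> k = \<one>\<^bsub>K\<^esub>"
        using y(3) field_Units by auto
      have "W \<subseteq> V"
      proof
        fix z assume z: "z \<in> W"
        then obtain t l where t: "z = t \<oplus>\<^bsub>A\<^esub> l \<odot>\<^bsub>A\<^esub> b" "t \<in> U" "l \<in> carrier K" using WL by blast
        \<comment> \<open>With this coefficient \<open>z\<close> and \<open>c x\<close> have the
          same multiple of \<open>b\<close>, so their difference \<open>d\<close> lies in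
          \<open>U\<close>.\<close>
        define c where "c = l \<otimes>\<^bsub>K\<^esub> inv\<^bsub>K\<^esub> k"
        have c: "c \<in> carrier K" "c \<otimes>\<^bsub>K\<^esub> k = l"
          using k t(3) y(3) by (auto simp: c_def m_assoc)
        have tA: "t \<in> carrier A" "y \<in> carrier A" using uA t y by auto
        have cx: "c \<odot>\<^bsub>A\<^esub> x = c \<odot>\<^bsub>A\<^esub> y \<oplus>\<^bsub>A\<^esub> l \<odot>\<^bsub>A\<^esub> b"
          using y(1,3) tA c b by (simp add: smult_r_distr flip: smult_assoc1)
        define d where "d = t \<oplus>\<^bsub>A\<^esub> \<ominus>\<^bsub>A\<^esub> (c \<odot>\<^bsub>A\<^esub> y)"
        have d: "d \<in> U" unfolding d_def using u(3,4,5) t(2) y(2) c(1) by blast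
        have zd: "z = d \<oplus>\<^bsub>A\<^esub> c \<odot>\<^bsub>A\<^esub> x"
          unfolding cx d_def t(1) using tA c(1) t(3) b by (simp add: M.a_assoc M.r_neg1)
        have cxV: "c \<odot>\<^bsub>A\<^esub> x \<in> V" using v(4)[OF c(1) x(1)] .
        have dz: "d = z \<oplus>\<^bsub>A\<^esub> \<ominus>\<^bsub>A\<^esub> (c \<odot>\<^bsub>A\<^esub> x)"
          unfolding zd using uA[OF d] v(1) cxV by (simp add: M.add.m_assoc M.r_neg subset_iff)
        have "d \<in> W" unfolding dz using w(5)[OF z] v(3)[OF cxV] VW by blast
        then have "d \<in> V" using d True by blast
        then show "z \<in> V" unfolding zd using v(5) cxV by blast
      qed
      then show False using VW by blast
    qed
    then show ?thesis using True WU unfolding \<sigma>_def by simp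
  qed
  then show ?thesis unfolding has_rank_def by blast
qed

text \<open>Induction over a finite spanning set, adjoining one line at a time.\<close>

lemma has_rank_carrier: "has_rank (carrier A)"
proof -
  obtain B where B: "finite B" "B \<subseteq> carrier A"
    "\<forall>x\<in>carrier A. \<exists>c\<in>B \<rightarrow> carrier K. x = (\<Oplus>\<^bsub>A\<^esub>b\<in>B. c b \<odot>\<^bsub>A\<^esub> b)" using fin_dim by blast
  have "\<exists>U. submodule U K A \<and> has_rank U \<and> (\<forall>c\<in>B \<rightarrow> carrier K. (\<Oplus>\<^bsub>A\<^esub>b\<in>B. c b \<odot>\<^bsub>A\<^esub> b) \<in> U)"
    using B(1,2)
  proof (induction rule: finite_induct)
    case empty
    have "submodule {\<zero>\<^bsub>A\<^esub>} K A" by (rule submoduleI) auto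
    moreover have "has_rank {\<zero>\<^bsub>A\<^esub>}"
    proof -
      \<comment> \<open>A subspace is not empty, so no proper inclusion of subspaces exists inside
        the zero space.\<close>
      have *: False if "submodule V K A" "V \<subset> W" "W \<subseteq> {\<zero>\<^bsub>A\<^esub>}" for V W
      proof -
        have "W = {\<zero>\<^bsub>A\<^esub>}" "V = {}" using that(2,3) by auto
        then show False using submoduleE(2)[OF that(1)] by simp
      qed
      show ?thesis
        unfolding has_rank_def by (intro exI[of _ "\<lambda>_. 0"] allI impI) (elim conjE, drule (2) *, rule FalseE)
    qed
    ultimately show ?case by (intro exI[of _ "{\<zero>\<^bsub>A\<^esub>}"]) auto
  next
    case (insert b B)
    have bA: "b \<in> carrier A" and BA: "B \<subseteq> carrier A" using insert.prems by auto
    obtain U where U: "submodule U K A" "has_rank U"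
      "\<And>c. c \<in> B \<rightarrow> carrier K \<Longrightarrow> (\<Oplus>\<^bsub>A\<^esub>b\<in>B. c b \<odot>\<^bsub>A\<^esub> b) \<in> U"
      using insert.IH[OF BA] by metis
    let ?L = "{u \<oplus>\<^bsub>A\<^esub> k \<odot>\<^bsub>A\<^esub> b | u k. u \<in> U \<and> k \<in> carrier K}"
    have "(\<Oplus>\<^bsub>A\<^esub>b\<in>insert b B. c b \<odot>\<^bsub>A\<^esub> b) \<in> ?L" if c: "c \<in> insert b B \<rightarrow> carrier K" for c
    proof -
      have cB: "c \<in> B \<rightarrow> carrier K" and cb: "c b \<in> carrier K" using c by auto
      have "(\<Oplus>\<^bsub>A\<^esub>b\<in>insert b B. c b \<odot>\<^bsub>A\<^esub> b) = c b \<odot>\<^bsub>A\<^esub> b \<oplus>\<^bsub>A\<^esub> (\<Oplus>\<^bsub>A\<^esub>b\<in>B. c b \<odot>\<^bsub>A\<^esub> b)"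
        using insert.hyps cB cb bA BA by (intro M.finsum_insert) auto
      also have "\<dots> = (\<Oplus>\<^bsub>A\<^esub>b\<in>B. c b \<odot>\<^bsub>A\<^esub> b) \<oplus>\<^bsub>A\<^esub> c b \<odot>\<^bsub>A\<^esub> b"
        using cB cb bA BA by (intro M.a_comm M.finsum_closed) auto
      finally show ?thesis using U(3)[OF cB] cb by blast
    qed
    then show ?case using submodule_add_line[OF U(1) bA] has_rank_add_line[OF U(1) bA U(2)] by blast
  qed
  then obtain U where U: "has_rank U" "\<And>c. c \<in> B \<rightarrow> carrier K \<Longrightarrow> (\<Oplus>\<^bsub>A\<^esub>b\<in>B. c b \<odot>\<^bsub>A\<^esub> b) \<in> U" by blast
  have "carrier A \<subseteq> U"
  proof
    fix x assume "x \<in> carrier A"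
    then obtain c where "c \<in> B \<rightarrow> carrier K" "x = (\<Oplus>\<^bsub>A\<^esub>b\<in>B. c b \<odot>\<^bsub>A\<^esub> b)" using B(3) by blast
    then show "x \<in> U" using U(2) by simp
  qed
  then show ?thesis using U(1) unfolding has_rank_def by (meson order_trans)
qed

text \<open>The right ideals of the incidence algebra are subspaces of this kind, which reduces
  chains of right ideals to chains of subspaces of \<open>A\<close>.\<close>

definition matrix_subspace :: "('q \<Rightarrow> 'q \<Rightarrow> 'a) set \<Rightarrow> bool" where
  "matrix_subspace V \<longleftrightarrow> (\<lambda>i j. \<zero>\<^bsub>A\<^esub>) \<in> V \<and> (\<forall>X\<in>V. \<forall>i j. X i j \<in> carrier A) \<and>
     (\<forall>X\<in>V. \<forall>Y\<in>V. (\<lambda>i j. X i j \<oplus>\<^bsub>A\<^esub> Y i j) \<in> V) \<and>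
     (\<forall>k\<in>carrier K. \<forall>X\<in>V. (\<lambda>i j. k \<odot>\<^bsub>A\<^esub> X i j) \<in> V)"

lemma matrix_subspaceD:
  assumes "matrix_subspace V"
  shows "(\<lambda>i j. \<zero>\<^bsub>A\<^esub>) \<in> V" "\<And>X i j. X \<in> V \<Longrightarrow> X i j \<in> carrier A"
    "\<And>X Y. \<lbrakk>X \<in> V; Y \<in> V\<rbrakk> \<Longrightarrow> (\<lambda>i j. X i j \<oplus>\<^bsub>A\<^esub> Y i j) \<in> V"
    "\<And>k X. \<lbrakk>k \<in> carrier K; X \<in> V\<rbrakk> \<Longrightarrow> (\<lambda>i j. k \<odot>\<^bsub>A\<^esub> X i j) \<in> V"
    "\<And>X. X \<in> V \<Longrightarrow> (\<lambda>i j. \<ominus>\<^bsub>A\<^esub> X i j) \<in> V"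
proof -
  show X: "\<And>X i j. X \<in> V \<Longrightarrow> X i j \<in> carrier A" and "(\<lambda>i j. \<zero>\<^bsub>A\<^esub>) \<in> V"
    and "\<And>X Y. \<lbrakk>X \<in> V; Y \<in> V\<rbrakk> \<Longrightarrow> (\<lambda>i j. X i j \<oplus>\<^bsub>A\<^esub> Y i j) \<in> V"
    and k: "\<And>k X. \<lbrakk>k \<in> carrier K; X \<in> V\<rbrakk> \<Longrightarrow> (\<lambda>i j. k \<odot>\<^bsub>A\<^esub> X i j) \<in> V"
    using assms unfolding matrix_subspace_def by auto
  fix X assume "X \<in> V"
  then show "(\<lambda>i j. \<ominus>\<^bsub>A\<^esub> X i j) \<in> V"
    using k[of "\<ominus>\<^bsub>K\<^esub> \<one>\<^bsub>K\<^esub>" X] X by (simp add: smult_l_minus)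
qed

text \<open>Induction over the set \<open>Z\<close> of positions that may be nonzero. One position
  splits a subspace into its values there, ranked as a subspace of \<open>A\<close>, and the
  matrices vanishing there, ranked by induction; the two ranks are added.\<close>

lemma matrix_subspace_rank:
  assumes "finite Z"
  shows "\<exists>\<rho> :: ('q \<Rightarrow> 'q \<Rightarrow> 'a) set \<Rightarrow> nat. \<forall>V W. matrix_subspace V \<and> matrix_subspace W \<and> V \<subset> W \<and>
    (\<forall>X\<in>W. \<forall>i j. (i, j) \<notin> Z \<longrightarrow> X i j = \<zero>\<^bsub>A\<^esub>) \<longrightarrow> \<rho> V < \<rho> W"
  using assms
proof (induction rule: finite_induct)
  case empty
  have *: False if VW: "matrix_subspace V" "V \<subset> W" "\<forall>X\<in>W. \<forall>i j. X i j = \<zero>\<^bsub>A\<^esub>" for V W :: "('q \<Rightarrow> 'q \<Rightarrow> 'a) set"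
  proof -
    obtain X where X: "X \<in> W" "X \<notin> V" using VW(2) by blast
    then have "X = (\<lambda>i j. \<zero>\<^bsub>A\<^esub>)" using VW(3) by blast
    then show False using X matrix_subspaceD(1)[OF VW(1)] by simp
  qed
  show ?case by (intro exI[of _ "\<lambda>_. 0"] allI impI) (use * in blast)
next
  case (insert z Z)
  obtain p q where z: "z = (p, q)" by (cases z)
  obtain \<rho> :: "('q \<Rightarrow> 'q \<Rightarrow> 'a) set \<Rightarrow> nat" where \<rho>: "\<And>V W. \<lbrakk>matrix_subspace V; matrix_subspace W; V \<subset> W;
    \<forall>X\<in>W. \<forall>i j. (i, j) \<notin> Z \<longrightarrow> X i j = \<zero>\<^bsub>A\<^esub>\<rbrakk> \<Longrightarrow> \<rho> V < \<rho> W"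
    using insert.IH by metis
  obtain \<alpha> :: "'a set \<Rightarrow> nat" where \<alpha>: "\<And>V W. \<lbrakk>submodule V K A; submodule W K A; V \<subset> W\<rbrakk> \<Longrightarrow> \<alpha> V < \<alpha> W"
    using has_rank_carrier submoduleE(1) unfolding has_rank_def by metis
  define ev where "ev V = (\<lambda>X. X p q) ` V" for V :: "('q \<Rightarrow> 'q \<Rightarrow> 'a) set"
  define ker where "ker V = {X \<in> V. X p q = \<zero>\<^bsub>A\<^esub>}" for V :: "('q \<Rightarrow> 'q \<Rightarrow> 'a) set"
  have ev: "submodule (ev V) K A" if V: "matrix_subspace V" for V
  proof (rule submoduleI)
    note v = matrix_subspaceD[OF V]
    show "ev V \<subseteq> carrier A" using v(2) unfolding ev_def by blast
    show "\<zero>\<^bsub>A\<^esub> \<in> ev V" unfolding ev_def by (rule image_eqI[OF _ v(1)]) simp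
    show "\<ominus>\<^bsub>A\<^esub> a \<in> ev V" if "a \<in> ev V" for a
      using that unfolding ev_def by (auto intro: image_eqI[OF _ v(5)])
    show "a \<oplus>\<^bsub>A\<^esub> b \<in> ev V" if "a \<in> ev V" "b \<in> ev V" for a b
      using that unfolding ev_def by (auto intro: image_eqI[OF _ v(3)])
    show "k \<odot>\<^bsub>A\<^esub> a \<in> ev V" if "k \<in> carrier K" "a \<in> ev V" for k a
      using that unfolding ev_def by (auto intro: image_eqI[OF _ v(4)])
  qed
  have ker: "matrix_subspace (ker V)" if V: "matrix_subspace V" for V
    using matrix_subspaceD[OF V] unfolding matrix_subspace_def ker_def by auto
  have "\<alpha> (ev V) + \<rho> (ker V) < \<alpha> (ev W) + \<rho> (ker W)"
    if V: "matrix_subspace V" and W: "matrix_subspace W" and VW: "V \<subset> W"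
      and s: "\<forall>X\<in>W. \<forall>i j. (i, j) \<notin> insert z Z \<longrightarrow> X i j = \<zero>\<^bsub>A\<^esub>" for V W
  proof -
    have e: "ev V \<subseteq> ev W" and k: "ker V \<subseteq> ker W" using VW unfolding ev_def ker_def by auto
    have sk: "\<forall>X\<in>ker W. \<forall>i j. (i, j) \<notin> Z \<longrightarrow> X i j = \<zero>\<^bsub>A\<^esub>"
    proof (intro ballI allI impI)
      fix X i j assume "X \<in> ker W" "(i, j) \<notin> Z"
      then show "X i j = \<zero>\<^bsub>A\<^esub>" using s unfolding ker_def z by (cases "(i, j) = (p, q)") auto
    qed
    \<comment> \<open>If both parts agree, a matrix of \<open>W\<close> differs from one of
      \<open>V\<close> with the same entry at \<open>(p, q)\<close> by an element of the common
      kernel, so it lies in \<open>V\<close>.\<close>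
    have "ev V \<noteq> ev W \<or> ker V \<noteq> ker W"
    proof (rule ccontr)
      note v = matrix_subspaceD[OF V] and w = matrix_subspaceD[OF W]
      assume c: "\<not> (ev V \<noteq> ev W \<or> ker V \<noteq> ker W)"
      have "W \<subseteq> V"
      proof
        fix X assume X: "X \<in> W"
        then obtain Y where Y: "Y \<in> V" "Y p q = X p q" 
        proof -
          have "X p q \<in> ev W" using X unfolding ev_def by blast
          then have "X p q \<in> ev V" using c by blast
          then obtain Y where "Y \<in> V" "Y p q = X p q" unfolding ev_def by auto
          then show ?thesis by (rule that)
        qed
        define D where "D = (\<lambda>i j. X i j \<oplus>\<^bsub>A\<^esub> \<ominus>\<^bsub>A\<^esub> Y i j)"
        have "D \<in> W" unfolding D_def using w(3)[OF X w(5)] Y VW by blast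
        moreover have "D p q = \<zero>\<^bsub>A\<^esub>" unfolding D_def using Y(2) w(2)[OF X] by (simp add: M.r_neg)
        ultimately have "D \<in> V" using c unfolding ker_def by blast
        then have "(\<lambda>i j. D i j \<oplus>\<^bsub>A\<^esub> Y i j) \<in> V" using v(3) Y by blast
        also have "(\<lambda>i j. D i j \<oplus>\<^bsub>A\<^esub> Y i j) = X"
          unfolding D_def using w(2)[OF X] v(2)[OF Y(1)] by (intro ext) (simp add: M.add.m_assoc M.l_neg)
        finally show "X \<in> V" .
      qed
      then show False using VW by blast
    qed
    moreover have "\<alpha> (ev V) \<le> \<alpha> (ev W)" 
      using \<alpha>[OF ev[OF V] ev[OF W]] e by (metis less_imp_le order_refl psubsetI)
    moreover have "\<rho> (ker V) \<le> \<rho> (ker W)" 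
      using \<rho>[OF ker[OF V] ker[OF W] _ sk] k by (metis less_imp_le order_refl psubsetI)
    moreover have "\<alpha> (ev V) < \<alpha> (ev W)" if "ev V \<noteq> ev W" using \<alpha>[OF ev[OF V] ev[OF W]] e that by blast
    moreover have "\<rho> (ker V) < \<rho> (ker W)" if "ker V \<noteq> ker W" using \<rho>[OF ker[OF V] ker[OF W] _ sk] k that by blast
    ultimately show ?thesis by linarith
  qed
  then show ?case by (intro exI[of _ "\<lambda>V. \<alpha> (ev V) + \<rho> (ker V)"]) blast
qed

end


section \<open>Simple submodules and transport of structure\<close>

lemma (in ring) right_module_regular: "right_module R (regular_rmodule R)"
proof -
  have "abelian_group (regular_rmodule R)"
  proof (rule abelian_groupI)
    fix x assume "x \<in> carrier (regular_rmodule R)"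
    then show "\<exists>y\<in>carrier (regular_rmodule R). y \<oplus>\<^bsub>regular_rmodule R\<^esub> x = \<zero>\<^bsub>regular_rmodule R\<^esub>"
      by (intro bexI[of _ "\<ominus> x"]) (auto simp: regular_rmodule_def l_neg)
  qed (auto simp: regular_rmodule_def a_ac)
  then show ?thesis
    by (intro right_module.intro right_module_axioms.intro ring_axioms)
      (auto simp: regular_rmodule_def r_distr l_distr m_assoc)
qed

text \<open>\<open>M\<close> may have no chain condition, but a cyclic submodule has one: a
  submodule \<open>W\<close> of \<open>x R\<close> is determined by the right ideal of all
  \<open>a\<close> with \<open>x a\<close> in \<open>W\<close>. A nonzero \<open>W\<close> for which
  this ideal has least rank is simple.\<close>

lemma (in right_module) exists_simple_rsubmodule:
  fixes \<rho> :: "'r set \<Rightarrow> nat"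
  assumes \<rho>: "\<And>I J. \<lbrakk>rsubmodule I R (regular_rmodule R); rsubmodule J R (regular_rmodule R); I \<subset> J\<rbrakk> \<Longrightarrow> \<rho> I < \<rho> J"
    and N: "rsubmodule N R M" "N \<noteq> {\<zero>\<^bsub>M\<^esub>}"
  obtains S where "rsubmodule S R M" "S \<subseteq> N" "simple_rmodule R (M\<lparr>carrier := S\<rparr>)"
proof -
  note n = rsubmoduleD[OF N(1)]
  obtain x where x: "x \<in> N" "x \<noteq> \<zero>\<^bsub>M\<^esub>" using N n(2) by blast
  have xM: "x \<in> carrier M" using x n by blast
  let ?C = "{x \<cdot>\<^bsub>M\<^esub> a | a. a \<in> carrier R}"
  \<comment> \<open>The preimage of \<open>W\<close> under \<open>a \<mapsto> x a\<close>; for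
    \<open>W = 0\<close> it is the annihilator of \<open>x\<close>.\<close>
  define ann where "ann W = {a \<in> carrier R. x \<cdot>\<^bsub>M\<^esub> a \<in> W}" for W
  interpret reg: right_module R "regular_rmodule R" by (rule R.right_module_regular)
  have ann: "rsubmodule (ann W) R (regular_rmodule R)" if W: "rsubmodule W R M" for W
    using rsubmoduleD[OF W] xM
    by (intro reg.rsubmoduleI) (auto simp: ann_def regular_rmodule_def act_add act_assoc)
  let ?P = "\<lambda>W. rsubmodule W R M \<and> W \<subseteq> ?C \<and> W \<noteq> {\<zero>\<^bsub>M\<^esub>}"
  have "x \<in> ?C" using act_one[OF xM, symmetric] R.one_closed by blast
  then have "?P ?C" using rsubmodule_cyclic[OF xM] x(2) by blast
  then obtain S where S: "?P S" and min: "\<And>W. ?P W \<Longrightarrow> \<rho> (ann S) \<le> \<rho> (ann W)"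
    using ex_has_least_nat[of ?P ?C "\<lambda>W. \<rho> (ann W)"] by blast
  have SN: "S \<subseteq> N" using S n(4) x by blast
  have sM: "right_module R (M\<lparr>carrier := S\<rparr>)" using S right_module_rsubmodule by blast
  have "W = {\<zero>\<^bsub>M\<^esub>} \<or> W = S" if W: "rsubmodule W R (M\<lparr>carrier := S\<rparr>)" for W
  proof (rule ccontr)
    assume c: "\<not> (W = {\<zero>\<^bsub>M\<^esub>} \<or> W = S)"
    have W': "W \<subseteq> S" "rsubmodule W R M" using W rsubmodule_rsubmodule_iff S by auto
    then have "?P W" using S c by blast
    then have le: "\<rho> (ann S) \<le> \<rho> (ann W)" by (rule min)
    obtain y where y: "y \<in> S" "y \<notin> W" using W' c by blast
    then obtain a where a: "a \<in> carrier R" "y = x \<cdot>\<^bsub>M\<^esub> a" using S by blast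
    have "ann W \<subset> ann S" using W' y a unfolding ann_def by blast
    then show False using \<rho>[OF ann[OF W'(2)] ann] S le by fastforce
  qed
  then have "simple_rmodule R (M\<lparr>carrier := S\<rparr>)"
    using S sM unfolding simple_rmodule_def by auto
  then show ?thesis using that S SN by blast
qed

text \<open>Copies a module along a map that is injective on its carrier. It brings the regular
  module and modules of families into the element type of the category.\<close>

definition transport_rmodule :: "('v \<Rightarrow> 'w) \<Rightarrow> ('r, 'v) rmodule \<Rightarrow> ('r, 'w) rmodule" where
  "transport_rmodule f M = (let g = inv_into (carrier M) f in
     \<lparr>carrier = f ` carrier M, mult = undefined, one = undefined, zero = f \<zero>\<^bsub>M\<^esub>,
      add = (\<lambda>x y. f (g x \<oplus>\<^bsub>M\<^esub> g y)), act = (\<lambda>x a. f (g x \<cdot>\<^bsub>M\<^esub> a))\<rparr>)"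

lemma transport_rmodule:
  assumes M: "right_module R M" and f: "inj_on f (carrier M)"
  shows "right_module R (transport_rmodule f M)"
    and "restrict f (carrier M) \<in> rmod_hom R M (transport_rmodule f M)"
    and "f ` carrier M = carrier (transport_rmodule f M)"
proof -
  interpret right_module R M by fact
  let ?N = "transport_rmodule f M"
  have N: "carrier ?N = f ` carrier M" "\<zero>\<^bsub>?N\<^esub> = f \<zero>\<^bsub>M\<^esub>"
    "\<And>x y. \<lbrakk>x \<in> carrier M; y \<in> carrier M\<rbrakk> \<Longrightarrow> f x \<oplus>\<^bsub>?N\<^esub> f y = f (x \<oplus>\<^bsub>M\<^esub> y)"
    "\<And>x a. x \<in> carrier M \<Longrightarrow> f x \<cdot>\<^bsub>?N\<^esub> a = f (x \<cdot>\<^bsub>M\<^esub> a)"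
    using f by (simp_all add: transport_rmodule_def Let_def)
  have "abelian_group ?N"
  proof (rule abelian_groupI)
    fix x assume "x \<in> carrier ?N"
    then obtain u where "u \<in> carrier M" "x = f u" using N by auto
    then show "\<exists>y\<in>carrier ?N. y \<oplus>\<^bsub>?N\<^esub> x = \<zero>\<^bsub>?N\<^esub>"
      using N M.l_neg by (intro bexI[of _ "f (\<ominus>\<^bsub>M\<^esub> u)"]) auto
  qed (auto simp: N M.a_ac)
  then show "right_module R ?N"
    by (intro right_module.intro right_module_axioms.intro R.ring_axioms)
      (auto simp: N act_closed act_add add_act act_assoc act_one)
  show "restrict f (carrier M) \<in> rmod_hom R M ?N"
    by (rule rmod_homI) (auto simp: N M)
  show "f ` carrier M = carrier ?N" by (simp add: N)
qed

text \<open>One factor is added at a time, since an infinite set is equinumerous with its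
  square.\<close>

lemma PiE_lepoll_infinite:
  assumes "finite J" and "infinite (UNIV :: 'v set)"
  shows "(J \<rightarrow>\<^sub>E (UNIV :: 'v set)) \<lesssim> (UNIV :: 'v set)"
  using assms(1)
proof (induction rule: finite_induct)
  case empty
  then show ?case by (auto simp: lepoll_def)
next
  case (insert j J)
  have "insert j J \<rightarrow>\<^sub>E (UNIV :: 'v set) \<lesssim> (UNIV :: 'v set) \<times> (J \<rightarrow>\<^sub>E (UNIV :: 'v set))"
    unfolding PiE_insert_eq by (rule image_lepoll)
  also have "\<dots> \<lesssim> (UNIV :: 'v set) \<times> (UNIV :: 'v set)"
    using insert.IH by (intro times_lepoll_mono) auto
  also have "(UNIV :: 'v set) \<times> (UNIV :: 'v set) \<approx> (UNIV :: 'v set)"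
    using card_of_Times_same_infinite[OF assms(2)] by (simp add: eqpoll_iff_card_of_ordIso)
  finally show ?case .
qed


section \<open>Simple modules are generated by any nonzero element\<close>

lemma simple_rmodule_nonzero:
  assumes "simple_rmodule R M"
  obtains x where "x \<in> carrier M" "x \<noteq> \<zero>\<^bsub>M\<^esub>"
proof -
  interpret right_module R M using assms unfolding simple_rmodule_def by blast
  have "carrier M \<noteq> {\<zero>\<^bsub>M\<^esub>}" using assms unfolding simple_rmodule_def by blast
  then show ?thesis using that M.zero_closed by (metis is_singletonI' is_singleton_the_elem singletonD empty_iff)
qed

lemma simple_rmoduleD:
  "\<lbrakk>simple_rmodule R M; rsubmodule N R M\<rbrakk> \<Longrightarrow> N = {\<zero>\<^bsub>M\<^esub>} \<or> N = carrier M"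
  unfolding simple_rmodule_def by blast

lemma simple_rmodule_cyclic:
  assumes M: "simple_rmodule R M" and x: "x \<in> carrier M" "x \<noteq> \<zero>\<^bsub>M\<^esub>" and y: "y \<in> carrier M"
  obtains a where "a \<in> carrier R" "y = x \<cdot>\<^bsub>M\<^esub> a"
proof -
  interpret right_module R M using M unfolding simple_rmodule_def by blast
  have "x \<in> {x \<cdot>\<^bsub>M\<^esub> a | a. a \<in> carrier R}" using act_one[OF x(1), symmetric] R.one_closed by blast
  then have "{x \<cdot>\<^bsub>M\<^esub> a | a. a \<in> carrier R} = carrier M"
    using simple_rmoduleD[OF M rsubmodule_cyclic[OF x(1)]] x(2) by auto
  then show ?thesis using that y by auto
qed


section \<open>Modules over an incidence algebra with a top element\<close>

text \<open>The features of \<open>\<Lambda>(\<T>\<^sup>m)\<close> on which the argument rests: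
  nothing lies above \<open>m\<close>, the column of \<open>m\<close> consists of copies of
  \<open>A\<close>, and each diagonal part contains the unit of \<open>A\<close>. That the matrices
  form a ring is an axiom here and is supplied by the Morita hypothesis.\<close>

locale top_incidence = fin_dim_algebra K A
  for K :: "('k, 'c) ring_scheme" and A :: "('k, 'a) module" +
  fixes I :: "'q set" and s :: "'q rel" and m :: 'q and S :: "'q \<Rightarrow> 'q \<Rightarrow> 'a set"
  assumes finite_I: "finite I" and s_sub: "s \<subseteq> I \<times> I" and s_refl: "i \<in> I \<Longrightarrow> (i, i) \<in> s"
    and m_in: "m \<in> I" and s_top: "i \<in> I \<Longrightarrow> (i, m) \<in> s" and s_max: "(m, j) \<in> s \<Longrightarrow> j = m"
    and S_sub: "(i, j) \<in> s \<Longrightarrow> submodule (S i j) K A" and S_one: "i \<in> I \<Longrightarrow> \<one>\<^bsub>A\<^esub> \<in> S i i"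
    and S_top: "i \<in> I \<Longrightarrow> S i m = carrier A"
    and ring_Inc: "ring (incidence_algebra I s A S)"
begin

abbreviation "Inc \<equiv> incidence_algebra I s A S"

section \<open>Matrix units and the column of the top element\<close>

definition E :: "'q \<Rightarrow> 'q \<Rightarrow> 'a \<Rightarrow> 'q \<Rightarrow> 'q \<Rightarrow> 'a" where
  "E i j a = (\<lambda>k l. if k = i \<and> l = j then a else \<zero>\<^bsub>A\<^esub>)"

lemma S_carrier: "(i, j) \<in> s \<Longrightarrow> a \<in> S i j \<Longrightarrow> a \<in> carrier A"
  using submoduleE(1)[OF S_sub] by blast

lemma S_zero: "(i, j) \<in> s \<Longrightarrow> \<zero>\<^bsub>A\<^esub> \<in> S i j"
  using submodule.axioms(1)[OF S_sub] subgroup.one_closed by fastforce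

lemma Inc_entry: "\<lbrakk>X \<in> carrier Inc; (i, j) \<in> s\<rbrakk> \<Longrightarrow> X i j \<in> S i j"
  unfolding incidence_algebra_def by simp

lemma Inc_outside: "\<lbrakk>X \<in> carrier Inc; (i, j) \<notin> s\<rbrakk> \<Longrightarrow> X i j = \<zero>\<^bsub>A\<^esub>"
  unfolding incidence_algebra_def by simp

lemma IncI: "\<lbrakk>\<And>i j. (i, j) \<in> s \<Longrightarrow> X i j \<in> S i j; \<And>i j. (i, j) \<notin> s \<Longrightarrow> X i j = \<zero>\<^bsub>A\<^esub>\<rbrakk> \<Longrightarrow> X \<in> carrier Inc"
  by (simp add: incidence_algebra_def)

lemma Inc_carrier: "X \<in> carrier Inc \<Longrightarrow> X i j \<in> carrier A"
  by (cases "(i, j) \<in> s") (auto simp: Inc_outside intro: S_carrier Inc_entry)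

lemma add_Inc: "X \<oplus>\<^bsub>Inc\<^esub> Y = (\<lambda>i j. X i j \<oplus>\<^bsub>A\<^esub> Y i j)"
  and zero_Inc: "\<zero>\<^bsub>Inc\<^esub> = (\<lambda>i j. \<zero>\<^bsub>A\<^esub>)"
  and mult_Inc: "X \<otimes>\<^bsub>Inc\<^esub> Y = (\<lambda>i j. \<Oplus>\<^bsub>A\<^esub>l\<in>I. X i l \<otimes>\<^bsub>A\<^esub> Y l j)"
  by (simp_all add: incidence_algebra_def)

lemma local_one_eq: "i \<in> I \<Longrightarrow> local_one A S i = \<one>\<^bsub>A\<^esub>"
  unfolding local_one_def using S_one S_carrier[OF s_refl] A.r_one A.l_one
  by (intro the_equality) (auto, metis A.r_one)

lemma one_Inc: "\<one>\<^bsub>Inc\<^esub> = (\<lambda>i j. if i = j \<and> i \<in> I then \<one>\<^bsub>A\<^esub> else \<zero>\<^bsub>A\<^esub>)"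
  by (auto simp: incidence_algebra_def local_one_eq fun_eq_iff)

lemma E_in: "\<lbrakk>(i, j) \<in> s; a \<in> S i j\<rbrakk> \<Longrightarrow> E i j a \<in> carrier Inc"
  by (rule IncI) (auto simp: E_def S_zero)

lemma E_top_in: "\<lbrakk>i \<in> I; a \<in> carrier A\<rbrakk> \<Longrightarrow> E i m a \<in> carrier Inc"
  by (rule E_in) (simp_all add: s_top S_top)

lemma E_diag_in: "i \<in> I \<Longrightarrow> E i i \<one>\<^bsub>A\<^esub> \<in> carrier Inc"
  by (rule E_in) (simp_all add: s_refl S_one)

lemma E_zero: "E i j \<zero>\<^bsub>A\<^esub> = \<zero>\<^bsub>Inc\<^esub>"
  by (auto simp: E_def zero_Inc)

lemma E_add: "\<lbrakk>a \<in> carrier A; b \<in> carrier A\<rbrakk> \<Longrightarrow> E i j (a \<oplus>\<^bsub>A\<^esub> b) = E i j a \<oplus>\<^bsub>Inc\<^esub> E i j b"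
  by (auto simp: E_def add_Inc fun_eq_iff)

lemma E_carrier: "a \<in> carrier A \<Longrightarrow> E i j a k l \<in> carrier A"
  by (auto simp: E_def)

lemma finsum_delta:
  assumes "j \<in> I" "a \<in> carrier A"
  shows "(\<Oplus>\<^bsub>A\<^esub>l\<in>I. if l = j then a else \<zero>\<^bsub>A\<^esub>) = a"
  using M.finsum_singleton[OF assms(1) finite_I, of "\<lambda>_. a"] assms(2) by (simp add: eq_commute)

lemma mult_E:
  assumes "\<And>p q. X p q \<in> carrier A" "j \<in> I" "b \<in> carrier A"
  shows "X \<otimes>\<^bsub>Inc\<^esub> E j k b = (\<lambda>p q. if q = k then X p j \<otimes>\<^bsub>A\<^esub> b else \<zero>\<^bsub>A\<^esub>)"
proof (intro ext)
  fix p q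
  have "(\<Oplus>\<^bsub>A\<^esub>l\<in>I. X p l \<otimes>\<^bsub>A\<^esub> E j k b l q)
      = (\<Oplus>\<^bsub>A\<^esub>l\<in>I. if l = j then (if q = k then X p j \<otimes>\<^bsub>A\<^esub> b else \<zero>\<^bsub>A\<^esub>) else \<zero>\<^bsub>A\<^esub>)"
    using assms by (intro M.finsum_cong') (auto simp: E_def)
  also have "\<dots> = (if q = k then X p j \<otimes>\<^bsub>A\<^esub> b else \<zero>\<^bsub>A\<^esub>)" using assms by (intro finsum_delta) auto
  finally show "(X \<otimes>\<^bsub>Inc\<^esub> E j k b) p q = (if q = k then X p j \<otimes>\<^bsub>A\<^esub> b else \<zero>\<^bsub>A\<^esub>)" by (simp add: mult_Inc)
qed

lemma E_mult:
  assumes "\<And>p q. X p q \<in> carrier A" "j \<in> I" "a \<in> carrier A"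
  shows "E i j a \<otimes>\<^bsub>Inc\<^esub> X = (\<lambda>p q. if p = i then a \<otimes>\<^bsub>A\<^esub> X j q else \<zero>\<^bsub>A\<^esub>)"
proof (intro ext)
  fix p q
  have "(\<Oplus>\<^bsub>A\<^esub>l\<in>I. E i j a p l \<otimes>\<^bsub>A\<^esub> X l q)
      = (\<Oplus>\<^bsub>A\<^esub>l\<in>I. if l = j then (if p = i then a \<otimes>\<^bsub>A\<^esub> X j q else \<zero>\<^bsub>A\<^esub>) else \<zero>\<^bsub>A\<^esub>)"
    using assms by (intro M.finsum_cong') (auto simp: E_def)
  also have "\<dots> = (if p = i then a \<otimes>\<^bsub>A\<^esub> X j q else \<zero>\<^bsub>A\<^esub>)" using assms by (intro finsum_delta) auto
  finally show "(E i j a \<otimes>\<^bsub>Inc\<^esub> X) p q = (if p = i then a \<otimes>\<^bsub>A\<^esub> X j q else \<zero>\<^bsub>A\<^esub>)" by (simp add: mult_Inc)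
qed

lemma E_mult_E:
  assumes "a \<in> carrier A" "b \<in> carrier A" "j \<in> I"
  shows "E i j a \<otimes>\<^bsub>Inc\<^esub> E j' k b = (if j = j' then E i k (a \<otimes>\<^bsub>A\<^esub> b) else \<zero>\<^bsub>Inc\<^esub>)"
proof -
  have "E i j a \<otimes>\<^bsub>Inc\<^esub> E j' k b = (\<lambda>p q. if p = i then a \<otimes>\<^bsub>A\<^esub> E j' k b j q else \<zero>\<^bsub>A\<^esub>)"
    using assms by (intro E_mult E_carrier)
  also have "\<dots> = (if j = j' then E i k (a \<otimes>\<^bsub>A\<^esub> b) else \<zero>\<^bsub>Inc\<^esub>)"
    using assms by (auto simp: E_def zero_Inc fun_eq_iff)
  finally show ?thesis .
qed

text \<open>Nothing lies above \<open>m\<close>, so row \<open>m\<close> of \<open>X\<close>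
  vanishes outside the diagonal.\<close>

lemma top_mult:
  assumes X: "X \<in> carrier Inc" and a: "a \<in> carrier A"
  shows "E m m a \<otimes>\<^bsub>Inc\<^esub> X = E m m (a \<otimes>\<^bsub>A\<^esub> X m m)"
proof -
  have "E m m a \<otimes>\<^bsub>Inc\<^esub> X = (\<lambda>p q. if p = m then a \<otimes>\<^bsub>A\<^esub> X m q else \<zero>\<^bsub>A\<^esub>)"
    by (rule E_mult[OF Inc_carrier[OF X] m_in a])
  also have "\<dots> = E m m (a \<otimes>\<^bsub>A\<^esub> X m m)"
  proof -
    have "X m q = \<zero>\<^bsub>A\<^esub>" if "q \<noteq> m" for q using Inc_outside[OF X] s_max that by blast
    then show ?thesis using a by (auto simp: E_def fun_eq_iff)
  qed
  finally show ?thesis .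
qed

sublocale Inc: ring Inc by (rule ring_Inc)

lemma finsum_Inc:
  assumes "finite J" "f \<in> J \<rightarrow> carrier Inc"
  shows "finsum Inc f J p q = (\<Oplus>\<^bsub>A\<^esub>k\<in>J. f k p q)"
  using assms by (induction rule: finite_induct) (auto simp: zero_Inc add_Inc Inc_carrier Pi_iff)

text \<open>Both sides are column \<open>i\<close> of \<open>X\<close> moved to column
  \<open>m\<close>. Each summand begins with a matrix unit \<open>E k m 1\<close>, so that the
  formula can be applied to elements of a module.\<close>

lemma mult_E_top:
  assumes X: "X \<in> carrier Inc" and i: "i \<in> I"
  shows "X \<otimes>\<^bsub>Inc\<^esub> E i m \<one>\<^bsub>A\<^esub> = (\<Oplus>\<^bsub>Inc\<^esub>k\<in>I. E k m \<one>\<^bsub>A\<^esub> \<otimes>\<^bsub>Inc\<^esub> E m m (X k i))"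
proof (intro ext)
  fix p q
  have f: "(\<lambda>k. E k m \<one>\<^bsub>A\<^esub> \<otimes>\<^bsub>Inc\<^esub> E m m (X k i)) \<in> I \<rightarrow> carrier Inc"
    by (intro funcsetI Inc.m_closed E_top_in Inc_carrier[OF X] m_in) auto
  have "(\<Oplus>\<^bsub>Inc\<^esub>k\<in>I. E k m \<one>\<^bsub>A\<^esub> \<otimes>\<^bsub>Inc\<^esub> E m m (X k i)) p q = (\<Oplus>\<^bsub>A\<^esub>k\<in>I. E k m (X k i) p q)"
    unfolding finsum_Inc[OF finite_I f] using X m_in
    by (intro M.finsum_cong') (auto simp: E_mult_E Inc_carrier E_carrier)
  also have "\<dots> = (\<Oplus>\<^bsub>A\<^esub>k\<in>I. if k = p then (if q = m then X p i else \<zero>\<^bsub>A\<^esub>) else \<zero>\<^bsub>A\<^esub>)"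
    using X by (intro M.finsum_cong') (auto simp: E_def Inc_carrier)
  also have "\<dots> = (if q = m then X p i else \<zero>\<^bsub>A\<^esub>)"
  proof (cases "p \<in> I")
    case True
    then show ?thesis using X by (intro finsum_delta) (auto simp: Inc_carrier)
  next
    case False
    then have "(\<Oplus>\<^bsub>A\<^esub>k\<in>I. if k = p then (if q = m then X p i else \<zero>\<^bsub>A\<^esub>) else \<zero>\<^bsub>A\<^esub>) = (\<Oplus>\<^bsub>A\<^esub>k\<in>I. \<zero>\<^bsub>A\<^esub>)"
      by (intro M.finsum_cong') auto
    moreover have "X p i = \<zero>\<^bsub>A\<^esub>" using Inc_outside[OF X] s_sub False by blast
    ultimately show ?thesis by simp
  qed
  finally show "(X \<otimes>\<^bsub>Inc\<^esub> E i m \<one>\<^bsub>A\<^esub>) p q = (\<Oplus>\<^bsub>Inc\<^esub>k\<in>I. E k m \<one>\<^bsub>A\<^esub> \<otimes>\<^bsub>Inc\<^esub> E m m (X k i)) p q"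
    using mult_E[OF Inc_carrier[OF X] i] X by (simp add: Inc_carrier)
qed

text \<open>The components \<open>x e\<^sub>k\<^sub>m\<close> of \<open>x\<close> determine the
  components of \<open>x X\<close>. This is why the elements with zero components form a submodule,
  and why linearity of a map can be checked on components.\<close>

lemma act_E_top:
  assumes M: "right_module Inc M" and x: "x \<in> carrier M" and X: "X \<in> carrier Inc" and i: "i \<in> I"
  shows "(x \<cdot>\<^bsub>M\<^esub> X) \<cdot>\<^bsub>M\<^esub> E i m \<one>\<^bsub>A\<^esub> = (\<Oplus>\<^bsub>M\<^esub>k\<in>I. (x \<cdot>\<^bsub>M\<^esub> E k m \<one>\<^bsub>A\<^esub>) \<cdot>\<^bsub>M\<^esub> E m m (X k i))"
proof -
  interpret M: right_module Inc M by fact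
  have E: "E k m \<one>\<^bsub>A\<^esub> \<in> carrier Inc" "E m m (X k i) \<in> carrier Inc" if "k \<in> I" for k
    using that E_top_in m_in Inc_carrier[OF X] by auto
  have "(x \<cdot>\<^bsub>M\<^esub> X) \<cdot>\<^bsub>M\<^esub> E i m \<one>\<^bsub>A\<^esub> = x \<cdot>\<^bsub>M\<^esub> (\<Oplus>\<^bsub>Inc\<^esub>k\<in>I. E k m \<one>\<^bsub>A\<^esub> \<otimes>\<^bsub>Inc\<^esub> E m m (X k i))"
    using mult_E_top[OF X i] M.act_assoc[OF x X E(1)[OF i]] by simp
  also have "\<dots> = (\<Oplus>\<^bsub>M\<^esub>k\<in>I. x \<cdot>\<^bsub>M\<^esub> (E k m \<one>\<^bsub>A\<^esub> \<otimes>\<^bsub>Inc\<^esub> E m m (X k i)))"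
    by (rule M.act_finsum[OF finite_I _ x]) (use E in auto)
  also have "\<dots> = (\<Oplus>\<^bsub>M\<^esub>k\<in>I. (x \<cdot>\<^bsub>M\<^esub> E k m \<one>\<^bsub>A\<^esub>) \<cdot>\<^bsub>M\<^esub> E m m (X k i))"
    using E x by (intro M.M.finsum_cong') (auto simp: M.act_assoc M.act_closed)
  finally show ?thesis .
qed

section \<open>Separated modules and annihilated simple modules\<close>

definition separated :: "('q \<Rightarrow> 'q \<Rightarrow> 'a, 'v) rmodule \<Rightarrow> bool" where
  "separated M \<longleftrightarrow> (\<forall>x\<in>carrier M. (\<forall>i\<in>I. x \<cdot>\<^bsub>M\<^esub> E i m \<one>\<^bsub>A\<^esub> = \<zero>\<^bsub>M\<^esub>) \<longrightarrow> x = \<zero>\<^bsub>M\<^esub>)"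

text \<open>Multiplication by \<open>E q m 1\<close> puts column \<open>q\<close> of
  \<open>X\<close> into column \<open>m\<close>, so every entry can be read off.\<close>

lemma separated_Inc:
  assumes X: "X \<in> carrier Inc" and z: "\<And>i. i \<in> I \<Longrightarrow> X \<otimes>\<^bsub>Inc\<^esub> E i m \<one>\<^bsub>A\<^esub> = \<zero>\<^bsub>Inc\<^esub>"
  shows "X = \<zero>\<^bsub>Inc\<^esub>"
proof (intro ext)
  fix p q
  show "X p q = \<zero>\<^bsub>Inc\<^esub> p q"
  proof (cases "q \<in> I")
    case True
    have "(X \<otimes>\<^bsub>Inc\<^esub> E q m \<one>\<^bsub>A\<^esub>) p m = X p q"
      using mult_E[OF Inc_carrier[OF X] True] X by (simp add: Inc_carrier)
    then show ?thesis using z[OF True] by (simp add: zero_Inc)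
  next
    case False
    then show ?thesis using Inc_outside[OF X] s_sub by (auto simp: zero_Inc)
  qed
qed

text \<open>A matrix vanishes outside the finite set \<open>I \<times> I\<close>, so it amounts to a
  finite tuple of elements of \<open>A\<close>.\<close>

lemma carrier_Inc_lepoll:
  assumes "infinite (UNIV :: 'v set)" and "carrier A \<lesssim> (UNIV :: 'v set)"
  shows "carrier Inc \<lesssim> (UNIV :: 'v set)"
proof -
  obtain f :: "'a \<Rightarrow> 'v" where f: "inj_on f (carrier A)" using assms(2) unfolding lepoll_def by blast
  define F where "F X = restrict (\<lambda>(p, q). f (X p q)) (I \<times> I)" for X
  have "inj_on F (carrier Inc)"
  proof (rule inj_onI, intro ext)
    fix X Y p q assume X: "X \<in> carrier Inc" and Y: "Y \<in> carrier Inc" and eq: "F X = F Y"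
    show "X p q = Y p q"
    proof (cases "(p, q) \<in> I \<times> I")
      case True
      then have "f (X p q) = f (Y p q)" using fun_cong[OF eq, of "(p, q)"] by (simp add: F_def)
      then show ?thesis using f X Y Inc_carrier by (auto dest: inj_onD)
    next
      case False
      then have "(p, q) \<notin> s" using s_sub by blast
      then show ?thesis using Inc_outside[OF X] Inc_outside[OF Y] by simp
    qed
  qed
  moreover have "F ` carrier Inc \<subseteq> (I \<times> I \<rightarrow>\<^sub>E UNIV)" by (intro image_subsetI) (simp add: F_def)
  ultimately have "carrier Inc \<lesssim> (I \<times> I \<rightarrow>\<^sub>E (UNIV :: 'v set))" unfolding lepoll_def by blast
  also have "\<dots> \<lesssim> (UNIV :: 'v set)"
    using finite_I assms(1) by (intro PiE_lepoll_infinite) auto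
  finally show ?thesis .
qed

text \<open>A surjection from a copy of the regular module onto a simple module \<open>T\<close> annihilated by all
  \<open>E i m 1\<close> cannot split, since the regular module is separated.\<close>

lemma not_projective_if_annihilated:
  fixes T :: "('q \<Rightarrow> 'q \<Rightarrow> 'a, 'v) rmodule"
  assumes card: "carrier Inc \<lesssim> (UNIV :: 'v set)" and T: "simple_rmodule Inc T"
    and z: "\<And>x i. \<lbrakk>x \<in> carrier T; i \<in> I\<rbrakk> \<Longrightarrow> x \<cdot>\<^bsub>T\<^esub> E i m \<one>\<^bsub>A\<^esub> = \<zero>\<^bsub>T\<^esub>"
  shows "\<not> projective_rmodule Inc T"
proof
  assume p: "projective_rmodule Inc T"
  have Tm: "right_module Inc T" using T unfolding simple_rmodule_def by blast
  interpret T: right_module Inc T by (rule Tm)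
  interpret reg: right_module Inc "regular_rmodule Inc" by (rule Inc.right_module_regular)
  have reg: "carrier (regular_rmodule Inc) = carrier Inc" "act (regular_rmodule Inc) = mult Inc"
    "add (regular_rmodule Inc) = add Inc" "zero (regular_rmodule Inc) = zero Inc"
    by (simp_all add: regular_rmodule_def)
  obtain f :: "('q \<Rightarrow> 'q \<Rightarrow> 'a) \<Rightarrow> 'v" where f: "inj_on f (carrier (regular_rmodule Inc))"
    using card unfolding lepoll_def reg by blast
  \<comment> \<open>Projectivity of \<open>T\<close> speaks about modules with elements in
    \<open>'v\<close>, so the regular module enters through a copy.\<close>
  define X where "X = transport_rmodule f (regular_rmodule Inc)"
  note tr = transport_rmodule[OF Inc.right_module_regular f, folded X_def]
  have bij: "bij_betw (restrict f (carrier Inc)) (carrier (regular_rmodule Inc)) (carrier X)"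
    using f tr(3) reg by (simp add: bij_betw_def)
  define \<phi> where "\<phi> = restrict (inv_into (carrier Inc) (restrict f (carrier Inc))) (carrier X)"
  have \<phi>: "\<phi> \<in> rmod_hom Inc X (regular_rmodule Inc)"
    using rmod_hom_inv_into[OF Inc.right_module_regular tr(1,2)] bij reg unfolding \<phi>_def by simp
  have \<phi>_f: "\<phi> (f Y) = Y" "f Y \<in> carrier X" if "Y \<in> carrier Inc" for Y
  proof -
    show "f Y \<in> carrier X" using tr(3) that reg by auto
    moreover have "inj_on (restrict f (carrier Inc)) (carrier Inc)" using f reg by simp
    ultimately show "\<phi> (f Y) = Y"
      unfolding \<phi>_def using that inv_into_f_f[of "restrict f (carrier Inc)" "carrier Inc" Y] by simp
  qed
  obtain t where t: "t \<in> carrier T" "t \<noteq> \<zero>\<^bsub>T\<^esub>" using T T.M.zero_closed unfolding simple_rmodule_def by blast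
  \<comment> \<open>Up to the identification \<open>\<phi>\<close> with the regular module,
    \<open>g\<close> sends a matrix \<open>Y\<close> to \<open>t Y\<close>.\<close>
  define g where "g = restrict (\<lambda>x. t \<cdot>\<^bsub>T\<^esub> \<phi> x) (carrier X)"
  have \<phi>D: "\<And>x. x \<in> carrier X \<Longrightarrow> \<phi> x \<in> carrier Inc"
    "\<And>x y. \<lbrakk>x \<in> carrier X; y \<in> carrier X\<rbrakk> \<Longrightarrow> \<phi> (x \<oplus>\<^bsub>X\<^esub> y) = \<phi> x \<oplus>\<^bsub>Inc\<^esub> \<phi> y"
    "\<And>x a. \<lbrakk>x \<in> carrier X; a \<in> carrier Inc\<rbrakk> \<Longrightarrow> \<phi> (x \<cdot>\<^bsub>X\<^esub> a) = \<phi> x \<otimes>\<^bsub>Inc\<^esub> a"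
    using rmod_homD[OF \<phi>] unfolding reg by blast+
  have g: "g \<in> rmod_hom Inc X T"
    unfolding g_def using t(1) \<phi>D tr(1) by (intro rmod_homI) (auto simp: T.act_closed T.act_add T.act_assoc)
  have "t \<in> g ` carrier X"
    using \<phi>_f[OF Inc.one_closed] T.act_one[OF t(1)] by (intro image_eqI[of _ _ "f \<one>\<^bsub>Inc\<^esub>"]) (auto simp: g_def)
  then have surj: "g ` carrier X = carrier T"
    using T rmod_hom_image[OF tr(1) Tm g] t(2) unfolding simple_rmodule_def by blast
  then obtain h where h: "h \<in> rmod_hom Inc T X" "compose (carrier T) g h = restrict id (carrier T)"
    using p g tr(1) Tm rmod_hom_id[OF Tm] unfolding projective_rmodule_def by blast
  note hD = rmod_homD[OF h(1)]
  have ht: "h t \<in> carrier X" using hD(1) t by blast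
  \<comment> \<open>A splitting commutes with the action, so it sends \<open>t\<close> to an element
    that is annihilated in the same way.\<close>
  have "\<phi> (h t) \<otimes>\<^bsub>Inc\<^esub> E i m \<one>\<^bsub>A\<^esub> = \<zero>\<^bsub>Inc\<^esub>" if i: "i \<in> I" for i
  proof -
    have "\<phi> (h t) \<otimes>\<^bsub>Inc\<^esub> E i m \<one>\<^bsub>A\<^esub> = \<phi> (h (t \<cdot>\<^bsub>T\<^esub> E i m \<one>\<^bsub>A\<^esub>))"
      using \<phi>D(3)[OF ht] hD(3)[OF t(1)] E_top_in[OF i] by simp
    also have "\<dots> = \<phi> \<zero>\<^bsub>X\<^esub>" using z[OF t(1) i] rmod_hom_zero[OF Tm tr(1) h(1)] by simp
    also have "\<dots> = \<zero>\<^bsub>Inc\<^esub>" using rmod_hom_zero[OF tr(1) Inc.right_module_regular \<phi>] reg by simp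
    finally show ?thesis .
  qed
  then have "\<phi> (h t) = \<zero>\<^bsub>Inc\<^esub>" using separated_Inc \<phi>D(1)[OF ht] by blast
  then have "g (h t) = \<zero>\<^bsub>T\<^esub>" unfolding g_def using ht t by simp
  moreover have "g (h t) = t" using fun_cong[OF h(2), of t] t by (simp add: compose_def)
  ultimately show False using t by simp
qed

text \<open>A scalar acts as right multiplication by a diagonal matrix, which belongs to the algebra
  because each \<open>S i i\<close> is a subspace containing the unit of \<open>A\<close>. So right
  ideals are matrix subspaces and inherit their rank.\<close>

lemma Inc_rank:
  obtains \<rho> :: "('q \<Rightarrow> 'q \<Rightarrow> 'a) set \<Rightarrow> nat" where
    "\<And>V W. \<lbrakk>rsubmodule V Inc (regular_rmodule Inc); rsubmodule W Inc (regular_rmodule Inc); V \<subset> W\<rbrakk> \<Longrightarrow> \<rho> V < \<rho> W"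
proof -
  interpret reg: right_module Inc "regular_rmodule Inc" by (rule Inc.right_module_regular)
  obtain \<rho> :: "('q \<Rightarrow> 'q \<Rightarrow> 'a) set \<Rightarrow> nat" where \<rho>: "\<forall>V W. matrix_subspace V \<and> matrix_subspace W \<and> V \<subset> W \<and>
    (\<forall>X\<in>W. \<forall>i j. (i, j) \<notin> I \<times> I \<longrightarrow> X i j = \<zero>\<^bsub>A\<^esub>) \<longrightarrow> \<rho> V < \<rho> W"
    using matrix_subspace_rank[OF finite_cartesian_product[OF finite_I finite_I]] by (elim exE)
  have sub: "matrix_subspace V" if V: "rsubmodule V Inc (regular_rmodule Inc)" for V
  proof -
    note v = reg.rsubmoduleD[OF V]
    have VI: "X \<in> carrier Inc" if "X \<in> V" for X using v(1) that by (auto simp: regular_rmodule_def)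
    have "(\<lambda>i j. k \<odot>\<^bsub>A\<^esub> X i j) \<in> V" if k: "k \<in> carrier K" and X: "X \<in> V" for k X
    proof -
      define D where "D = (\<lambda>i j. if i = j \<and> i \<in> I then k \<odot>\<^bsub>A\<^esub> \<one>\<^bsub>A\<^esub> else \<zero>\<^bsub>A\<^esub>)"
      have D: "D \<in> carrier Inc"
        by (rule IncI) (auto simp: D_def S_zero s_refl intro: submoduleE(4)[OF S_sub[OF s_refl] k S_one])
      have "X \<otimes>\<^bsub>Inc\<^esub> D = (\<lambda>i j. k \<odot>\<^bsub>A\<^esub> X i j)"
      proof (intro ext)
        fix p q
        have XA: "\<And>i j. X i j \<in> carrier A" using Inc_carrier[OF VI[OF X]] .
        have "(\<Oplus>\<^bsub>A\<^esub>l\<in>I. X p l \<otimes>\<^bsub>A\<^esub> D l q) = (\<Oplus>\<^bsub>A\<^esub>l\<in>I. if l = q then k \<odot>\<^bsub>A\<^esub> X p q else \<zero>\<^bsub>A\<^esub>)"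
          using XA k by (intro M.finsum_cong') (auto simp: D_def mult_smult)
        also have "\<dots> = k \<odot>\<^bsub>A\<^esub> X p q"
        proof (cases "q \<in> I")
          case True
          then show ?thesis using XA k by (intro finsum_delta) auto
        next
          case False
          then have "(\<Oplus>\<^bsub>A\<^esub>l\<in>I. if l = q then k \<odot>\<^bsub>A\<^esub> X p q else \<zero>\<^bsub>A\<^esub>) = (\<Oplus>\<^bsub>A\<^esub>l\<in>I. \<zero>\<^bsub>A\<^esub>)"
            by (intro M.finsum_cong') auto
          moreover have "X p q = \<zero>\<^bsub>A\<^esub>" using Inc_outside[OF VI[OF X]] s_sub False by blast
          ultimately show ?thesis using k by simp
        qed
        finally show "(X \<otimes>\<^bsub>Inc\<^esub> D) p q = k \<odot>\<^bsub>A\<^esub> X p q" by (simp add: mult_Inc)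
      qed
      then show ?thesis using v(4)[OF X D] by (simp add: regular_rmodule_def)
    qed
    moreover have "(\<lambda>i j. X i j \<oplus>\<^bsub>A\<^esub> Y i j) \<in> V" if "X \<in> V" "Y \<in> V" for X Y
      using v(3)[OF that] by (simp add: regular_rmodule_def add_Inc)
    moreover have "(\<lambda>i j. \<zero>\<^bsub>A\<^esub>) \<in> V" using v(2) by (simp add: regular_rmodule_def zero_Inc)
    ultimately show ?thesis unfolding matrix_subspace_def using Inc_carrier VI by blast
  qed
  show ?thesis
  proof (rule that[of \<rho>])
    fix V W assume V: "rsubmodule V Inc (regular_rmodule Inc)" and W: "rsubmodule W Inc (regular_rmodule Inc)" and "V \<subset> W"
    moreover have "\<forall>X\<in>W. \<forall>i j. (i, j) \<notin> I \<times> I \<longrightarrow> X i j = \<zero>\<^bsub>A\<^esub>"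
    proof (intro ballI allI impI)
      fix X i j assume "X \<in> W" "(i, j) \<notin> I \<times> I"
      then have "X \<in> carrier Inc" "(i, j) \<notin> s"
        using reg.rsubmoduleD(1)[OF W] s_sub by (auto simp: regular_rmodule_def)
      then show "X i j = \<zero>\<^bsub>A\<^esub>" by (rule Inc_outside)
    qed
    ultimately show "\<rho> V < \<rho> W" using \<rho> sub by blast
  qed
qed

lemma annihilated_rsubmodule:
  assumes M: "right_module Inc M"
  shows "rsubmodule {x \<in> carrier M. \<forall>i\<in>I. x \<cdot>\<^bsub>M\<^esub> E i m \<one>\<^bsub>A\<^esub> = \<zero>\<^bsub>M\<^esub>} Inc M"
proof -
  interpret M: right_module Inc M by fact
  show ?thesis
  proof (rule M.rsubmoduleI)
    fix x X assume x: "x \<in> {x \<in> carrier M. \<forall>i\<in>I. x \<cdot>\<^bsub>M\<^esub> E i m \<one>\<^bsub>A\<^esub> = \<zero>\<^bsub>M\<^esub>}" and X: "X \<in> carrier Inc"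
    have "(x \<cdot>\<^bsub>M\<^esub> X) \<cdot>\<^bsub>M\<^esub> E i m \<one>\<^bsub>A\<^esub> = \<zero>\<^bsub>M\<^esub>" if i: "i \<in> I" for i
    proof -
      have "(x \<cdot>\<^bsub>M\<^esub> X) \<cdot>\<^bsub>M\<^esub> E i m \<one>\<^bsub>A\<^esub> = (\<Oplus>\<^bsub>M\<^esub>k\<in>I. \<zero>\<^bsub>M\<^esub>)"
        unfolding act_E_top[OF M _ X i, of x, OF conjunct1[OF x[unfolded mem_Collect_eq]]]
        using x E_top_in[OF m_in Inc_carrier[OF X]] by (intro M.M.finsum_cong') auto
      then show ?thesis by simp
    qed
    then show "x \<cdot>\<^bsub>M\<^esub> X \<in> {x \<in> carrier M. \<forall>i\<in>I. x \<cdot>\<^bsub>M\<^esub> E i m \<one>\<^bsub>A\<^esub> = \<zero>\<^bsub>M\<^esub>}"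
      using x X M.act_closed by auto
  qed (use E_top_in M.add_act in auto)
qed

text \<open>The rank on right ideals provides a simple submodule inside the annihilated part
  whenever that part is nonzero.\<close>

lemma separated_if_simple_projective:
  fixes M :: "('q \<Rightarrow> 'q \<Rightarrow> 'a, 'v) rmodule"
  assumes card: "carrier Inc \<lesssim> (UNIV :: 'v set)" and M: "right_module Inc M"
    and p: "\<And>S. \<lbrakk>rsubmodule S Inc M; simple_rmodule Inc (M\<lparr>carrier := S\<rparr>)\<rbrakk> \<Longrightarrow> projective_rmodule Inc (M\<lparr>carrier := S\<rparr>)"
  shows "separated M"
proof (rule ccontr)
  interpret M: right_module Inc M by fact
  let ?N = "{x \<in> carrier M. \<forall>i\<in>I. x \<cdot>\<^bsub>M\<^esub> E i m \<one>\<^bsub>A\<^esub> = \<zero>\<^bsub>M\<^esub>}"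
  assume "\<not> separated M"
  then have N: "?N \<noteq> {\<zero>\<^bsub>M\<^esub>}" unfolding separated_def by blast
  obtain \<rho> :: "('q \<Rightarrow> 'q \<Rightarrow> 'a) set \<Rightarrow> nat" where \<rho>:
    "\<And>V W. \<lbrakk>rsubmodule V Inc (regular_rmodule Inc); rsubmodule W Inc (regular_rmodule Inc); V \<subset> W\<rbrakk> \<Longrightarrow> \<rho> V < \<rho> W"
    using Inc_rank by blast
  obtain S where S: "rsubmodule S Inc M" "S \<subseteq> ?N" "simple_rmodule Inc (M\<lparr>carrier := S\<rparr>)"
    by (rule M.exists_simple_rsubmodule[OF \<rho> annihilated_rsubmodule[OF M] N])
  have "\<not> projective_rmodule Inc (M\<lparr>carrier := S\<rparr>)"
    using S(2) by (intro not_projective_if_annihilated[OF card S(3)]) auto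
  then show False using p S by blast
qed

end

locale simple_top_incidence = top_incidence K A I s m S
  for K :: "('k, 'c) ring_scheme" and A :: "('k, 'a) module" and I :: "'q set" and s m S +
  fixes \<epsilon> :: 'a
  assumes \<epsilon>_in: "\<epsilon> \<in> carrier A" and \<epsilon>_idem: "\<epsilon> \<otimes>\<^bsub>A\<^esub> \<epsilon> = \<epsilon>"
    and semisimple: "semisimple_ring A" and unique_simple: "unique_simple_rmodule A (principal_rmodule A \<epsilon>)"
begin

lemma regular_A: "right_module A (regular_rmodule A)"
  by (rule A.right_module_regular)

text \<open>\<open>A\<close> is generated by its simple right ideals \<open>T\<close>, and an isomorphism \<open>\<epsilon>A \<rightarrow> T\<close> maps \<open>\<epsilon>\<close> to a
  generator \<open>t\<close> of \<open>T\<close> with \<open>t = t\<epsilon>\<close>. So nothing but \<open>0\<close> is annihilated by \<open>A\<epsilon>\<close>.\<close>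

lemma act_idempotent_nonzero:
  assumes M: "right_module Inc M" and y: "y \<in> carrier M" and z: "\<And>b. b \<in> carrier A \<Longrightarrow> y \<cdot>\<^bsub>M\<^esub> E m m (b \<otimes>\<^bsub>A\<^esub> \<epsilon>) = \<zero>\<^bsub>M\<^esub>"
  shows "y \<cdot>\<^bsub>M\<^esub> E m m \<one>\<^bsub>A\<^esub> = \<zero>\<^bsub>M\<^esub>"
proof -
  interpret M: right_module Inc M by fact
  interpret reg: right_module A "regular_rmodule A" by (rule regular_A)
  have reg: "carrier (regular_rmodule A) = carrier A" "act (regular_rmodule A) = mult A"
    "add (regular_rmodule A) = add A" "zero (regular_rmodule A) = zero A"
    by (simp_all add: regular_rmodule_def)
  have Em: "E m m a \<in> carrier Inc" if "a \<in> carrier A" for a using E_top_in[OF m_in that] .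
  have EE: "E m m a \<otimes>\<^bsub>Inc\<^esub> E m m b = E m m (a \<otimes>\<^bsub>A\<^esub> b)" if "a \<in> carrier A" "b \<in> carrier A" for a b
    using E_mult_E[OF that m_in, of m m m] by simp
  \<comment> \<open>The claim says that the right ideal \<open>?N\<close> contains the unit. It is
    shown to contain the socle of the regular module, which is everything by semisimplicity.\<close>
  let ?N = "{a \<in> carrier A. y \<cdot>\<^bsub>M\<^esub> E m m a = \<zero>\<^bsub>M\<^esub>}"
  have N: "rsubmodule ?N A (regular_rmodule A)"
  proof (rule reg.rsubmoduleI)
    fix a b assume a: "a \<in> ?N" and b: "b \<in> carrier A"
    have "y \<cdot>\<^bsub>M\<^esub> E m m (a \<otimes>\<^bsub>A\<^esub> b) = (y \<cdot>\<^bsub>M\<^esub> E m m a) \<cdot>\<^bsub>M\<^esub> E m m b"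
      using EE a b M.act_assoc[OF y Em Em] by simp
    then show "a \<cdot>\<^bsub>regular_rmodule A\<^esub> b \<in> ?N" using a b Em by (simp add: reg)
  qed (use y Em in \<open>auto simp: reg E_zero E_add M.act_add\<close>)
  have "T \<subseteq> ?N" if T: "rsubmodule T A (regular_rmodule A)" "simple_rmodule A ((regular_rmodule A)\<lparr>carrier := T\<rparr>)" for T
  proof -
    let ?T = "(regular_rmodule A)\<lparr>carrier := T\<rparr>" and ?P = "principal_rmodule A \<epsilon>"
    note t = reg.rsubmoduleD[OF T(1)]
    obtain h where h: "h \<in> rmod_hom A ?T ?P" "bij_betw h (carrier ?T) (carrier ?P)"
      using unique_simple T(2) unfolding unique_simple_rmodule_def rmod_isomorphic_def by blast
    have "\<epsilon> \<in> {\<epsilon> \<otimes>\<^bsub>A\<^esub> a | a. a \<in> carrier A}" using \<epsilon>_in \<epsilon>_idem[symmetric] by blast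
    then have "\<epsilon> \<in> h ` T" using bij_betw_imp_surj_on[OF h(2)] by (simp add: principal_rmodule_def)
    then obtain u where u: "u \<in> T" "h u = \<epsilon>" by blast
    have uA: "u \<in> carrier A" using u t(1) by (auto simp: reg)
    have hact: "h (x \<otimes>\<^bsub>A\<^esub> a) = h x \<otimes>\<^bsub>A\<^esub> a" if "x \<in> T" "a \<in> carrier A" for x a
      using rmod_homD(3)[OF h(1)] that by (simp add: reg principal_rmodule_def)
    have inj: "inj_on h T" using h(2) by (simp add: bij_betw_def)
    have xa: "x \<otimes>\<^bsub>A\<^esub> a \<in> T" if "x \<in> T" "a \<in> carrier A" for x a using t(4)[OF that] by (simp add: reg)
    \<comment> \<open>Both sides have the image \<open>\<epsilon>\<close> under the injective map
      \<open>h\<close>.\<close>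
    have "u \<otimes>\<^bsub>A\<^esub> \<epsilon> = u"
      using inj_onD[OF inj _ xa[OF u(1) \<epsilon>_in] u(1)] hact[OF u(1) \<epsilon>_in] u(2) \<epsilon>_idem by metis
    then have uN: "u \<in> ?N" using z[OF uA] uA by simp
    show ?thesis
    proof
      fix x assume x: "x \<in> T"
      then have "h x \<in> carrier ?P" using rmod_homD(1)[OF h(1)] by simp
      then obtain a where a: "a \<in> carrier A" "h x = \<epsilon> \<otimes>\<^bsub>A\<^esub> a" by (auto simp: principal_rmodule_def)
      then have "x = u \<otimes>\<^bsub>A\<^esub> a"
        using inj_onD[OF inj _ x xa[OF u(1) a(1)]] hact[OF u(1) a(1)] u(2) a(2) by metis
      then show "x \<in> ?N" using reg.rsubmoduleD(4)[OF N uN a(1)] by (simp add: reg)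
    qed
  qed
  then have "socle A (regular_rmodule A) \<subseteq> ?N" by (rule reg.socle_subset[OF N])
  then have "carrier A \<subseteq> ?N"
    using semisimple unfolding semisimple_ring_def semisimple_rmodule_def reg by blast
  then show ?thesis by blast
qed

text \<open>\<open>T\<close> is generated by an element \<open>t\<close> fixed by
  \<open>\<epsilon>\<close> at the vertex \<open>m\<close>, and by simplicity of
  \<open>\<epsilon> A\<close> the products \<open>t a\<close> and \<open>\<epsilon> a\<close>
  determine each other. So \<open>T\<close> is isomorphic to the right ideal generated by the
  idempotent \<open>E m m \<epsilon>\<close>, and a lifting of \<open>f\<close> only takes a
  preimage of \<open>f t\<close>.\<close>

lemma projective_if_separated:
  fixes T :: "('q \<Rightarrow> 'q \<Rightarrow> 'a, 'v) rmodule"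
  assumes T: "simple_rmodule Inc T" and sep: "separated T"
  shows "projective_rmodule Inc T"
proof -
  have Tm: "right_module Inc T" using T unfolding simple_rmodule_def by blast
  interpret T: right_module Inc T by (rule Tm)
  have Em: "E m m a \<in> carrier Inc" if "a \<in> carrier A" for a using E_top_in[OF m_in that] .
  have EE: "E m m a \<otimes>\<^bsub>Inc\<^esub> E m m b = E m m (a \<otimes>\<^bsub>A\<^esub> b)" if "a \<in> carrier A" "b \<in> carrier A" for a b
    using E_mult_E[OF that m_in, of m m m] by simp
  have act_EE: "(x \<cdot>\<^bsub>T\<^esub> E m m a) \<cdot>\<^bsub>T\<^esub> E m m b = x \<cdot>\<^bsub>T\<^esub> E m m (a \<otimes>\<^bsub>A\<^esub> b)"
    if "x \<in> carrier T" "a \<in> carrier A" "b \<in> carrier A" for x a b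
    using T.act_assoc[OF that(1) Em Em, OF that(2,3)] EE[OF that(2,3)] by simp
  \<comment> \<open>Being separated and nonzero, \<open>T\<close> has an element with a nonzero
    component.\<close>
  obtain x i where x: "x \<in> carrier T" "i \<in> I" "x \<cdot>\<^bsub>T\<^esub> E i m \<one>\<^bsub>A\<^esub> \<noteq> \<zero>\<^bsub>T\<^esub>"
    by (rule simple_rmodule_nonzero[OF T]) (use sep in \<open>unfold separated_def, blast\<close>)
  define y where "y = x \<cdot>\<^bsub>T\<^esub> E i m \<one>\<^bsub>A\<^esub>"
  have y: "y \<in> carrier T" unfolding y_def using x E_top_in by (intro T.act_closed) auto
  have "y \<cdot>\<^bsub>T\<^esub> E m m \<one>\<^bsub>A\<^esub> = y"
    unfolding y_def using T.act_assoc[OF x(1) E_top_in[OF x(2) A.one_closed] Em[OF A.one_closed]]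
      E_mult_E[of "\<one>\<^bsub>A\<^esub>" "\<one>\<^bsub>A\<^esub>" m i m m] m_in by simp
  then obtain b where b: "b \<in> carrier A" "y \<cdot>\<^bsub>T\<^esub> E m m (b \<otimes>\<^bsub>A\<^esub> \<epsilon>) \<noteq> \<zero>\<^bsub>T\<^esub>"
    using act_idempotent_nonzero[OF Tm y] x y_def by metis
  define t where "t = y \<cdot>\<^bsub>T\<^esub> E m m (b \<otimes>\<^bsub>A\<^esub> \<epsilon>)"
  have t: "t \<in> carrier T" "t \<noteq> \<zero>\<^bsub>T\<^esub>" unfolding t_def using y b Em \<epsilon>_in T.act_closed by auto
  have t\<epsilon>: "t \<cdot>\<^bsub>T\<^esub> E m m \<epsilon> = t"
    unfolding t_def using y b \<epsilon>_in \<epsilon>_idem by (simp add: act_EE A.m_assoc)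
  note tA = act_EE[OF t(1)]
  \<comment> \<open>By \<open>top_mult\<close> a matrix acts on \<open>t\<close> through its entry
    at \<open>(m, m)\<close> alone, so \<open>T\<close> is already generated by \<open>t\<close>
    over \<open>A\<close>.\<close>
  have t_act: "t \<cdot>\<^bsub>T\<^esub> X = t \<cdot>\<^bsub>T\<^esub> E m m (\<epsilon> \<otimes>\<^bsub>A\<^esub> X m m)" if "X \<in> carrier Inc" for X
    using T.act_assoc[OF t(1) Em[OF \<epsilon>_in] that] t\<epsilon> top_mult[OF that \<epsilon>_in] by simp
  have gen: "\<exists>a\<in>carrier A. u = t \<cdot>\<^bsub>T\<^esub> E m m a" if u: "u \<in> carrier T" for u
  proof -
    obtain X where X: "X \<in> carrier Inc" "u = t \<cdot>\<^bsub>T\<^esub> X" by (rule simple_rmodule_cyclic[OF T t u])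
    have "\<epsilon> \<otimes>\<^bsub>A\<^esub> X m m \<in> carrier A" using \<epsilon>_in Inc_carrier[OF X(1)] by simp
    then show ?thesis using t_act[OF X(1)] X(2) by blast
  qed
  have ann: "\<epsilon> \<otimes>\<^bsub>A\<^esub> a = \<zero>\<^bsub>A\<^esub>" if a: "a \<in> carrier A" "t \<cdot>\<^bsub>T\<^esub> E m m a = \<zero>\<^bsub>T\<^esub>" for a
  proof -
    let ?P = "principal_rmodule A \<epsilon>"
    have P: "right_module A ?P" using unique_simple unfolding unique_simple_rmodule_def simple_rmodule_def by blast
    interpret P: right_module A ?P by (rule P)
    have Ps: "carrier ?P = {\<epsilon> \<otimes>\<^bsub>A\<^esub> a | a. a \<in> carrier A}" "act ?P = mult A" "add ?P = add A" "zero ?P = zero A"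
      by (simp_all add: principal_rmodule_def regular_rmodule_def)
    have PA: "c \<in> carrier A" if "c \<in> carrier ?P" for c using that \<epsilon>_in unfolding Ps by auto
    \<comment> \<open>A submodule of the simple module \<open>\<epsilon> A\<close> that does not
      contain \<open>\<epsilon>\<close>, hence zero. It contains \<open>\<epsilon> a\<close> as soon
      as \<open>a\<close> at the vertex \<open>m\<close> annihilates \<open>t\<close>.\<close>
    let ?N = "{c \<in> carrier ?P. t \<cdot>\<^bsub>T\<^esub> E m m c = \<zero>\<^bsub>T\<^esub>}"
    have "rsubmodule ?N A ?P"
    proof (rule P.rsubmoduleI)
      show "\<zero>\<^bsub>?P\<^esub> \<in> ?N" using P.M.zero_closed t by (simp add: Ps(4) E_zero)
    next
      fix c d assume "c \<in> ?N" "d \<in> ?N"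
      then show "c \<oplus>\<^bsub>?P\<^esub> d \<in> ?N"
        using P.M.a_closed[of c d] PA t(1) Em by (auto simp: Ps(3) E_add T.act_add)
    next
      fix c d assume "c \<in> ?N" "d \<in> carrier A"
      then show "c \<cdot>\<^bsub>?P\<^esub> d \<in> ?N"
        using P.act_closed[of c d] PA tA[of c d] Em by (auto simp: Ps(2))
    qed blast
    then have "?N = {\<zero>\<^bsub>?P\<^esub>} \<or> ?N = carrier ?P"
      using simple_rmoduleD unique_simple unfolding unique_simple_rmodule_def by blast
    moreover have "\<epsilon> \<in> carrier ?P" using \<epsilon>_in \<epsilon>_idem[symmetric] unfolding Ps by blast
    moreover have "\<epsilon> \<notin> ?N" using t\<epsilon> t(2) by simp
    ultimately have "?N = {\<zero>\<^bsub>A\<^esub>}" unfolding Ps(4) by metis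
    moreover have "\<epsilon> \<otimes>\<^bsub>A\<^esub> a \<in> ?N"
    proof -
      have "t \<cdot>\<^bsub>T\<^esub> E m m (\<epsilon> \<otimes>\<^bsub>A\<^esub> a) = t \<cdot>\<^bsub>T\<^esub> E m m a" using tA[OF \<epsilon>_in a(1)] t\<epsilon> by simp
      then show ?thesis using a unfolding Ps by auto
    qed
    ultimately show ?thesis by blast
  qed
  have uniq: "\<epsilon> \<otimes>\<^bsub>A\<^esub> a = \<epsilon> \<otimes>\<^bsub>A\<^esub> c" if "a \<in> carrier A" "c \<in> carrier A" "t \<cdot>\<^bsub>T\<^esub> E m m a = t \<cdot>\<^bsub>T\<^esub> E m m c" for a c
  proof -
    have "t \<cdot>\<^bsub>T\<^esub> E m m (a \<oplus>\<^bsub>A\<^esub> \<ominus>\<^bsub>A\<^esub> c) \<oplus>\<^bsub>T\<^esub> t \<cdot>\<^bsub>T\<^esub> E m m c = t \<cdot>\<^bsub>T\<^esub> E m m c"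
      using that t(1) Em by (simp add: M.a_assoc M.l_neg flip: T.act_add E_add)
    then have "t \<cdot>\<^bsub>T\<^esub> E m m (a \<oplus>\<^bsub>A\<^esub> \<ominus>\<^bsub>A\<^esub> c) = \<zero>\<^bsub>T\<^esub>"
      using that t(1) Em T.act_closed by (simp add: T.M.add.l_cancel_one)
    then have "\<epsilon> \<otimes>\<^bsub>A\<^esub> a \<oplus>\<^bsub>A\<^esub> \<ominus>\<^bsub>A\<^esub> (\<epsilon> \<otimes>\<^bsub>A\<^esub> c) = \<zero>\<^bsub>A\<^esub>"
      using ann[of "a \<oplus>\<^bsub>A\<^esub> \<ominus>\<^bsub>A\<^esub> c"] that(1,2) \<epsilon>_in by (simp add: A.r_distr A.r_minus)
    then show ?thesis using that \<epsilon>_in M.minus_equality[of "\<epsilon> \<otimes>\<^bsub>A\<^esub> a" "\<ominus>\<^bsub>A\<^esub> (\<epsilon> \<otimes>\<^bsub>A\<^esub> c)"] by simp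
  qed
  have "\<exists>h\<in>rmod_hom Inc T X. compose (carrier T) g h = f"
    if XY: "g \<in> rmod_hom Inc X Y" "f \<in> rmod_hom Inc T Y" "right_module Inc X" "right_module Inc Y"
      "g ` carrier X = carrier Y" for X Y :: "('q \<Rightarrow> 'q \<Rightarrow> 'a, 'v) rmodule" and g f
  proof -
    interpret X: right_module Inc X by fact
    interpret Y: right_module Inc Y by fact
    note gD = rmod_homD[OF XY(1)] and fD = rmod_homD[OF XY(2)]
    obtain x0 where x0: "x0 \<in> carrier X" "g x0 = f t" using XY(5) fD(1)[OF t(1)] by (metis imageE)
    \<comment> \<open>\<open>x0\<close> need not be fixed by \<open>\<epsilon>\<close>, so the
      factor \<open>\<epsilon>\<close> is built in; by \<open>uniq\<close> it also makes the value
      independent of the chosen \<open>a\<close>.\<close>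
    define h where "h u = x0 \<cdot>\<^bsub>X\<^esub> E m m (\<epsilon> \<otimes>\<^bsub>A\<^esub> (SOME a. a \<in> carrier A \<and> u = t \<cdot>\<^bsub>T\<^esub> E m m a))" for u
    have h: "h (t \<cdot>\<^bsub>T\<^esub> E m m a) = x0 \<cdot>\<^bsub>X\<^esub> E m m (\<epsilon> \<otimes>\<^bsub>A\<^esub> a)" if a: "a \<in> carrier A" for a
    proof -
      have "\<exists>c. c \<in> carrier A \<and> t \<cdot>\<^bsub>T\<^esub> E m m a = t \<cdot>\<^bsub>T\<^esub> E m m c" using a by blast
      from someI_ex[OF this] have "\<epsilon> \<otimes>\<^bsub>A\<^esub> a =
          \<epsilon> \<otimes>\<^bsub>A\<^esub> (SOME c. c \<in> carrier A \<and> t \<cdot>\<^bsub>T\<^esub> E m m a = t \<cdot>\<^bsub>T\<^esub> E m m c)"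
        by (intro uniq[OF a]) blast+
      then show ?thesis unfolding h_def by simp
    qed
    have "restrict h (carrier T) \<in> rmod_hom Inc T X"
    proof (rule rmod_homI)
      fix u assume "u \<in> carrier T"
      then obtain a where a: "a \<in> carrier A" "u = t \<cdot>\<^bsub>T\<^esub> E m m a" using gen by blast
      then show "h u \<in> carrier X" using h x0 Em \<epsilon>_in by (simp add: X.act_closed)
    next
      fix u v assume "u \<in> carrier T" "v \<in> carrier T"
      then obtain a c where a: "a \<in> carrier A" "u = t \<cdot>\<^bsub>T\<^esub> E m m a" and c: "c \<in> carrier A" "v = t \<cdot>\<^bsub>T\<^esub> E m m c"
        using gen by metis
      have "u \<oplus>\<^bsub>T\<^esub> v = t \<cdot>\<^bsub>T\<^esub> E m m (a \<oplus>\<^bsub>A\<^esub> c)" using a c t Em by (simp add: E_add T.act_add)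
      then show "h (u \<oplus>\<^bsub>T\<^esub> v) = h u \<oplus>\<^bsub>X\<^esub> h v"
        using a c h[OF a(1)] h[OF c(1)] h[of "a \<oplus>\<^bsub>A\<^esub> c"] x0 Em \<epsilon>_in by (simp add: A.r_distr E_add X.act_add)
    next
      fix u Z assume u: "u \<in> carrier T" and Z: "Z \<in> carrier Inc"
      then obtain a where a: "a \<in> carrier A" "u = t \<cdot>\<^bsub>T\<^esub> E m m a" using gen by blast
      have Zm: "Z m m \<in> carrier A" using Inc_carrier[OF Z] .
      have "u \<cdot>\<^bsub>T\<^esub> Z = t \<cdot>\<^bsub>T\<^esub> E m m (a \<otimes>\<^bsub>A\<^esub> Z m m)"
        using a Z t(1) Em by (simp add: top_mult flip: T.act_assoc)
      then have "h (u \<cdot>\<^bsub>T\<^esub> Z) = x0 \<cdot>\<^bsub>X\<^esub> E m m (\<epsilon> \<otimes>\<^bsub>A\<^esub> (a \<otimes>\<^bsub>A\<^esub> Z m m))" using h a Zm by simp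
      also have "\<dots> = h u \<cdot>\<^bsub>X\<^esub> Z"
        using a h[OF a(1)] x0 Em \<epsilon>_in Z Zm by (simp add: top_mult A.m_assoc flip: X.act_assoc)
      finally show "h (u \<cdot>\<^bsub>T\<^esub> Z) = h u \<cdot>\<^bsub>X\<^esub> Z" .
    qed (rule Tm)
    moreover have "compose (carrier T) g (restrict h (carrier T)) = f"
    proof (rule rmod_hom_eqI[OF rmod_hom_compose[OF Tm calculation XY(1)] XY(2)])
      fix u assume u: "u \<in> carrier T"
      then obtain a where a: "a \<in> carrier A" "u = t \<cdot>\<^bsub>T\<^esub> E m m a" using gen by blast
      have "g (h u) = f t \<cdot>\<^bsub>Y\<^esub> E m m (\<epsilon> \<otimes>\<^bsub>A\<^esub> a)"
        using a h[OF a(1)] gD(3)[OF x0(1)] x0 Em \<epsilon>_in by simp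
      also have "\<dots> = f (t \<cdot>\<^bsub>T\<^esub> E m m (\<epsilon> \<otimes>\<^bsub>A\<^esub> a))" using fD(3)[OF t(1)] Em \<epsilon>_in a by simp
      also have "\<dots> = f u" using tA[OF \<epsilon>_in a(1)] t\<epsilon> a by simp
      finally show "compose (carrier T) g (restrict h (carrier T)) u = f u" using u by (simp add: compose_def)
    qed
    ultimately show ?thesis by blast
  qed
  then show ?thesis unfolding projective_rmodule_def using Tm by blast
qed

text \<open>Separatedness passes to submodules, in particular to the simple ones. The other
  direction tests projectivity against a copy of the algebra, which is where the size of
  \<open>'v\<close> enters.\<close>

theorem simple_subobjects_projective_iff_separated:
  fixes M :: "('q \<Rightarrow> 'q \<Rightarrow> 'a, 'v) rmodule"
  assumes "infinite (UNIV :: 'v set)" "carrier A \<lesssim> (UNIV :: 'v set)" and M: "right_module Inc M"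
  shows "simple_subobjects_projective (mod_category Inc) M \<longleftrightarrow> separated M"
  unfolding simple_subobjects_projective_mod_category[OF M]
proof
  interpret M: right_module Inc M by fact
  assume "separated M"
  then have "separated (M\<lparr>carrier := S\<rparr>)" if "rsubmodule S Inc M" for S
    using M.rsubmoduleD(1)[OF that] by (auto simp: separated_def)
  then show "\<forall>S. rsubmodule S Inc M \<and> simple_rmodule Inc (M\<lparr>carrier := S\<rparr>) \<longrightarrow> projective_rmodule Inc (M\<lparr>carrier := S\<rparr>)"
    using projective_if_separated by blast
qed (use separated_if_simple_projective[OF carrier_Inc_lepoll[OF assms(1,2)] M] in blast)

end


section \<open>From modules to representations\<close>

lemma (in abelian_monoid) finsum_swap:
  assumes "finite I" "finite J" "\<And>i j. \<lbrakk>i \<in> I; j \<in> J\<rbrakk> \<Longrightarrow> f i j \<in> carrier G"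
  shows "(\<Oplus>i\<in>I. \<Oplus>j\<in>J. f i j) = (\<Oplus>j\<in>J. \<Oplus>i\<in>I. f i j)"
  using assms(1,3)
proof (induction rule: finite_induct)
  case empty
  then show ?case by simp
next
  case (insert a I)
  have 1: "(\<lambda>i. \<Oplus>j\<in>J. f i j) \<in> I \<rightarrow> carrier G" and 2: "(\<Oplus>j\<in>J. f a j) \<in> carrier G"
    using insert.prems by (auto intro!: finsum_closed)
  have "(\<Oplus>i\<in>insert a I. \<Oplus>j\<in>J. f i j) = (\<Oplus>j\<in>J. f a j) \<oplus> (\<Oplus>i\<in>I. \<Oplus>j\<in>J. f i j)"
    using insert.hyps 1 2 by (rule finsum_insert)
  also have "\<dots> = (\<Oplus>j\<in>J. f a j) \<oplus> (\<Oplus>j\<in>J. \<Oplus>i\<in>I. f i j)" using insert by simp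
  also have "\<dots> = (\<Oplus>j\<in>J. f a j \<oplus> (\<Oplus>i\<in>I. f i j))"
    using insert.prems by (intro finsum_addf[symmetric]) (auto intro!: finsum_closed)
  also have "\<dots> = (\<Oplus>j\<in>J. \<Oplus>i\<in>insert a I. f i j)"
    using insert.prems insert.hyps by (intro finsum_cong') (auto intro!: finsum_closed)
  finally show ?case .
qed

section \<open>The representation attached to a module\<close>

context top_incidence
begin

lemma act_E_E:
  assumes M: "right_module Inc M" and x: "x \<in> carrier M" and ij: "(i, j) \<in> s" "a \<in> S i j" and jk: "(j', k) \<in> s" "b \<in> S j' k"
  shows "(x \<cdot>\<^bsub>M\<^esub> E i j a) \<cdot>\<^bsub>M\<^esub> E j' k b = (if j = j' then x \<cdot>\<^bsub>M\<^esub> E i k (a \<otimes>\<^bsub>A\<^esub> b) else \<zero>\<^bsub>M\<^esub>)"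
proof -
  interpret M: right_module Inc M by fact
  have "j \<in> I" using ij s_sub by blast
  then show ?thesis
    using M.act_assoc[OF x E_in[OF ij] E_in[OF jk]] E_mult_E[OF S_carrier[OF ij] S_carrier[OF jk]] x
    by (cases "j = j'") simp_all
qed

text \<open>The module \<open>M e\<^sub>m\<^sub>m\<close>, with \<open>A\<close> acting through the
  entry at \<open>(m, m)\<close>. It is realised on the elements fixed by
  \<open>e\<^sub>m\<^sub>m\<close>, so that it shares elements and addition with
  \<open>M\<close>.\<close>

definition corner :: "('q \<Rightarrow> 'q \<Rightarrow> 'a, 'v) rmodule \<Rightarrow> ('a, 'v) rmodule" where
  "corner M = \<lparr>carrier = {x \<in> carrier M. x \<cdot>\<^bsub>M\<^esub> E m m \<one>\<^bsub>A\<^esub> = x}, mult = mult M, one = one M,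
     zero = zero M, add = add M, act = (\<lambda>x a. x \<cdot>\<^bsub>M\<^esub> E m m a)\<rparr>"

text \<open>The copy inside \<open>corner M\<close> of the vertex space
  \<open>M e\<^sub>i\<^sub>i\<close>: on a separated module and for \<open>i\<close> in
  \<open>I\<close>, right multiplication by \<open>e\<^sub>i\<^sub>m\<close> is injective on that
  space.\<close>

definition vert :: "('q \<Rightarrow> 'q \<Rightarrow> 'a, 'v) rmodule \<Rightarrow> 'q \<Rightarrow> 'v set" where
  "vert M i = (\<lambda>x. x \<cdot>\<^bsub>M\<^esub> E i m \<one>\<^bsub>A\<^esub>) ` carrier M"

lemma corner_simps [simp]: "carrier (corner M) = {x \<in> carrier M. x \<cdot>\<^bsub>M\<^esub> E m m \<one>\<^bsub>A\<^esub> = x}"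
  "add (corner M) = add M" "zero (corner M) = zero M" "act (corner M) x a = x \<cdot>\<^bsub>M\<^esub> E m m a"
  by (simp_all add: corner_def)

lemma S_top_I: "\<lbrakk>i \<in> I; a \<in> carrier A\<rbrakk> \<Longrightarrow> (i, m) \<in> s \<and> a \<in> S i m"
  by (simp add: s_top S_top)

lemma act_E_top_corner:
  assumes M: "right_module Inc M" and x: "x \<in> carrier M" and i: "i \<in> I" and a: "a \<in> carrier A"
  shows "x \<cdot>\<^bsub>M\<^esub> E i m a \<in> carrier (corner M)"
proof -
  interpret M: right_module Inc M by fact
  have "(x \<cdot>\<^bsub>M\<^esub> E i m a) \<cdot>\<^bsub>M\<^esub> E m m \<one>\<^bsub>A\<^esub> = x \<cdot>\<^bsub>M\<^esub> E i m a"
    using act_E_E[OF M x, of i m a m m "\<one>\<^bsub>A\<^esub>"] S_top_I[OF i a] S_top_I[OF m_in A.one_closed] a by simp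
  then show ?thesis using x E_top_in[OF i a] by (simp add: M.act_closed)
qed

lemma corner_act:
  assumes M: "right_module Inc M" and x: "x \<in> carrier (corner M)" and i: "i \<in> I"
  shows "x \<cdot>\<^bsub>M\<^esub> E i m \<one>\<^bsub>A\<^esub> = (if i = m then x else \<zero>\<^bsub>M\<^esub>)"
proof -
  interpret M: right_module Inc M by fact
  have x': "x \<in> carrier M" "x \<cdot>\<^bsub>M\<^esub> E m m \<one>\<^bsub>A\<^esub> = x" using x by auto
  have "(x \<cdot>\<^bsub>M\<^esub> E m m \<one>\<^bsub>A\<^esub>) \<cdot>\<^bsub>M\<^esub> E i m \<one>\<^bsub>A\<^esub> = (if m = i then x \<cdot>\<^bsub>M\<^esub> E m m (\<one>\<^bsub>A\<^esub> \<otimes>\<^bsub>A\<^esub> \<one>\<^bsub>A\<^esub>) else \<zero>\<^bsub>M\<^esub>)"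
    using S_top_I[OF i A.one_closed] S_top_I[OF m_in A.one_closed] by (intro act_E_E[OF M x'(1)]) auto
  then show ?thesis using x' by auto
qed

lemma right_module_corner:
  assumes M: "right_module Inc M"
  shows "right_module A (corner M)"
proof -
  interpret M: right_module Inc M by fact
  have Em: "E m m a \<in> carrier Inc" if "a \<in> carrier A" for a using E_top_in[OF m_in that] .
  have one: "E m m \<one>\<^bsub>A\<^esub> \<in> carrier Inc" using Em by simp
  have "abelian_group (corner M)"
  proof (rule abelian_groupI)
    fix x assume "x \<in> carrier (corner M)"
    then show "\<exists>y\<in>carrier (corner M). y \<oplus>\<^bsub>corner M\<^esub> x = \<zero>\<^bsub>corner M\<^esub>"
      using one by (intro bexI[of _ "\<ominus>\<^bsub>M\<^esub> x"]) (auto simp: M.minus_act M.M.l_neg)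
  qed (use one in \<open>auto simp: M.add_act M.M.a_ac\<close>)
  moreover have "right_module_axioms A (corner M)"
  proof
    fix x a assume "x \<in> carrier (corner M)" "a \<in> carrier A"
    then show "x \<cdot>\<^bsub>corner M\<^esub> a \<in> carrier (corner M)" using act_E_top_corner[OF M _ m_in] by simp
  next
    fix x a b assume x: "x \<in> carrier (corner M)" and ab: "a \<in> carrier A" "b \<in> carrier A"
    then show "x \<cdot>\<^bsub>corner M\<^esub> (a \<oplus>\<^bsub>A\<^esub> b) = x \<cdot>\<^bsub>corner M\<^esub> a \<oplus>\<^bsub>corner M\<^esub> x \<cdot>\<^bsub>corner M\<^esub> b"
      using Em by (simp add: E_add M.act_add)
    show "x \<cdot>\<^bsub>corner M\<^esub> (a \<otimes>\<^bsub>A\<^esub> b) = (x \<cdot>\<^bsub>corner M\<^esub> a) \<cdot>\<^bsub>corner M\<^esub> b"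
      using x act_E_E[OF M, of x m m a m m b] S_top_I[OF m_in] ab by simp
  qed (use Em in \<open>auto simp: M.add_act\<close>)
  ultimately show ?thesis by (intro right_module.intro A.ring_axioms)
qed

lemma vert_corner: "\<lbrakk>right_module Inc M; i \<in> I\<rbrakk> \<Longrightarrow> vert M i \<subseteq> carrier (corner M)"
  unfolding vert_def by (intro image_subsetI act_E_top_corner A.one_closed)

text \<open>The matrix with entry \<open>a\<close> at \<open>(i, m)\<close> factors in two ways: as
  \<open>e\<^sub>i\<^sub>m\<close> times \<open>a\<close> at \<open>(m, m)\<close>, and as
  \<open>a\<close> at \<open>(i, j)\<close> times \<open>e\<^sub>j\<^sub>m\<close>.\<close>

lemma vert_act:
  assumes M: "right_module Inc M" and ij: "(i, j) \<in> s" "a \<in> S i j" and v: "v \<in> vert M i"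
  shows "v \<cdot>\<^bsub>corner M\<^esub> a \<in> vert M j"
proof -
  interpret M: right_module Inc M by fact
  have I: "i \<in> I" "j \<in> I" using ij s_sub by auto
  obtain x where x: "x \<in> carrier M" "v = x \<cdot>\<^bsub>M\<^esub> E i m \<one>\<^bsub>A\<^esub>" using v unfolding vert_def by blast
  have a: "a \<in> carrier A" by (rule S_carrier[OF ij])
  have "v \<cdot>\<^bsub>M\<^esub> E m m a = x \<cdot>\<^bsub>M\<^esub> E i m a"
    using act_E_E[OF M x(1), of i m "\<one>\<^bsub>A\<^esub>" m m a] S_top_I[OF I(1) A.one_closed] S_top_I[OF m_in a] a x by simp
  also have "\<dots> = (x \<cdot>\<^bsub>M\<^esub> E i j a) \<cdot>\<^bsub>M\<^esub> E j m \<one>\<^bsub>A\<^esub>"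
    using act_E_E[OF M x(1) ij, of j m "\<one>\<^bsub>A\<^esub>"] S_top_I[OF I(2) A.one_closed] a by simp
  finally show ?thesis unfolding vert_def using M.act_closed[OF x(1) E_in[OF ij]] by simp
qed

lemma vert_subgroup:
  assumes M: "right_module Inc M" and i: "i \<in> I"
  shows "\<zero>\<^bsub>M\<^esub> \<in> vert M i" "\<And>x y. \<lbrakk>x \<in> vert M i; y \<in> vert M i\<rbrakk> \<Longrightarrow> x \<oplus>\<^bsub>M\<^esub> y \<in> vert M i"
    "\<And>x. x \<in> vert M i \<Longrightarrow> \<ominus>\<^bsub>M\<^esub> x \<in> vert M i"
proof -
  interpret M: right_module Inc M by fact
  have Ei: "E i m \<one>\<^bsub>A\<^esub> \<in> carrier Inc" using E_top_in i by simp
  show "\<zero>\<^bsub>M\<^esub> \<in> vert M i" unfolding vert_def using M.zero_act[OF Ei] M.M.zero_closed by (metis imageI)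
  show "x \<oplus>\<^bsub>M\<^esub> y \<in> vert M i" if "x \<in> vert M i" "y \<in> vert M i" for x y
  proof -
    obtain u v where "u \<in> carrier M" "x = u \<cdot>\<^bsub>M\<^esub> E i m \<one>\<^bsub>A\<^esub>" "v \<in> carrier M" "y = v \<cdot>\<^bsub>M\<^esub> E i m \<one>\<^bsub>A\<^esub>"
      using \<open>x \<in> vert M i\<close> \<open>y \<in> vert M i\<close> unfolding vert_def by blast
    then show ?thesis
      using M.add_act[OF _ _ Ei, of u v, symmetric] M.M.a_closed[of u v] unfolding vert_def by simp
  qed
  show "\<ominus>\<^bsub>M\<^esub> x \<in> vert M i" if "x \<in> vert M i" for x
    using that M.minus_act[OF _ Ei] unfolding vert_def by (auto intro!: image_eqI[OF _ M.M.a_inv_closed])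
qed

lemma corner_hom:
  assumes M: "right_module Inc M" and h: "h \<in> rmod_hom Inc M N"
  shows "restrict h (carrier (corner M)) \<in> rmod_hom A (corner M) (corner N)"
    and "i \<in> I \<Longrightarrow> h ` vert M i \<subseteq> vert N i"
proof -
  interpret M: right_module Inc M by fact
  note hD = rmod_homD[OF h]
  have hE: "h (x \<cdot>\<^bsub>M\<^esub> E i m a) = h x \<cdot>\<^bsub>N\<^esub> E i m a" if "x \<in> carrier M" "i \<in> I" "a \<in> carrier A" for x i a
    using hD(3)[OF that(1) E_top_in[OF that(2,3)]] .
  show "restrict h (carrier (corner M)) \<in> rmod_hom A (corner M) (corner N)"
  proof (rule rmod_homI[OF _ _ _ right_module_corner[OF M]])
    fix x assume x: "x \<in> carrier (corner M)"
    then have "h x \<cdot>\<^bsub>N\<^esub> E m m \<one>\<^bsub>A\<^esub> = h x" using hE[OF _ m_in, of x "\<one>\<^bsub>A\<^esub>"] by simp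
    then show "h x \<in> carrier (corner N)" using x hD(1) by simp
  qed (use hD(2) hE m_in in auto)
  show "h ` vert M i \<subseteq> vert N i" if "i \<in> I"
    using hE[OF _ that A.one_closed] hD(1) unfolding vert_def by auto
qed

lemma separated_eqI:
  assumes M: "right_module Inc M" "separated M" and x: "x \<in> carrier M" and y: "y \<in> carrier M"
    and eq: "\<And>i. i \<in> I \<Longrightarrow> x \<cdot>\<^bsub>M\<^esub> E i m \<one>\<^bsub>A\<^esub> = y \<cdot>\<^bsub>M\<^esub> E i m \<one>\<^bsub>A\<^esub>"
  shows "x = y"
proof -
  interpret M: right_module Inc M by fact
  have "(x \<oplus>\<^bsub>M\<^esub> \<ominus>\<^bsub>M\<^esub> y) \<cdot>\<^bsub>M\<^esub> E i m \<one>\<^bsub>A\<^esub> = \<zero>\<^bsub>M\<^esub>" if "i \<in> I" for i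
    using eq[OF that] x y E_top_in[OF that A.one_closed] by (simp add: M.add_act M.minus_act M.act_closed M.M.r_neg)
  then have "x \<oplus>\<^bsub>M\<^esub> \<ominus>\<^bsub>M\<^esub> y = \<zero>\<^bsub>M\<^esub>" using M(2) x y unfolding separated_def by simp
  then show ?thesis using x y M.M.minus_equality[of x "\<ominus>\<^bsub>M\<^esub> y"] by simp
qed

text \<open>The components of \<open>h x\<close> are the values of \<open>h\<close> at the elements
  \<open>x e\<^sub>i\<^sub>m\<close>, which lie in the corner.\<close>

lemma corner_faithful:
  assumes M: "right_module Inc M" and N: "right_module Inc N" "separated N"
    and h: "h \<in> rmod_hom Inc M N" and k: "k \<in> rmod_hom Inc M N"
    and eq: "restrict h (carrier (corner M)) = restrict k (carrier (corner M))"
  shows "h = k"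
proof (rule rmod_hom_eqI[OF h k])
  fix x assume x: "x \<in> carrier M"
  show "h x = k x"
  proof (rule separated_eqI[OF N rmod_homD(1)[OF h x] rmod_homD(1)[OF k x]])
    fix i assume i: "i \<in> I"
    have "h (x \<cdot>\<^bsub>M\<^esub> E i m \<one>\<^bsub>A\<^esub>) = k (x \<cdot>\<^bsub>M\<^esub> E i m \<one>\<^bsub>A\<^esub>)"
      using fun_cong[OF eq, of "x \<cdot>\<^bsub>M\<^esub> E i m \<one>\<^bsub>A\<^esub>"] act_E_top_corner[OF M x i A.one_closed] by (simp del: corner_simps)
    then show "h x \<cdot>\<^bsub>N\<^esub> E i m \<one>\<^bsub>A\<^esub> = k x \<cdot>\<^bsub>N\<^esub> E i m \<one>\<^bsub>A\<^esub>"
      using rmod_homD(3)[OF h x] rmod_homD(3)[OF k x] E_top_in[OF i A.one_closed] by simp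
  qed
qed

text \<open>Multiplying a preimage of \<open>v i\<close> by \<open>e\<^sub>i\<^sub>i\<close> keeps
  its component at \<open>i\<close> and kills the others, so such elements can be added up:
  components can be prescribed independently.\<close>

lemma exists_with_verts:
  assumes N: "right_module Inc N" and v: "\<And>i. i \<in> I \<Longrightarrow> v i \<in> vert N i"
  obtains y where "y \<in> carrier N" "\<And>i. i \<in> I \<Longrightarrow> y \<cdot>\<^bsub>N\<^esub> E i m \<one>\<^bsub>A\<^esub> = v i"
proof -
  interpret N: right_module Inc N by fact
  have "\<forall>i\<in>I. \<exists>y. y \<in> carrier N \<and> v i = y \<cdot>\<^bsub>N\<^esub> E i m \<one>\<^bsub>A\<^esub>" using v unfolding vert_def by blast
  then obtain y where y: "\<And>i. i \<in> I \<Longrightarrow> y i \<in> carrier N" "\<And>i. i \<in> I \<Longrightarrow> v i = y i \<cdot>\<^bsub>N\<^esub> E i m \<one>\<^bsub>A\<^esub>" by metis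
  have yE: "(\<lambda>i. y i \<cdot>\<^bsub>N\<^esub> E i i \<one>\<^bsub>A\<^esub>) \<in> I \<rightarrow> carrier N" using y(1) E_diag_in N.act_closed by auto
  define z where "z = (\<Oplus>\<^bsub>N\<^esub>i\<in>I. y i \<cdot>\<^bsub>N\<^esub> E i i \<one>\<^bsub>A\<^esub>)"
  have "z \<cdot>\<^bsub>N\<^esub> E j m \<one>\<^bsub>A\<^esub> = v j" if j: "j \<in> I" for j
  proof -
    have Ej: "E j m \<one>\<^bsub>A\<^esub> \<in> carrier Inc" using E_top_in j by simp
    have "z \<cdot>\<^bsub>N\<^esub> E j m \<one>\<^bsub>A\<^esub> = (\<Oplus>\<^bsub>N\<^esub>i\<in>I. (y i \<cdot>\<^bsub>N\<^esub> E i i \<one>\<^bsub>A\<^esub>) \<cdot>\<^bsub>N\<^esub> E j m \<one>\<^bsub>A\<^esub>)"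
      unfolding z_def by (rule N.finsum_act[OF finite_I yE Ej])
    also have "\<dots> = (\<Oplus>\<^bsub>N\<^esub>i\<in>I. if j = i then y i \<cdot>\<^bsub>N\<^esub> E i m \<one>\<^bsub>A\<^esub> else \<zero>\<^bsub>N\<^esub>)"
    proof (rule N.M.finsum_cong')
      fix i assume i: "i \<in> I"
      then show "(y i \<cdot>\<^bsub>N\<^esub> E i i \<one>\<^bsub>A\<^esub>) \<cdot>\<^bsub>N\<^esub> E j m \<one>\<^bsub>A\<^esub> = (if j = i then y i \<cdot>\<^bsub>N\<^esub> E i m \<one>\<^bsub>A\<^esub> else \<zero>\<^bsub>N\<^esub>)"
        using act_E_E[OF N y(1)[OF i] s_refl[OF i] S_one[OF i], of j m "\<one>\<^bsub>A\<^esub>"] S_top_I[OF j A.one_closed] by simp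
    qed (use y E_top_in N.act_closed in auto)
    also have "\<dots> = y j \<cdot>\<^bsub>N\<^esub> E j m \<one>\<^bsub>A\<^esub>"
      using y E_top_in N.act_closed by (intro N.M.finsum_singleton[OF j finite_I]) auto
    finally show ?thesis using y j by simp
  qed
  moreover have "z \<in> carrier N" unfolding z_def by (rule N.M.finsum_closed[OF yE])
  ultimately show ?thesis by (rule that[rotated])
qed

lemma corner_hom_finsum:
  assumes M: "right_module Inc M" and N: "right_module Inc N" and k: "k \<in> rmod_hom A (corner M) (corner N)"
    and "finite J" "f \<in> J \<rightarrow> carrier (corner M)"
  shows "k (finsum M f J) = (\<Oplus>\<^bsub>N\<^esub>j\<in>J. k (f j))" "finsum M f J \<in> carrier (corner M)"
proof -
  interpret M: right_module Inc M by fact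
  interpret N: right_module Inc N by fact
  note kD = rmod_homD[OF k]
  interpret cM: right_module A "corner M" by (rule right_module_corner[OF M])
  have "k (finsum M f J) = (\<Oplus>\<^bsub>N\<^esub>j\<in>J. k (f j)) \<and> finsum M f J \<in> carrier (corner M)"
    using assms(4,5)
  proof (induction rule: finite_induct)
    case empty
    then show ?case
      using rmod_hom_zero[OF right_module_corner[OF M] right_module_corner[OF N] k] cM.M.zero_closed by simp
  next
    case (insert j J)
    have f: "f \<in> J \<rightarrow> carrier (corner M)" "f j \<in> carrier (corner M)" using insert.prems by auto
    have "finsum M f (insert j J) = f j \<oplus>\<^bsub>M\<^esub> finsum M f J"
      using insert.hyps f by (intro M.M.finsum_insert) auto
    moreover have "(\<Oplus>\<^bsub>N\<^esub>j\<in>insert j J. k (f j)) = k (f j) \<oplus>\<^bsub>N\<^esub> (\<Oplus>\<^bsub>N\<^esub>j\<in>J. k (f j))"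
    proof (rule N.M.finsum_insert[OF insert.hyps])
      show "(\<lambda>j. k (f j)) \<in> J \<rightarrow> carrier N" "k (f j) \<in> carrier N" using f kD(1) by auto
    qed
    moreover have "f j \<oplus>\<^bsub>M\<^esub> finsum M f J \<in> carrier (corner M)"
      using cM.M.a_closed[OF f(2)] insert.IH[OF f(1)] by simp
    ultimately show ?case using kD(2)[OF f(2)] insert.IH[OF f(1)] by simp
  qed
  then show "k (finsum M f J) = (\<Oplus>\<^bsub>N\<^esub>j\<in>J. k (f j))" "finsum M f J \<in> carrier (corner M)" by auto
qed

text \<open>\<open>h x\<close> is the element of \<open>N\<close> whose components are the values of
  \<open>k\<close> at the components of \<open>x\<close>. It exists because \<open>k\<close> maps
  \<open>vert M i\<close> into \<open>vert N i\<close>, it is unique because \<open>N\<close> is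
  separated, and linearity is checked on components.\<close>

lemma corner_full:
  assumes M: "right_module Inc M" and N: "right_module Inc N" "separated N"
    and k: "k \<in> rmod_hom A (corner M) (corner N)" and kv: "\<And>i. i \<in> I \<Longrightarrow> k ` vert M i \<subseteq> vert N i"
  shows "\<exists>h\<in>rmod_hom Inc M N. restrict h (carrier (corner M)) = k"
proof -
  interpret M: right_module Inc M by fact
  interpret N: right_module Inc N by fact
  note kD = rmod_homD[OF k]
  have cM: "x \<cdot>\<^bsub>M\<^esub> E i m a \<in> carrier (corner M)" if "x \<in> carrier M" "i \<in> I" "a \<in> carrier A" for x i a
    using act_E_top_corner[OF M that] .
  have EI: "E i m a \<in> carrier Inc" if "i \<in> I" "a \<in> carrier A" for i a using E_top_in[OF that] .
  have "\<exists>y. y \<in> carrier N \<and> (\<forall>i\<in>I. y \<cdot>\<^bsub>N\<^esub> E i m \<one>\<^bsub>A\<^esub> = k (x \<cdot>\<^bsub>M\<^esub> E i m \<one>\<^bsub>A\<^esub>))" if x: "x \<in> carrier M" for x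
  proof -
    have "k (x \<cdot>\<^bsub>M\<^esub> E i m \<one>\<^bsub>A\<^esub>) \<in> vert N i" if "i \<in> I" for i using kv[OF that] x unfolding vert_def by blast
    then obtain y where "y \<in> carrier N" "\<And>i. i \<in> I \<Longrightarrow> y \<cdot>\<^bsub>N\<^esub> E i m \<one>\<^bsub>A\<^esub> = k (x \<cdot>\<^bsub>M\<^esub> E i m \<one>\<^bsub>A\<^esub>)"
      using exists_with_verts[OF N(1), of "\<lambda>i. k (x \<cdot>\<^bsub>M\<^esub> E i m \<one>\<^bsub>A\<^esub>)"] by blast
    then show ?thesis by blast
  qed
  then obtain h where h: "\<And>x. x \<in> carrier M \<Longrightarrow> h x \<in> carrier N"
    "\<And>x i. \<lbrakk>x \<in> carrier M; i \<in> I\<rbrakk> \<Longrightarrow> h x \<cdot>\<^bsub>N\<^esub> E i m \<one>\<^bsub>A\<^esub> = k (x \<cdot>\<^bsub>M\<^esub> E i m \<one>\<^bsub>A\<^esub>)"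
    by metis
  have "restrict h (carrier M) \<in> rmod_hom Inc M N"
  proof (rule rmod_homI[OF h(1) _ _ M])
    fix x y assume x: "x \<in> carrier M" and y: "y \<in> carrier M"
    show "h (x \<oplus>\<^bsub>M\<^esub> y) = h x \<oplus>\<^bsub>N\<^esub> h y"
    proof (rule separated_eqI[OF N])
      fix i assume i: "i \<in> I"
      have "h (x \<oplus>\<^bsub>M\<^esub> y) \<cdot>\<^bsub>N\<^esub> E i m \<one>\<^bsub>A\<^esub> = k (x \<cdot>\<^bsub>M\<^esub> E i m \<one>\<^bsub>A\<^esub> \<oplus>\<^bsub>M\<^esub> y \<cdot>\<^bsub>M\<^esub> E i m \<one>\<^bsub>A\<^esub>)"
        using h(2)[of "x \<oplus>\<^bsub>M\<^esub> y" i] x y i EI by (simp add: M.add_act)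
      also have "\<dots> = k (x \<cdot>\<^bsub>M\<^esub> E i m \<one>\<^bsub>A\<^esub>) \<oplus>\<^bsub>N\<^esub> k (y \<cdot>\<^bsub>M\<^esub> E i m \<one>\<^bsub>A\<^esub>)"
        using kD(2)[OF cM[OF x i A.one_closed] cM[OF y i A.one_closed]] by simp
      also have "\<dots> = (h x \<oplus>\<^bsub>N\<^esub> h y) \<cdot>\<^bsub>N\<^esub> E i m \<one>\<^bsub>A\<^esub>"
        using h[OF x] h[OF y] i EI by (simp add: N.add_act)
      finally show "h (x \<oplus>\<^bsub>M\<^esub> y) \<cdot>\<^bsub>N\<^esub> E i m \<one>\<^bsub>A\<^esub> = (h x \<oplus>\<^bsub>N\<^esub> h y) \<cdot>\<^bsub>N\<^esub> E i m \<one>\<^bsub>A\<^esub>" .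
    qed (use h(1) x y in auto)
  next
    fix x X assume x: "x \<in> carrier M" and X: "X \<in> carrier Inc"
    show "h (x \<cdot>\<^bsub>M\<^esub> X) = h x \<cdot>\<^bsub>N\<^esub> X"
    proof (rule separated_eqI[OF N])
      fix i assume i: "i \<in> I"
      have XA: "X j i \<in> carrier A" for j using Inc_carrier[OF X] .
      have xX: "(x \<cdot>\<^bsub>M\<^esub> E j m \<one>\<^bsub>A\<^esub>) \<cdot>\<^bsub>M\<^esub> E m m (X j i) \<in> carrier (corner M)" if "j \<in> I" for j
        using cM[OF _ m_in XA] M.act_closed[OF x EI[OF that A.one_closed]] by blast
      \<comment> \<open>\<open>act_E_top\<close> expresses a component of \<open>x X\<close> through
        elements of the corner, where \<open>k\<close> is linear over \<open>A\<close>; the same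
        formula in \<open>N\<close> ends the computation.\<close>
      have "h (x \<cdot>\<^bsub>M\<^esub> X) \<cdot>\<^bsub>N\<^esub> E i m \<one>\<^bsub>A\<^esub> = k (\<Oplus>\<^bsub>M\<^esub>j\<in>I. (x \<cdot>\<^bsub>M\<^esub> E j m \<one>\<^bsub>A\<^esub>) \<cdot>\<^bsub>M\<^esub> E m m (X j i))"
        using h(2)[OF M.act_closed[OF x X] i] act_E_top[OF M x X i] by simp
      also have "\<dots> = (\<Oplus>\<^bsub>N\<^esub>j\<in>I. k ((x \<cdot>\<^bsub>M\<^esub> E j m \<one>\<^bsub>A\<^esub>) \<cdot>\<^bsub>M\<^esub> E m m (X j i)))"
        by (rule corner_hom_finsum(1)[OF M N(1) k finite_I]) (use xX in blast)
      also have "\<dots> = (\<Oplus>\<^bsub>N\<^esub>j\<in>I. (h x \<cdot>\<^bsub>N\<^esub> E j m \<one>\<^bsub>A\<^esub>) \<cdot>\<^bsub>N\<^esub> E m m (X j i))"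
      proof (rule N.M.finsum_cong'[OF refl])
        show "(\<lambda>j. (h x \<cdot>\<^bsub>N\<^esub> E j m \<one>\<^bsub>A\<^esub>) \<cdot>\<^bsub>N\<^esub> E m m (X j i)) \<in> I \<rightarrow> carrier N"
          using h(1)[OF x] EI XA m_in N.act_closed by auto
        fix j assume j: "j \<in> I"
        show "k ((x \<cdot>\<^bsub>M\<^esub> E j m \<one>\<^bsub>A\<^esub>) \<cdot>\<^bsub>M\<^esub> E m m (X j i)) = (h x \<cdot>\<^bsub>N\<^esub> E j m \<one>\<^bsub>A\<^esub>) \<cdot>\<^bsub>N\<^esub> E m m (X j i)"
          using kD(3)[OF cM[OF x j A.one_closed] XA] h(2)[OF x j] by simp
      qed
      also have "\<dots> = (h x \<cdot>\<^bsub>N\<^esub> X) \<cdot>\<^bsub>N\<^esub> E i m \<one>\<^bsub>A\<^esub>" using act_E_top[OF N(1) h(1)[OF x] X i] by simp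
      finally show "h (x \<cdot>\<^bsub>M\<^esub> X) \<cdot>\<^bsub>N\<^esub> E i m \<one>\<^bsub>A\<^esub> = (h x \<cdot>\<^bsub>N\<^esub> X) \<cdot>\<^bsub>N\<^esub> E i m \<one>\<^bsub>A\<^esub>" .
    qed (use h(1) x X M.act_closed N.act_closed in auto)
  qed
  moreover have "restrict (restrict h (carrier M)) (carrier (corner M)) = k"
  proof (rule extensionalityI[OF restrict_extensional kD(4)])
    fix x assume x: "x \<in> carrier (corner M)"
    have xM: "x \<in> carrier M" using x by simp
    have "h x = k x"
    proof (rule separated_eqI[OF N])
      show "k x \<in> carrier N" using kD(1)[OF x] by simp
      fix i assume i: "i \<in> I"
      show "h x \<cdot>\<^bsub>N\<^esub> E i m \<one>\<^bsub>A\<^esub> = k x \<cdot>\<^bsub>N\<^esub> E i m \<one>\<^bsub>A\<^esub>"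
        using h(2)[OF xM i] corner_act[OF M x i] corner_act[OF N(1) kD(1)[OF x] i]
          rmod_hom_zero[OF right_module_corner[OF M] right_module_corner[OF N(1)] k] by simp
    qed (use h(1) xM in auto)
    then show "restrict (restrict h (carrier M)) (carrier (corner M)) x = k x" using x by simp
  qed
  ultimately show ?thesis by blast
qed

text \<open>Row vectors with entry \<open>i\<close> in \<open>V i\<close>, on which matrices act by
  multiplication from the right. The vectors are \<open>undefined\<close> outside \<open>I\<close>,
  so that equality of functions is equality of entries.\<close>

definition family_module :: "('a, 'v) rmodule \<Rightarrow> ('q \<Rightarrow> 'v set) \<Rightarrow> ('q \<Rightarrow> 'q \<Rightarrow> 'a, 'q \<Rightarrow> 'v) rmodule" where
  "family_module L V = \<lparr>carrier = Pi\<^sub>E I V, mult = undefined, one = undefined, zero = (\<lambda>i\<in>I. \<zero>\<^bsub>L\<^esub>),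
     add = (\<lambda>v w. \<lambda>i\<in>I. v i \<oplus>\<^bsub>L\<^esub> w i), act = (\<lambda>v X. \<lambda>j\<in>I. \<Oplus>\<^bsub>L\<^esub>i\<in>I. v i \<cdot>\<^bsub>L\<^esub> X i j)\<rparr>"

text \<open>A representation with the whole of \<open>L\<close> placed at the index
  \<open>m\<close>. Closure under scalars is contained in the last condition, because
  \<open>S i i\<close> contains the scalar multiples of the unit.\<close>

definition representation :: "('a, 'v) rmodule \<Rightarrow> ('q \<Rightarrow> 'v set) \<Rightarrow> bool" where
  "representation L V \<longleftrightarrow> right_module A L \<and> V m = carrier L \<and> (\<forall>i\<in>I. subgroup (V i) (add_monoid L)) \<and>
     (\<forall>(i, j)\<in>s. \<forall>x\<in>V i. \<forall>a\<in>S i j. x \<cdot>\<^bsub>L\<^esub> a \<in> V j)"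

section \<open>Row vectors over a representation as a module\<close>

context
  fixes L :: "('a, 'v) rmodule" and V :: "'q \<Rightarrow> 'v set"
  assumes rep: "representation L V"
begin

interpretation L: right_module A L using rep unfolding representation_def by blast

lemma V_subgroup:
  assumes "i \<in> I"
  shows "V i \<subseteq> carrier L" "\<zero>\<^bsub>L\<^esub> \<in> V i" "\<And>x y. \<lbrakk>x \<in> V i; y \<in> V i\<rbrakk> \<Longrightarrow> x \<oplus>\<^bsub>L\<^esub> y \<in> V i"
    "\<And>x. x \<in> V i \<Longrightarrow> \<ominus>\<^bsub>L\<^esub> x \<in> V i"
proof -
  have g: "subgroup (V i) (add_monoid L)" using rep assms unfolding representation_def by blast
  show "V i \<subseteq> carrier L" "\<zero>\<^bsub>L\<^esub> \<in> V i" "\<And>x y. \<lbrakk>x \<in> V i; y \<in> V i\<rbrakk> \<Longrightarrow> x \<oplus>\<^bsub>L\<^esub> y \<in> V i"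
    "\<And>x. x \<in> V i \<Longrightarrow> \<ominus>\<^bsub>L\<^esub> x \<in> V i"
    using subgroup.subset[OF g] subgroup.one_closed[OF g] subgroup.m_closed[OF g] subgroup.m_inv_closed[OF g]
    by (auto simp: a_inv_def)
qed

lemma V_finsum:
  assumes i: "i \<in> I" and "finite J" "f \<in> J \<rightarrow> V i"
  shows "finsum L f J \<in> V i"
  using assms(2,3)
proof (induction J rule: finite_induct)
  case empty
  then show ?case using V_subgroup(2)[OF i] by simp
next
  case (insert j J)
  have "finsum L f (insert j J) = f j \<oplus>\<^bsub>L\<^esub> finsum L f J"
    using insert V_subgroup(1)[OF i] by (intro L.M.finsum_insert) auto
  then show ?case using insert V_subgroup(3)[OF i] by auto
qed

lemma family_entry: "\<lbrakk>v \<in> Pi\<^sub>E I V; X \<in> carrier Inc; i \<in> I; j \<in> I\<rbrakk> \<Longrightarrow> v i \<cdot>\<^bsub>L\<^esub> X i j \<in> V j"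
proof (cases "(i, j) \<in> s")
  case True
  assume "v \<in> Pi\<^sub>E I V" "X \<in> carrier Inc" "i \<in> I"
  then show ?thesis using rep Inc_entry[OF _ True] True unfolding representation_def by (auto simp: PiE_iff)
next
  case False
  assume v: "v \<in> Pi\<^sub>E I V" "X \<in> carrier Inc" "i \<in> I" "j \<in> I"
  then have "v i \<in> carrier L" using V_subgroup(1)[OF v(3)] by (auto simp: PiE_iff)
  then show ?thesis using Inc_outside[OF v(2) False] V_subgroup(2)[OF v(4)] by simp
qed

lemma V_carrier: "\<lbrakk>i \<in> I; x \<in> V i\<rbrakk> \<Longrightarrow> x \<in> carrier L"
  using V_subgroup(1) by blast

lemma family_simps: "carrier (family_module L V) = Pi\<^sub>E I V" "\<zero>\<^bsub>family_module L V\<^esub> = (\<lambda>i\<in>I. \<zero>\<^bsub>L\<^esub>)"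
  "v \<oplus>\<^bsub>family_module L V\<^esub> w = (\<lambda>i\<in>I. v i \<oplus>\<^bsub>L\<^esub> w i)"
  "v \<cdot>\<^bsub>family_module L V\<^esub> X = (\<lambda>j\<in>I. \<Oplus>\<^bsub>L\<^esub>i\<in>I. v i \<cdot>\<^bsub>L\<^esub> X i j)"
  by (simp_all add: family_module_def)

lemma family_L: "\<lbrakk>v \<in> Pi\<^sub>E I V; i \<in> I\<rbrakk> \<Longrightarrow> v i \<in> carrier L"
  using V_carrier by (auto simp: PiE_iff)

lemma family_eqI: "\<lbrakk>v \<in> Pi\<^sub>E I V; w \<in> Pi\<^sub>E I V; \<And>i. i \<in> I \<Longrightarrow> v i = w i\<rbrakk> \<Longrightarrow> v = w"
  by (rule PiE_ext)

text \<open>Associativity is the interchange of two finite sums. The action stays inside the family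
  because \<open>V i\<close> times an entry at \<open>(i, j)\<close> lies in
  \<open>V j\<close>.\<close>

lemma right_module_family: "right_module Inc (family_module L V)"
proof -
  let ?F = "family_module L V"
  have act: "v \<cdot>\<^bsub>?F\<^esub> X \<in> Pi\<^sub>E I V" if "v \<in> Pi\<^sub>E I V" "X \<in> carrier Inc" for v X
    unfolding family_simps restrict_PiE_iff
  proof
    fix j assume j: "j \<in> I"
    show "(\<Oplus>\<^bsub>L\<^esub>i\<in>I. v i \<cdot>\<^bsub>L\<^esub> X i j) \<in> V j"
      using family_entry[OF that _ j] by (intro V_finsum[OF j finite_I]) auto
  qed
  have add: "v \<oplus>\<^bsub>?F\<^esub> w \<in> Pi\<^sub>E I V" if "v \<in> Pi\<^sub>E I V" "w \<in> Pi\<^sub>E I V" for v w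
    using that V_subgroup(3) by (auto simp: family_simps PiE_iff)
  have XA: "X i j \<in> carrier A" if "X \<in> carrier Inc" for X i j using Inc_carrier[OF that] .
  have "abelian_group ?F"
  proof (rule abelian_groupI)
    fix v assume v: "v \<in> carrier ?F"
    have "(\<lambda>i\<in>I. \<ominus>\<^bsub>L\<^esub> v i) \<in> carrier ?F" using v V_subgroup(4) by (auto simp: family_simps PiE_iff)
    moreover have "(\<lambda>i\<in>I. \<ominus>\<^bsub>L\<^esub> v i) \<oplus>\<^bsub>?F\<^esub> v = \<zero>\<^bsub>?F\<^esub>"
      using v family_L by (auto simp: family_simps L.M.l_neg fun_eq_iff restrict_def)
    ultimately show "\<exists>w\<in>carrier ?F. w \<oplus>\<^bsub>?F\<^esub> v = \<zero>\<^bsub>?F\<^esub>" by blast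
  next
    fix v assume v: "v \<in> carrier ?F"
    show "\<zero>\<^bsub>?F\<^esub> \<oplus>\<^bsub>?F\<^esub> v = v"
      using v family_L by (auto simp: family_simps fun_eq_iff restrict_def PiE_def extensional_def)
  next
    fix u v w assume uvw: "u \<in> carrier ?F" "v \<in> carrier ?F" "w \<in> carrier ?F"
    then show "(u \<oplus>\<^bsub>?F\<^esub> v) \<oplus>\<^bsub>?F\<^esub> w = u \<oplus>\<^bsub>?F\<^esub> (v \<oplus>\<^bsub>?F\<^esub> w)"
      using family_L by (auto simp: family_simps fun_eq_iff restrict_def L.M.a_assoc)
  next
    fix u v assume "u \<in> carrier ?F" "v \<in> carrier ?F"
    then show "u \<oplus>\<^bsub>?F\<^esub> v = v \<oplus>\<^bsub>?F\<^esub> u"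
      using family_L by (auto simp: family_simps fun_eq_iff restrict_def L.M.a_comm)
  qed (use add V_subgroup(2) in \<open>auto simp: family_simps(1,2)\<close>)
  moreover have "right_module_axioms Inc ?F"
  proof
    fix v X assume "v \<in> carrier ?F" "X \<in> carrier Inc"
    then show "v \<cdot>\<^bsub>?F\<^esub> X \<in> carrier ?F" using act by (simp add: family_simps(1))
  next
    fix v X Y assume v: "v \<in> carrier ?F" and X: "X \<in> carrier Inc" and Y: "Y \<in> carrier Inc"
    have vL: "v i \<in> carrier L" if "i \<in> I" for i using v that family_L by (simp add: family_simps(1))
    show "v \<cdot>\<^bsub>?F\<^esub> (X \<oplus>\<^bsub>Inc\<^esub> Y) = v \<cdot>\<^bsub>?F\<^esub> X \<oplus>\<^bsub>?F\<^esub> v \<cdot>\<^bsub>?F\<^esub> Y"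
    proof (rule family_eqI)
      fix j assume j: "j \<in> I"
      have "(\<Oplus>\<^bsub>L\<^esub>i\<in>I. v i \<cdot>\<^bsub>L\<^esub> (X i j \<oplus>\<^bsub>A\<^esub> Y i j)) = (\<Oplus>\<^bsub>L\<^esub>i\<in>I. v i \<cdot>\<^bsub>L\<^esub> X i j \<oplus>\<^bsub>L\<^esub> v i \<cdot>\<^bsub>L\<^esub> Y i j)"
        using vL XA[OF X] XA[OF Y] L.act_closed by (intro L.M.finsum_cong') (auto simp: L.act_add)
      also have "\<dots> = (\<Oplus>\<^bsub>L\<^esub>i\<in>I. v i \<cdot>\<^bsub>L\<^esub> X i j) \<oplus>\<^bsub>L\<^esub> (\<Oplus>\<^bsub>L\<^esub>i\<in>I. v i \<cdot>\<^bsub>L\<^esub> Y i j)"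
        using vL XA[OF X] XA[OF Y] L.act_closed by (intro L.M.finsum_addf) auto
      finally show "(v \<cdot>\<^bsub>?F\<^esub> (X \<oplus>\<^bsub>Inc\<^esub> Y)) j = (v \<cdot>\<^bsub>?F\<^esub> X \<oplus>\<^bsub>?F\<^esub> v \<cdot>\<^bsub>?F\<^esub> Y) j"
        using j by (simp add: family_simps add_Inc)
    qed (use act add v X Y Inc.a_closed in \<open>auto simp: family_simps(1)\<close>)
    show "v \<cdot>\<^bsub>?F\<^esub> (X \<otimes>\<^bsub>Inc\<^esub> Y) = (v \<cdot>\<^bsub>?F\<^esub> X) \<cdot>\<^bsub>?F\<^esub> Y"
    proof (rule family_eqI)
      fix j assume j: "j \<in> I"
      have "(\<Oplus>\<^bsub>L\<^esub>i\<in>I. v i \<cdot>\<^bsub>L\<^esub> (\<Oplus>\<^bsub>A\<^esub>l\<in>I. X i l \<otimes>\<^bsub>A\<^esub> Y l j))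
          = (\<Oplus>\<^bsub>L\<^esub>i\<in>I. \<Oplus>\<^bsub>L\<^esub>l\<in>I. (v i \<cdot>\<^bsub>L\<^esub> X i l) \<cdot>\<^bsub>L\<^esub> Y l j)"
      proof (rule L.M.finsum_cong'[OF refl])
        show "(\<lambda>i. \<Oplus>\<^bsub>L\<^esub>l\<in>I. (v i \<cdot>\<^bsub>L\<^esub> X i l) \<cdot>\<^bsub>L\<^esub> Y l j) \<in> I \<rightarrow> carrier L"
          using vL XA[OF X] XA[OF Y] L.act_closed by (auto intro!: L.M.finsum_closed)
        fix i assume i: "i \<in> I"
        have "v i \<cdot>\<^bsub>L\<^esub> (\<Oplus>\<^bsub>A\<^esub>l\<in>I. X i l \<otimes>\<^bsub>A\<^esub> Y l j) = (\<Oplus>\<^bsub>L\<^esub>l\<in>I. v i \<cdot>\<^bsub>L\<^esub> (X i l \<otimes>\<^bsub>A\<^esub> Y l j))"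
          using vL[OF i] XA[OF X] XA[OF Y] by (intro L.act_finsum[OF finite_I]) auto
        also have "\<dots> = (\<Oplus>\<^bsub>L\<^esub>l\<in>I. (v i \<cdot>\<^bsub>L\<^esub> X i l) \<cdot>\<^bsub>L\<^esub> Y l j)"
          using vL[OF i] XA[OF X] XA[OF Y] L.act_closed by (intro L.M.finsum_cong') (auto simp: L.act_assoc)
        finally show "v i \<cdot>\<^bsub>L\<^esub> (\<Oplus>\<^bsub>A\<^esub>l\<in>I. X i l \<otimes>\<^bsub>A\<^esub> Y l j) = (\<Oplus>\<^bsub>L\<^esub>l\<in>I. (v i \<cdot>\<^bsub>L\<^esub> X i l) \<cdot>\<^bsub>L\<^esub> Y l j)" .
      qed
      also have "\<dots> = (\<Oplus>\<^bsub>L\<^esub>l\<in>I. \<Oplus>\<^bsub>L\<^esub>i\<in>I. (v i \<cdot>\<^bsub>L\<^esub> X i l) \<cdot>\<^bsub>L\<^esub> Y l j)"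
        using vL XA[OF X] XA[OF Y] L.act_closed by (intro L.M.finsum_swap finite_I) auto
      also have "\<dots> = (\<Oplus>\<^bsub>L\<^esub>l\<in>I. (\<Oplus>\<^bsub>L\<^esub>i\<in>I. v i \<cdot>\<^bsub>L\<^esub> X i l) \<cdot>\<^bsub>L\<^esub> Y l j)"
      proof (rule L.M.finsum_cong'[OF refl])
        show "(\<lambda>l. (\<Oplus>\<^bsub>L\<^esub>i\<in>I. v i \<cdot>\<^bsub>L\<^esub> X i l) \<cdot>\<^bsub>L\<^esub> Y l j) \<in> I \<rightarrow> carrier L"
          using vL XA[OF X] XA[OF Y] by (auto intro!: L.M.finsum_closed L.act_closed)
        fix l
        show "(\<Oplus>\<^bsub>L\<^esub>i\<in>I. (v i \<cdot>\<^bsub>L\<^esub> X i l) \<cdot>\<^bsub>L\<^esub> Y l j) = (\<Oplus>\<^bsub>L\<^esub>i\<in>I. v i \<cdot>\<^bsub>L\<^esub> X i l) \<cdot>\<^bsub>L\<^esub> Y l j"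
          using vL XA[OF X] XA[OF Y] by (intro L.finsum_act[OF finite_I, symmetric]) (auto intro!: L.act_closed)
      qed
      also have "\<dots> = (\<Oplus>\<^bsub>L\<^esub>l\<in>I. (v \<cdot>\<^bsub>?F\<^esub> X) l \<cdot>\<^bsub>L\<^esub> Y l j)"
        using vL XA[OF X] XA[OF Y]
        by (intro L.M.finsum_cong') (auto simp: family_simps intro!: L.M.finsum_closed L.act_closed)
      finally show "(v \<cdot>\<^bsub>?F\<^esub> (X \<otimes>\<^bsub>Inc\<^esub> Y)) j = ((v \<cdot>\<^bsub>?F\<^esub> X) \<cdot>\<^bsub>?F\<^esub> Y) j"
        using j by (simp add: family_simps(4) mult_Inc)
    qed (use act v X Y Inc.m_closed in \<open>auto simp: family_simps(1)\<close>)
  next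
    fix v w X assume v: "v \<in> carrier ?F" and w: "w \<in> carrier ?F" and X: "X \<in> carrier Inc"
    have vL: "v i \<in> carrier L" "w i \<in> carrier L" if "i \<in> I" for i using v w that family_L by (simp_all add: family_simps(1))
    show "(v \<oplus>\<^bsub>?F\<^esub> w) \<cdot>\<^bsub>?F\<^esub> X = v \<cdot>\<^bsub>?F\<^esub> X \<oplus>\<^bsub>?F\<^esub> w \<cdot>\<^bsub>?F\<^esub> X"
    proof (rule family_eqI)
      fix j assume j: "j \<in> I"
      have "(\<Oplus>\<^bsub>L\<^esub>i\<in>I. (\<lambda>i\<in>I. v i \<oplus>\<^bsub>L\<^esub> w i) i \<cdot>\<^bsub>L\<^esub> X i j) = (\<Oplus>\<^bsub>L\<^esub>i\<in>I. v i \<cdot>\<^bsub>L\<^esub> X i j \<oplus>\<^bsub>L\<^esub> w i \<cdot>\<^bsub>L\<^esub> X i j)"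
        using vL XA[OF X] L.act_closed by (intro L.M.finsum_cong') (auto simp: L.add_act)
      also have "\<dots> = (\<Oplus>\<^bsub>L\<^esub>i\<in>I. v i \<cdot>\<^bsub>L\<^esub> X i j) \<oplus>\<^bsub>L\<^esub> (\<Oplus>\<^bsub>L\<^esub>i\<in>I. w i \<cdot>\<^bsub>L\<^esub> X i j)"
        using vL XA[OF X] L.act_closed by (intro L.M.finsum_addf) auto
      finally show "((v \<oplus>\<^bsub>?F\<^esub> w) \<cdot>\<^bsub>?F\<^esub> X) j = (v \<cdot>\<^bsub>?F\<^esub> X \<oplus>\<^bsub>?F\<^esub> w \<cdot>\<^bsub>?F\<^esub> X) j"
        using j by (simp add: family_simps)
    qed (use act add v w X in \<open>auto simp: family_simps(1)\<close>)
  next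
    fix v assume v: "v \<in> carrier ?F"
    have vL: "v i \<in> carrier L" if "i \<in> I" for i using v that family_L by (simp add: family_simps(1))
    show "v \<cdot>\<^bsub>?F\<^esub> \<one>\<^bsub>Inc\<^esub> = v"
    proof (rule family_eqI)
      fix j assume j: "j \<in> I"
      have "(\<Oplus>\<^bsub>L\<^esub>i\<in>I. v i \<cdot>\<^bsub>L\<^esub> \<one>\<^bsub>Inc\<^esub> i j) = (\<Oplus>\<^bsub>L\<^esub>i\<in>I. if j = i then v i else \<zero>\<^bsub>L\<^esub>)"
        using vL by (intro L.M.finsum_cong') (auto simp: one_Inc L.act_one)
      also have "\<dots> = v j" using vL by (intro L.M.finsum_singleton[OF j finite_I]) auto
      finally show "(v \<cdot>\<^bsub>?F\<^esub> \<one>\<^bsub>Inc\<^esub>) j = v j" using j by (simp add: family_simps)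
    qed (use act v Inc.one_closed in \<open>auto simp: family_simps(1)\<close>)
  qed
  ultimately show ?thesis by (intro right_module.intro Inc.ring_axioms)
qed

lemma family_act_E:
  assumes v: "v \<in> Pi\<^sub>E I V" and i: "i \<in> I" and a: "a \<in> carrier A"
  shows "v \<cdot>\<^bsub>family_module L V\<^esub> E i m a = (\<lambda>j\<in>I. if j = m then v i \<cdot>\<^bsub>L\<^esub> a else \<zero>\<^bsub>L\<^esub>)"
proof
  fix j
  show "(v \<cdot>\<^bsub>family_module L V\<^esub> E i m a) j = (\<lambda>j\<in>I. if j = m then v i \<cdot>\<^bsub>L\<^esub> a else \<zero>\<^bsub>L\<^esub>) j"
  proof (cases "j \<in> I")
    case True
    have "(\<Oplus>\<^bsub>L\<^esub>k\<in>I. v k \<cdot>\<^bsub>L\<^esub> E i m a k j) = (\<Oplus>\<^bsub>L\<^esub>k\<in>I. if i = k then (if j = m then v k \<cdot>\<^bsub>L\<^esub> a else \<zero>\<^bsub>L\<^esub>) else \<zero>\<^bsub>L\<^esub>)"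
      using family_L[OF v] a by (intro L.M.finsum_cong') (auto simp: E_def L.act_closed)
    also have "\<dots> = (if j = m then v i \<cdot>\<^bsub>L\<^esub> a else \<zero>\<^bsub>L\<^esub>)"
      using family_L[OF v] a by (intro L.M.finsum_singleton[OF i finite_I]) (auto simp: L.act_closed)
    finally show ?thesis using True by (simp add: family_simps)
  qed (simp add: family_simps)
qed

end

end


lemma (in top_incidence) vert_top:
  assumes M: "right_module Inc M"
  shows "vert M m = carrier (corner M)"
proof
  show "vert M m \<subseteq> carrier (corner M)" by (rule vert_corner[OF M m_in])
  show "carrier (corner M) \<subseteq> vert M m" unfolding vert_def by (auto intro: image_eqI[OF sym])
qed

text \<open>On row vectors, multiplication by \<open>e\<^sub>i\<^sub>m\<close> moves entry
  \<open>i\<close> to place \<open>m\<close> and erases the rest. So the corner consists of the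
  vectors supported at \<open>m\<close>, and \<open>u\<close> reads off their entry there. Row
  vectors are not elements of \<open>'v\<close>, hence \<open>M\<close> is a copy of their
  module.\<close>

lemma (in top_incidence) corner_ess_surj:
  fixes L :: "('a, 'v) rmodule"
  assumes inf: "infinite (UNIV :: 'v set)" and rep: "representation L V"
  obtains M :: "('q \<Rightarrow> 'q \<Rightarrow> 'a, 'v) rmodule" and u where "right_module Inc M" "separated M"
    "u \<in> rmod_hom A (corner M) L" "bij_betw u (carrier (corner M)) (carrier L)"
    "\<And>i. i \<in> I \<Longrightarrow> u ` vert M i = V i"
proof -
  let ?F = "family_module L V"
  have L: "right_module A L" and Vm: "V m = carrier L" using rep unfolding representation_def by blast+
  interpret L: right_module A L by fact
  have F: "right_module Inc ?F" by (rule right_module_family[OF rep])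
  interpret F: right_module Inc ?F by fact
  have "Pi\<^sub>E I V \<lesssim> (I \<rightarrow>\<^sub>E (UNIV :: 'v set))" by (rule subset_imp_lepoll[OF PiE_mono]) simp
  also have "\<dots> \<lesssim> (UNIV :: 'v set)" by (rule PiE_lepoll_infinite[OF finite_I inf])
  finally obtain f :: "('q \<Rightarrow> 'v) \<Rightarrow> 'v" where f: "inj_on f (carrier ?F)"
    unfolding lepoll_def family_simps(1)[OF rep] by blast
  define M where "M = transport_rmodule f ?F"
  note tr = transport_rmodule[OF F f, folded M_def]
  have M: "right_module Inc M" by (rule tr(1))
  have bij: "bij_betw (restrict f (carrier ?F)) (carrier ?F) (carrier M)" using f tr(3) by (simp add: bij_betw_def)
  define g where "g = restrict (inv_into (carrier ?F) (restrict f (carrier ?F))) (carrier M)"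
  have g: "g \<in> rmod_hom Inc M ?F" unfolding g_def by (rule rmod_hom_inv_into[OF F tr(1,2) bij])
  have "bij_betw (inv_into (carrier ?F) (restrict f (carrier ?F))) (carrier M) (carrier ?F)"
    by (rule bij_betw_inv_into[OF bij])
  then have bijg: "bij_betw g (carrier M) (carrier ?F)" unfolding g_def by (simp add: bij_betw_def)
  note gD = rmod_homD[OF g]
  have gP: "g x \<in> Pi\<^sub>E I V" if "x \<in> carrier M" for x using gD(1)[OF that] by (simp add: family_simps[OF rep])
  have gL: "g x i \<in> carrier L" if "x \<in> carrier M" "i \<in> I" for x i using family_L[OF rep gP[OF that(1)] that(2)] .
  have inj: "inj_on g (carrier M)" using bijg by (simp add: bij_betw_def)
  have surj: "\<exists>x\<in>carrier M. g x = v" if "v \<in> Pi\<^sub>E I V" for v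
  proof -
    have "v \<in> g ` carrier M" using bijg that unfolding bij_betw_def family_simps(1)[OF rep] by simp
    then show ?thesis by blast
  qed
  have gE: "g (x \<cdot>\<^bsub>M\<^esub> E i m a) j = (if j = m then g x i \<cdot>\<^bsub>L\<^esub> a else \<zero>\<^bsub>L\<^esub>)"
    if "x \<in> carrier M" "i \<in> I" "j \<in> I" "a \<in> carrier A" for x i j a
    using gD(3)[OF that(1) E_top_in[OF that(2,4)]] family_act_E[OF rep gP[OF that(1)] that(2,4)] that(3) by simp
  interpret M: right_module Inc M by (rule M)
  have sep: "separated M"
    unfolding separated_def
  proof (intro ballI impI)
    fix x assume x: "x \<in> carrier M" and z: "\<forall>i\<in>I. x \<cdot>\<^bsub>M\<^esub> E i m \<one>\<^bsub>A\<^esub> = \<zero>\<^bsub>M\<^esub>"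
    have g0: "g \<zero>\<^bsub>M\<^esub> = \<zero>\<^bsub>?F\<^esub>" by (rule rmod_hom_zero[OF M F g])
    have "g x = g \<zero>\<^bsub>M\<^esub>"
    proof (rule family_eqI[OF rep gP[OF x] gP[OF M.M.zero_closed]])
      fix i assume i: "i \<in> I"
      have "g x i = g (x \<cdot>\<^bsub>M\<^esub> E i m \<one>\<^bsub>A\<^esub>) m" using gE[OF x i m_in A.one_closed] gL[OF x i] by (simp add: L.act_one)
      also have "\<dots> = g \<zero>\<^bsub>M\<^esub> i" using z i m_in by (simp add: g0 family_simps[OF rep])
      finally show "g x i = g \<zero>\<^bsub>M\<^esub> i" .
    qed
    then show "x = \<zero>\<^bsub>M\<^esub>" using inj_onD[OF inj _ x M.M.zero_closed] by blast
  qed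
  define u where "u = restrict (\<lambda>x. g x m) (carrier (corner M))"
  have u: "u \<in> rmod_hom A (corner M) L"
    unfolding u_def
  proof (rule rmod_homI[OF _ _ _ right_module_corner[OF M]])
    fix x y assume "x \<in> carrier (corner M)" "y \<in> carrier (corner M)"
    then show "g (x \<oplus>\<^bsub>corner M\<^esub> y) m = g x m \<oplus>\<^bsub>L\<^esub> g y m" using gD(2) m_in by (simp add: family_simps[OF rep])
  next
    fix x a assume "x \<in> carrier (corner M)" "a \<in> carrier A"
    then show "g (x \<cdot>\<^bsub>corner M\<^esub> a) m = g x m \<cdot>\<^bsub>L\<^esub> a" using gE[OF _ m_in m_in] by simp
  qed (use gL m_in in simp)
  \<comment> \<open>Under \<open>u\<close>, the component of \<open>x\<close> at \<open>i\<close>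
    becomes entry \<open>i\<close> of its row vector; this identifies \<open>vert M i\<close> with
    \<open>V i\<close>.\<close>
  have uE: "u (x \<cdot>\<^bsub>M\<^esub> E i m \<one>\<^bsub>A\<^esub>) = g x i" if "x \<in> carrier M" "i \<in> I" for x i
    unfolding u_def using act_E_top_corner[OF M that A.one_closed] gE[OF that m_in A.one_closed] gL[OF that]
    by (simp add: L.act_one del: corner_simps)
  have uV: "u ` vert M i = V i" if i: "i \<in> I" for i
  proof
    show "u ` vert M i \<subseteq> V i" using uE[OF _ i] gP i unfolding vert_def by (auto simp: PiE_iff)
    show "V i \<subseteq> u ` vert M i"
    proof
      fix l assume l: "l \<in> V i"
      \<comment> \<open>The vector whose only nonzero entry can be \<open>l\<close> at place
        \<open>i\<close> is a preimage of \<open>l\<close>.\<close>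
      have "(\<lambda>j\<in>I. if j = i then l else \<zero>\<^bsub>L\<^esub>) \<in> Pi\<^sub>E I V" using l V_subgroup(2)[OF rep] by auto
      then obtain x where x: "x \<in> carrier M" "g x = (\<lambda>j\<in>I. if j = i then l else \<zero>\<^bsub>L\<^esub>)" using surj by blast
      then have "u (x \<cdot>\<^bsub>M\<^esub> E i m \<one>\<^bsub>A\<^esub>) = l" using uE i by simp
      then show "l \<in> u ` vert M i" unfolding vert_def using x(1) by blast
    qed
  qed
  have "inj_on u (carrier (corner M))"
  proof (rule inj_onI)
    fix x y assume x: "x \<in> carrier (corner M)" and y: "y \<in> carrier (corner M)" and eq: "u x = u y"
    have xy: "x \<in> carrier M" "y \<in> carrier M" using x y by auto
    have "x \<cdot>\<^bsub>M\<^esub> E m m \<one>\<^bsub>A\<^esub> = x" "y \<cdot>\<^bsub>M\<^esub> E m m \<one>\<^bsub>A\<^esub> = y" using x y by auto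
    \<comment> \<open>An element fixed by \<open>e\<^sub>m\<^sub>m\<close> has a row vector that
      vanishes outside place \<open>m\<close>, so the value of \<open>u\<close> determines
      it.\<close>
    then have gm: "g z j = (if j = m then g z m \<cdot>\<^bsub>L\<^esub> \<one>\<^bsub>A\<^esub> else \<zero>\<^bsub>L\<^esub>)" if "z \<in> {x, y}" "j \<in> I" for z j
      using gE[OF _ m_in that(2) A.one_closed, of z] that(1) xy by auto
    have "g x = g y"
      using gm eq x y by (intro family_eqI[OF rep gP[OF xy(1)] gP[OF xy(2)]]) (simp add: u_def)
    then show "x = y" using inj_onD[OF inj _ xy] by blast
  qed
  moreover have "u ` carrier (corner M) = carrier L"
    using uV[OF m_in] vert_top[OF M] Vm by simp
  ultimately have "bij_betw u (carrier (corner M)) (carrier L)" by (simp add: bij_betw_def)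
  then show ?thesis using that M sep u uV by blast
qed


section \<open>The equivalence\<close>

lemma rep_category_ObD:
  assumes "(L, V) \<in> Ob (rep_category P r K A \<T>)"
  shows "right_module A L" "\<And>i. i \<in> P \<Longrightarrow> subgroup (V i) (add_monoid L)" "\<And>i. i \<in> P \<Longrightarrow> V i \<subseteq> carrier L"
proof -
  show "right_module A L" and V: "\<And>i. i \<in> P \<Longrightarrow> subgroup (V i) (add_monoid L)"
    using assms by (auto simp: rep_category_def rmod_subspace_def)
  show "V i \<subseteq> carrier L" if "i \<in> P" for i using subgroup.subset[OF V[OF that]] by simp
qed

lemma category_rep_category: "category (rep_category P r K A \<T>)"
proof -
  interpret C: category "mod_category A" by (rule category_mod_category)
  show ?thesis
  proof
    fix X assume "X \<in> Ob (rep_category P r K A \<T>)"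
    then obtain L V where X: "X = (L, V)" "right_module A L" "\<And>i. i \<in> P \<Longrightarrow> V i \<subseteq> carrier L"
      using rep_category_ObD by (metis surj_pair)
    then show "Id (rep_category P r K A \<T>) X \<in> Hom (rep_category P r K A \<T>) X X"
      using C.Id_in[of L] by (auto simp: rep_category_def subset_iff)
  next
    fix X Y Z f g assume XYZ: "X \<in> Ob (rep_category P r K A \<T>)" "Y \<in> Ob (rep_category P r K A \<T>)" "Z \<in> Ob (rep_category P r K A \<T>)"
      and f: "f \<in> Hom (rep_category P r K A \<T>) X Y" and g: "g \<in> Hom (rep_category P r K A \<T>) Y Z"
    obtain L V where X: "X = (L, V)" "right_module A L" "\<And>i. i \<in> P \<Longrightarrow> V i \<subseteq> carrier L"
      using XYZ(1) rep_category_ObD by (metis surj_pair)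
    obtain M W N U where Y: "Y = (M, W)" "Z = (N, U)" by (metis surj_pair)
    have fg: "f \<in> rmod_hom A L M" "\<And>i. i \<in> P \<Longrightarrow> f ` V i \<subseteq> W i" "g \<in> rmod_hom A M N" "\<And>i. i \<in> P \<Longrightarrow> g ` W i \<subseteq> U i"
      using f g X Y by (auto simp: rep_category_def)
    have "compose (carrier L) g f ` V i \<subseteq> U i" if "i \<in> P" for i
    proof (rule image_subsetI)
      fix x assume "x \<in> V i"
      then show "compose (carrier L) g f x \<in> U i"
        using X(3)[OF that] fg(2,4)[OF that] by (auto simp: compose_def)
    qed
    then show "Comp (rep_category P r K A \<T>) X Y Z g f \<in> Hom (rep_category P r K A \<T>) X Z"
      using rmod_hom_compose[OF X(2) fg(1,3)] X Y by (simp add: rep_category_def)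
  next
    fix X Y f assume XY: "X \<in> Ob (rep_category P r K A \<T>)" "Y \<in> Ob (rep_category P r K A \<T>)"
      and f: "f \<in> Hom (rep_category P r K A \<T>) X Y"
    obtain L V M W where X: "X = (L, V)" "Y = (M, W)" by (metis surj_pair)
    then show "Comp (rep_category P r K A \<T>) X X Y f (Id (rep_category P r K A \<T>) X) = f"
      "Comp (rep_category P r K A \<T>) X Y Y (Id (rep_category P r K A \<T>) Y) f = f"
      using C.Comp_Id[of L M f] C.Id_Comp[of L M f] XY f by (auto simp: rep_category_def)
  next
    fix W X Y Z f g h assume o: "W \<in> Ob (rep_category P r K A \<T>)" "X \<in> Ob (rep_category P r K A \<T>)"
        "Y \<in> Ob (rep_category P r K A \<T>)" "Z \<in> Ob (rep_category P r K A \<T>)"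
      and fgh: "f \<in> Hom (rep_category P r K A \<T>) W X" "g \<in> Hom (rep_category P r K A \<T>) X Y" "h \<in> Hom (rep_category P r K A \<T>) Y Z"
    obtain L1 V1 L2 V2 L3 V3 L4 V4 where X: "W = (L1, V1)" "X = (L2, V2)" "Y = (L3, V3)" "Z = (L4, V4)"
      by (metis surj_pair)
    then show "Comp (rep_category P r K A \<T>) W Y Z h (Comp (rep_category P r K A \<T>) W X Y g f) =
       Comp (rep_category P r K A \<T>) W X Z (Comp (rep_category P r K A \<T>) X Y Z h g) f"
      using C.Comp_assoc[of L1 L2 L3 L4 f g h] o fgh by (auto simp: rep_category_def)
  qed
qed

text \<open>That \<open>u\<close> maps \<open>V i\<close> onto \<open>W i\<close>, and not merely
  into it, is what makes the inverse map preserve the subspaces.\<close>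

lemma iso_arrow_rep_category:
  assumes o: "(L, V) \<in> Ob (rep_category P r K A \<T>)" "(M, W) \<in> Ob (rep_category P r K A \<T>)"
    and u: "u \<in> rmod_hom A L M" "bij_betw u (carrier L) (carrier M)" "\<And>i. i \<in> P \<Longrightarrow> u ` V i = W i"
  shows "iso_arrow (rep_category P r K A \<T>) (L, V) (M, W) u"
proof -
  have L: "right_module A L" and M: "right_module A M" and V: "\<And>i. i \<in> P \<Longrightarrow> V i \<subseteq> carrier L"
    using rep_category_ObD[OF o(1)] rep_category_ObD[OF o(2)] by auto
  obtain v where v: "v \<in> rmod_hom A M L" "compose (carrier L) v u = restrict id (carrier L)"
    "compose (carrier M) u v = restrict id (carrier M)"
    using iso_arrow_mod_category[OF L M, of u] u by (auto simp: iso_arrow_def)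
  have "v ` W i \<subseteq> V i" if i: "i \<in> P" for i
  proof
    fix y assume "y \<in> v ` W i"
    then have "y \<in> v ` u ` V i" using u(3)[OF i] by simp
    then obtain x where x: "x \<in> V i" "y = v (u x)" by blast
    then show "y \<in> V i" using fun_cong[OF v(2), of x] V[OF i] by (auto simp: compose_def subset_iff)
  qed
  then show ?thesis
    unfolding iso_arrow_def using u v by (auto simp: rep_category_def intro!: bexI[of _ v])
qed

text \<open>The part of the hypotheses that concerns \<open>\<T>\<close> and its extension by a top
  element. That the extended incidence algebra is a ring comes from the Morita hypothesis.\<close>

locale extended_poset = fin_dim_algebra K A
  for K :: "('k, 'c) ring_scheme" and A :: "('k, 'a) module" +
  fixes P :: "'p set" and r :: "'p rel" and \<T> :: "'p \<Rightarrow> 'p \<Rightarrow> 'a set"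
  assumes poset: "finite_poset P r" and mult: "multiplicative_system P r K A \<T>"
    and unital: "i \<in> P \<Longrightarrow> subring (\<T> i i) A"
    and ring_top: "ring (incidence_algebra (top_carrier P) (top_order P r) A (top_system A \<T>))"
begin

lemma r_sub: "r \<subseteq> P \<times> P" and r_refl: "i \<in> P \<Longrightarrow> (i, i) \<in> r"
  using poset unfolding finite_poset_def partial_order_on_def preorder_on_def refl_on_def by auto

lemma \<T>_sub: "(i, j) \<in> r \<Longrightarrow> submodule (\<T> i j) K A"
  using mult unfolding multiplicative_system_def by blast

lemma submodule_carrier: "submodule (carrier A) K A"
  by (rule submoduleI) auto

sublocale top_incidence K A "top_carrier P" "top_order P r" None "top_system A \<T>"
proof (intro top_incidence.intro top_incidence_axioms.intro)
  show "finite (top_carrier P)" using poset by (simp add: finite_poset_def top_carrier_def)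
  show "top_order P r \<subseteq> top_carrier P \<times> top_carrier P" using r_sub by (auto simp: top_order_def top_carrier_def)
  show "(i, i) \<in> top_order P r" if "i \<in> top_carrier P" for i
    using that r_refl by (auto simp: top_order_def top_carrier_def)
  show "submodule (top_system A \<T> i j) K A" if "(i, j) \<in> top_order P r" for i j
    using that \<T>_sub submodule_carrier by (auto simp: top_order_def)
  show "\<one>\<^bsub>A\<^esub> \<in> top_system A \<T> i i" if "i \<in> top_carrier P" for i
    using that subringE(3)[OF unital] by (auto simp: top_carrier_def)
qed (use ring_top fin_dim_algebra_axioms in \<open>auto simp: top_order_def top_carrier_def\<close>)

lemma local_one_\<T>: "i \<in> P \<Longrightarrow> local_one A \<T> i = \<one>\<^bsub>A\<^esub>"
  using local_one_eq[of "Some i"] by (simp add: local_one_def top_carrier_def)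

text \<open>Closure of \<open>vert M (Some i)\<close> under negation and under scalars is an
  instance of \<open>vert_act\<close>, since \<open>\<T> i i\<close> contains minus one and all
  scalar multiples of the unit.\<close>

lemma corner_in_Rep:
  assumes M: "right_module Inc M"
  shows "(corner M, \<lambda>i. vert M (Some i)) \<in> Ob (rep_category P r K A \<T>)"
proof -
  have cM: "right_module A (corner M)" by (rule right_module_corner[OF M])
  interpret cM: right_module A "corner M" by (rule cM)
  have I: "Some i \<in> top_carrier P" "(Some i, Some i) \<in> top_order P r" "\<one>\<^bsub>A\<^esub> \<in> \<T> i i" if "i \<in> P" for i
    using that r_refl subringE(3)[OF unital] by (auto simp: top_carrier_def top_order_def)
  have act: "x \<cdot>\<^bsub>corner M\<^esub> a \<in> vert M (Some j)" if "(i, j) \<in> r" "a \<in> \<T> i j" "x \<in> vert M (Some i)" for i j a x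
    using vert_act[OF M, of "Some i" "Some j" a x] that by (simp add: top_order_def)
  have vC: "x \<in> carrier (corner M)" if "i \<in> P" "x \<in> vert M (Some i)" for i x
    using vert_corner[OF M I(1)] that by blast
  have "subgroup (vert M (Some i)) (add_monoid (corner M))" if i: "i \<in> P" for i
  proof
    show "vert M (Some i) \<subseteq> carrier (add_monoid (corner M))" using vC[OF i] by auto
    fix x assume x: "x \<in> vert M (Some i)"
    have "\<ominus>\<^bsub>A\<^esub> \<one>\<^bsub>A\<^esub> \<in> \<T> i i" using subringE(5)[OF unital[OF i] I(3)[OF i]] .
    then have "\<ominus>\<^bsub>corner M\<^esub> x \<in> vert M (Some i)"
      using act[OF r_refl[OF i] _ x] cM.act_minus_one[OF vC[OF i x]] by metis
    then show "inv\<^bsub>add_monoid (corner M)\<^esub> x \<in> vert M (Some i)" by (simp add: a_inv_def)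
  qed (use vert_subgroup(1,2)[OF M I(1)[OF i]] in auto)
  moreover have "k \<odot>\<^bsub>A\<^esub> \<one>\<^bsub>A\<^esub> \<in> \<T> i i" if "i \<in> P" "k \<in> carrier K" for i k
    using submoduleE(4)[OF \<T>_sub[OF r_refl[OF that(1)]] that(2) I(3)[OF that(1)]] .
  moreover have "x \<cdot>\<^bsub>corner M\<^esub> local_one A \<T> i = x" if "i \<in> P" "x \<in> vert M (Some i)" for i x
    using local_one_\<T>[OF that(1)] cM.act_one[OF vC[OF that]] by simp
  ultimately show ?thesis
    using cM act r_refl by (simp add: rep_category_def rmod_subspace_def del: corner_simps) blast
qed

lemma rep_representation:
  assumes "(L, V) \<in> Ob (rep_category P r K A \<T>)"
  shows "representation L (case_option (carrier L) V)"
proof -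
  have L: "right_module A L" and V: "\<And>i. i \<in> P \<Longrightarrow> subgroup (V i) (add_monoid L)"
    and act: "\<And>i j x a. \<lbrakk>(i, j) \<in> r; x \<in> V i; a \<in> \<T> i j\<rbrakk> \<Longrightarrow> x \<cdot>\<^bsub>L\<^esub> a \<in> V j"
    using assms unfolding rep_category_def rmod_subspace_def by auto
  interpret L: right_module A L by fact
  have VL: "V i \<subseteq> carrier L" if "i \<in> P" for i using subgroup.subset[OF V[OF that]] by simp
  have "subgroup (carrier L) (add_monoid L)" using L.M.add.subgroup_self by simp
  then show ?thesis
    unfolding representation_def using L V VL act
    by (auto simp: top_carrier_def top_order_def L.act_closed subset_iff)
qed

text \<open>Faithfulness and fullness come from separatedness of the target. The infinite element
  type serves essential surjectivity, where row vectors have to be copied into it.\<close>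

lemma weak_equivalence_corner:
  assumes inf: "infinite (UNIV :: 'v set)"
  shows "weak_equivalence
    (full_subcategory (mod_category Inc) separated :: (('p option \<Rightarrow> 'p option \<Rightarrow> 'a, 'v) rmodule, 'v \<Rightarrow> 'v) cat)
    (rep_category P r K A \<T>)
    (\<lambda>M. (corner M, \<lambda>i. vert M (Some i))) (\<lambda>M N h. restrict h (carrier (corner M)))"
proof -
  interpret C: category "full_subcategory (mod_category Inc) separated
      :: (('p option \<Rightarrow> 'p option \<Rightarrow> 'a, 'v) rmodule, 'v \<Rightarrow> 'v) cat"
    by (rule category_full_subcategory[OF category_mod_category])
  interpret D: category "rep_category P r K A \<T> :: (('a, 'v) rmodule \<times> ('p \<Rightarrow> 'v set), 'v \<Rightarrow> 'v) cat"
    by (rule category_rep_category)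
  have Some_in: "Some i \<in> top_carrier P" if "i \<in> P" for i using that by (simp add: top_carrier_def)
  show ?thesis
  proof
    fix M :: "('p option \<Rightarrow> 'p option \<Rightarrow> 'a, 'v) rmodule"
    assume "M \<in> Ob (full_subcategory (mod_category Inc) separated)"
    then have M: "right_module Inc M" by simp
    show "(corner M, \<lambda>i. vert M (Some i)) \<in> Ob (rep_category P r K A \<T>)" by (rule corner_in_Rep[OF M])
    show "restrict (Id (full_subcategory (mod_category Inc) separated) M) (carrier (corner M))
        = Id (rep_category P r K A \<T>) (corner M, \<lambda>i. vert M (Some i))"
      by (auto simp: rep_category_def fun_eq_iff)
  next
    fix M N :: "('p option \<Rightarrow> 'p option \<Rightarrow> 'a, 'v) rmodule" and h
    assume "M \<in> Ob (full_subcategory (mod_category Inc) separated)"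
      "h \<in> Hom (full_subcategory (mod_category Inc) separated) M N"
    then have M: "right_module Inc M" and h: "h \<in> rmod_hom Inc M N" by simp_all
    have "restrict h (carrier (corner M)) ` vert M (Some i) \<subseteq> vert N (Some i)" if "i \<in> P" for i
      using corner_hom(2)[OF M h Some_in[OF that]] vert_corner[OF M Some_in[OF that]] by auto
    then show "restrict h (carrier (corner M)) \<in> Hom (rep_category P r K A \<T>)
        (corner M, \<lambda>i. vert M (Some i)) (corner N, \<lambda>i. vert N (Some i))"
      using corner_hom(1)[OF M h] by (simp add: rep_category_def del: corner_simps)
  next
    fix M N Q :: "('p option \<Rightarrow> 'p option \<Rightarrow> 'a, 'v) rmodule" and h k
    assume "M \<in> Ob (full_subcategory (mod_category Inc) separated)"
      "h \<in> Hom (full_subcategory (mod_category Inc) separated) M N"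
    then have "restrict h (carrier (corner M)) \<in> rmod_hom A (corner M) (corner N)"
      using corner_hom(1)[of M h N] by simp
    then have "h x \<in> carrier (corner N)" if "x \<in> carrier (corner M)" for x
      using rmod_homD(1) that by fastforce
    then show "restrict (Comp (full_subcategory (mod_category Inc) separated) M N Q k h) (carrier (corner M))
        = Comp (rep_category P r K A \<T>) (corner M, \<lambda>i. vert M (Some i)) (corner N, \<lambda>i. vert N (Some i))
          (corner Q, \<lambda>i. vert Q (Some i)) (restrict k (carrier (corner N))) (restrict h (carrier (corner M)))"
      by (auto simp: rep_category_def fun_eq_iff compose_def)
  next
    fix M N :: "('p option \<Rightarrow> 'p option \<Rightarrow> 'a, 'v) rmodule" and h k
    assume "M \<in> Ob (full_subcategory (mod_category Inc) separated)" "N \<in> Ob (full_subcategory (mod_category Inc) separated)"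
      "h \<in> Hom (full_subcategory (mod_category Inc) separated) M N" "k \<in> Hom (full_subcategory (mod_category Inc) separated) M N"
      "restrict h (carrier (corner M)) = restrict k (carrier (corner M))"
    then show "h = k" using corner_faithful[of M N h k] by (simp del: corner_simps)
  next
    fix M N :: "('p option \<Rightarrow> 'p option \<Rightarrow> 'a, 'v) rmodule" and k
    assume "M \<in> Ob (full_subcategory (mod_category Inc) separated)" "N \<in> Ob (full_subcategory (mod_category Inc) separated)"
      and k: "k \<in> Hom (rep_category P r K A \<T>) (corner M, \<lambda>i. vert M (Some i)) (corner N, \<lambda>i. vert N (Some i))"
    then have M: "right_module Inc M" and N: "right_module Inc N" "separated N" by simp_all
    have k': "k \<in> rmod_hom A (corner M) (corner N)" "\<And>i. i \<in> P \<Longrightarrow> k ` vert M (Some i) \<subseteq> vert N (Some i)"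
      using k by (auto simp: rep_category_def)
    \<comment> \<open>At the top index the condition is automatic, since \<open>vert M None\<close>
      is the whole corner; an arrow of representations gives it on \<open>P\<close>.\<close>
    have "k ` vert M i \<subseteq> vert N i" if "i \<in> top_carrier P" for i
    proof (cases i)
      case None
      then show ?thesis using vert_top[OF M] vert_top[OF N(1)] rmod_homD(1)[OF k'(1)] by (auto simp del: corner_simps)
    next
      case (Some j)
      then show ?thesis using k'(2) that by (auto simp: top_carrier_def)
    qed
    then show "\<exists>h\<in>Hom (full_subcategory (mod_category Inc) separated) M N. restrict h (carrier (corner M)) = k"
      using corner_full[OF M N k'(1)] by (simp del: corner_simps)
  next
    fix Y :: "('a, 'v) rmodule \<times> ('p \<Rightarrow> 'v set)"
    assume Y: "Y \<in> Ob (rep_category P r K A \<T>)"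
    obtain L V where LV: "Y = (L, V)" by (cases Y)
    obtain M :: "('p option \<Rightarrow> 'p option \<Rightarrow> 'a, 'v) rmodule" and u where M: "right_module Inc M" "separated M"
      and u: "u \<in> rmod_hom A (corner M) L" "bij_betw u (carrier (corner M)) (carrier L)"
        "\<And>i. i \<in> top_carrier P \<Longrightarrow> u ` vert M i = (case i of None \<Rightarrow> carrier L | Some j \<Rightarrow> V j)"
      using corner_ess_surj[OF inf rep_representation[OF Y[unfolded LV]]] by blast
    have "iso_arrow (rep_category P r K A \<T>) (corner M, \<lambda>i. vert M (Some i)) (L, V) u"
      using u(3)[OF Some_in] by (intro iso_arrow_rep_category[OF corner_in_Rep[OF M(1)] Y[unfolded LV] u(1,2)]) simp
    then show "\<exists>M\<in>Ob (full_subcategory (mod_category Inc) separated).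
        \<exists>u. iso_arrow (rep_category P r K A \<T>) (corner M, \<lambda>i. vert M (Some i)) Y u"
      using M LV by auto
  qed
qed

end

theorem theorem22:
  fixes P :: "'p set" and r :: "'p rel"
    and K :: "('k, 'c) ring_scheme" and A :: "('k, 'a) module"
    and \<T> :: "'p \<Rightarrow> 'p \<Rightarrow> 'a set" and \<R> :: "'p option \<Rightarrow> 'p option \<Rightarrow> 'a set"
  assumes "infinite (UNIV :: 'v set)" and "carrier A \<lesssim> (UNIV :: 'v set)"
    and "extendable_with TYPE('v) P r K A \<T> \<R>"
  shows "equivalent_categories
    (socle_projective_category (incidence_algebra (top_carrier P) (top_order P r) A \<R>)
      :: (('p option \<Rightarrow> 'p option \<Rightarrow> 'a, 'v) rmodule, 'v \<Rightarrow> 'v) cat)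
    (rep_category P r K A \<T> :: (('a, 'v) rmodule \<times> ('p \<Rightarrow> 'v set), 'v \<Rightarrow> 'v) cat)"
proof -
  let ?\<Lambda> = "incidence_algebra (top_carrier P) (top_order P r) A \<R>"
  let ?\<Lambda>' = "incidence_algebra (top_carrier P) (top_order P r) A (top_system A \<T>)"
  note ext = assms(3)[unfolded extendable_with_def]
  have "\<exists>e. (\<forall>i\<in>top_carrier P. e i \<in> top_system A \<T> i i \<and> e i \<otimes>\<^bsub>A\<^esub> e i = e i) \<and>
      unique_simple_rmodule A (principal_rmodule A (e None)) \<and>
      (\<forall>(i, j)\<in>top_order P r. \<R> i j = {e i \<otimes>\<^bsub>A\<^esub> t \<otimes>\<^bsub>A\<^esub> e j | t. t \<in> top_system A \<T> i j})"
    using ext by (elim conjE) assumption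
  then obtain e where e: "\<And>i. i \<in> top_carrier P \<Longrightarrow> e i \<in> top_system A \<T> i i \<and> e i \<otimes>\<^bsub>A\<^esub> e i = e i"
    and simple: "unique_simple_rmodule A (principal_rmodule A (e None))" by auto
  have aep: "algebraically_equipped_poset P r K A \<T>" and ss: "semisimple_ring A"
    and sub: "\<And>i. i \<in> P \<Longrightarrow> subring (\<T> i i) A" and mor: "morita_equivalent TYPE('v) ?\<Lambda> ?\<Lambda>'"
    using ext by auto
  have fin: "fin_dim_algebra K A" using aep unfolding algebraically_equipped_poset_def by blast
  have ring: "ring ?\<Lambda>'" using mor unfolding morita_equivalent_def by blast
  interpret extended_poset K A P r \<T>
    by (intro extended_poset.intro extended_poset_axioms.intro fin ring sub)
      (use aep in \<open>auto simp: algebraically_equipped_poset_def\<close>)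
  \<comment> \<open>\<open>e None\<close> is the idempotent \<open>\<epsilon>\<^sub>m\<close> that
    generates the simple \<open>A\<close>-module.\<close>
  interpret simple_top_incidence K A "top_carrier P" "top_order P r" None "top_system A \<T>" "e None"
    by standard (use e[of None] ss simple in \<open>auto simp: top_carrier_def\<close>)
  obtain Fo Fm where "weak_equivalence
      (mod_category ?\<Lambda> :: (('p option \<Rightarrow> 'p option \<Rightarrow> 'a, 'v) rmodule, 'v \<Rightarrow> 'v) cat)
      (mod_category ?\<Lambda>' :: (('p option \<Rightarrow> 'p option \<Rightarrow> 'a, 'v) rmodule, 'v \<Rightarrow> 'v) cat) Fo Fm"
    using mor equivalent_categories_imp_weak_equivalence unfolding morita_equivalent_def by blast
  then interpret F: weak_equivalence
      "mod_category ?\<Lambda> :: (('p option \<Rightarrow> 'p option \<Rightarrow> 'a, 'v) rmodule, 'v \<Rightarrow> 'v) cat"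
      "mod_category ?\<Lambda>' :: (('p option \<Rightarrow> 'p option \<Rightarrow> 'a, 'v) rmodule, 'v \<Rightarrow> 'v) cat" Fo Fm .
  have "weak_equivalence (full_subcategory (mod_category ?\<Lambda>) (socle_projective ?\<Lambda>))
      (full_subcategory (mod_category ?\<Lambda>') separated) Fo Fm"
  proof (rule weak_equivalence_full_subcategory[OF F.weak_equivalence_axioms])
    fix X Y u assume X: "X \<in> Ob (mod_category ?\<Lambda>)" and Y: "Y \<in> Ob (mod_category ?\<Lambda>')"
      and u: "iso_arrow (mod_category ?\<Lambda>') (Fo X) Y u"
    \<comment> \<open>The condition is restated with simple subobjects, carried along the Morita
      functor up to isomorphism, and recognised on the other side as separatedness.\<close>
    have "socle_projective ?\<Lambda> X \<longleftrightarrow> simple_subobjects_projective (mod_category ?\<Lambda>) X"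
      using X socle_projective_iff simple_subobjects_projective_mod_category by simp blast
    also have "\<dots> \<longleftrightarrow> simple_subobjects_projective (mod_category ?\<Lambda>') Y"
      by (rule F.simple_subobjects_projective_iff[OF X Y u])
    also have "\<dots> \<longleftrightarrow> separated Y"
      using simple_subobjects_projective_iff_separated[OF assms(1,2)] Y by simp
    finally show "socle_projective ?\<Lambda> X \<longleftrightarrow> separated Y" .
  qed
  \<comment> \<open>The restricted Morita functor is followed by the corner functor; a quasi-inverse
    is chosen for the composite.\<close>
  from weak_equivalence.equivalent_categories[OF weak_equivalence_compose[OF this weak_equivalence_corner[OF assms(1)]]]
  show ?thesis unfolding socle_projective_category_def .
qed

end
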